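(* Let $\mathcal B=(B_g)_{g\in G}$ be a Fell bundle over a discrete group $G$ and let $\psi$ be a state on $B_e$. Suppose that $(\mathcal B,\psi)$ has the Haagerup property. Then $(B_e,\psi)$ has the Haagerup property.
   Context: **Fell bundles.** A Fell bundle $\mathcal B=(B_g)_{g\in G}$ over a discrete group $G$ (with unit $e$) is a family of Banach spaces (their disjoint union is also denoted $\mathcal B$) with an associative multiplication $\mathcal B\times\mathcal B\to\mathcal B$ such that $B_gB_h\subseteq B_{gh}$, bilinear on each $B_g\times B_h$, $\|ab\|\le\|a\|\|b\|$, and an involutive anti-multiplicative map $b\mapsto b^*$ which is conjugate-linear and isometric from $B_g$ onto $B_{g^{-1}}$, such that $\|b^*b\|=\|b\|^2$ and $b^*b\ge 0$ in the $C^*$-algebra $B_e$ for all $b\in\mathcal B$. **Bundle maps.** A $\mathcal B$-bundle map is a family $T=(T_g)_{g\in G}$ of bounded linear maps $T_g:B_g\to B_g$. It is positive definite if $\sum_{i,j=1}^n b_i\,T_{g_i^{-1}g_j}(a_i^*a_j)\,b_j^*\ge 0$ in $B_e$ for all $n\in\mathbb N$, $g_1,\dots,g_n\in G$ and $a_i,b_i\in B_{g_i}$. **Haagerup property of $(\mathcal B,\psi)$.** For $g\in G$, $\|b\|_{g,\psi}:=\psi(b^*b)^{1/2}$ for $b\in B_g$, $N_{g,\psi}=\{b\in B_g:\psi(b^*b)=0\}$, and $H_{g,\psi}$ is the Hilbert space completion of $B_g/N_{g,\psi}$ for the inner product induced by $\langle b,c\rangle=\psi(b^*c)$. If $T$ is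 a positive definite $\mathcal B$-bundle map with $\psi\circ T_e\le M\psi$ (on positive elements) for some $M>0$, then for each $g$ the assignment $b+N_{g,\psi}\mapsto T_g(b)+N_{g,\psi}$ extends to a bounded operator $\widetilde{T_g}$ on $H_{g,\psi}$; $T$ is compact w.r.t. $\psi$ if every $\widetilde{T_g}$ is a compact operator. The pair $(\mathcal B,\psi)$ has the Haagerup property if there is a net $\{T^i\}_{i\in I}$ of positive definite $\mathcal B$-bundle maps such that: (i) $T^i_e$ is contractive and $\psi\circ T^i_e\le\psi$ for every $i$; (ii) $T^i$ is compact w.r.t. $\psi$ for every $i$; (iii) $g\mapsto\|\widetilde{T^i_g}\|$ vanishes at infinity on $G$ for each $i$; (iv) $\lim_i\|T_g^i(b)-b\|_{g,\psi}=0$ for every $g\in G$, $b\in B_g$. **Haagerup property of $(A,\varphi)$.** Let $\varphi$ be a state on a $C^*$-algebra $A$, $H_\varphi$ its GNS Hilbert space (completion of $A/\{a:\varphi(a^*a)=0\}$ for $\langle a,b\rangle=\varphi(a^*b)$), $[a]_\varphi$ the class of $a$. For a contractive completely positive $\Phi:A\to A$ with $\varphi\circ\Phi\le\varphi$, $S_\Phi$ is the contraction on $H_\varphi$ with $S_\Phi[a]_\varphi=[\Phi(a)]_\varphi$. $(A,\varphi)$ has the Haagerup property if there is a net $\{\Phi_i\}$ of contractive completely positive maps on $A$ with (a) $\varphi\circ\Phi_i\le\varphi$; (b) each $S_{\Phi_i}$ is compact; (c) $S_{\Phi_i}\to I$ in the strong operator topology. *)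

theory Defs
  imports "HOL-Analysis.Analysis" "HOL-Algebra.Module" "HOL-Library.Complex_Order"
begin

section \<open>Complex normed spaces on explicit carriers\<close>

text \<open>
  The fibres of a Fell bundle are different spaces indexed by a variable group element, so spaces
  are records with a carrier, built on the modules of HOL-Algebra. The components \<open>mult\<close> and \<open>one\<close>
  inherited from that record carry no meaning, except that \<open>mult\<close> is the product of a
  $C^*$-algebra; the algebras are not assumed to be unital.
\<close>

definition complex_ring :: "complex ring" where
  "complex_ring = \<lparr>carrier = UNIV, mult = (*), one = 1, zero = 0, add = (+)\<rparr>"

record 'v normed_space = "(complex, 'v) module" +
  vnorm :: "'v \<Rightarrow> real"

text \<open>
  \<^locale>\<open>Metric_space\<close> requires a distance that is non-negative and symmetric on the whole type, hence
  the value 0 outside the carrier.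
\<close>

definition vdist :: "('v, 'm) normed_space_scheme \<Rightarrow> 'v \<Rightarrow> 'v \<Rightarrow> real" where
  "vdist V x y = (if x \<in> carrier V \<and> y \<in> carrier V then vnorm V (x \<ominus>\<^bsub>V\<^esub> y) else 0)"

abbreviation vtopology :: "('v, 'm) normed_space_scheme \<Rightarrow> 'v topology" where
  "vtopology V \<equiv> Metric_space.mtopology (carrier V) (vdist V)"

abbreviation unit_ball :: "('v, 'm) normed_space_scheme \<Rightarrow> 'v set" where
  "unit_ball V \<equiv> {x \<in> carrier V. vnorm V x \<le> 1}"

locale complex_banach_space =
  Module.module complex_ring V for V :: "('v, 'm) normed_space_scheme" (structure) +
  assumes norm_nonneg: "x \<in> carrier V \<Longrightarrow> 0 \<le> vnorm V x"
    and norm_eq_zero: "x \<in> carrier V \<Longrightarrow> vnorm V x = 0 \<longleftrightarrow> x = \<zero>"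
    and norm_triangle: "\<lbrakk>x \<in> carrier V; y \<in> carrier V\<rbrakk> \<Longrightarrow> vnorm V (x \<oplus> y) \<le> vnorm V x + vnorm V y"
    and norm_smult: "x \<in> carrier V \<Longrightarrow> vnorm V (c \<odot> x) = cmod c * vnorm V x"
    and complete: "Metric_space.mcomplete (carrier V) (vdist V)"

definition linear_map :: "('v, 'm) normed_space_scheme \<Rightarrow> ('v \<Rightarrow> 'v) \<Rightarrow> bool" where
  "linear_map V T \<longleftrightarrow>
     T \<in> carrier V \<rightarrow> carrier V \<and>
     (\<forall>x\<in>carrier V. \<forall>y\<in>carrier V. T (x \<oplus>\<^bsub>V\<^esub> y) = T x \<oplus>\<^bsub>V\<^esub> T y) \<and>
     (\<forall>c. \<forall>x\<in>carrier V. T (c \<odot>\<^bsub>V\<^esub> x) = c \<odot>\<^bsub>V\<^esub> T x)"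

definition bounded_linear_map :: "('v, 'm) normed_space_scheme \<Rightarrow> ('v \<Rightarrow> 'v) \<Rightarrow> bool" where
  "bounded_linear_map V T \<longleftrightarrow>
     linear_map V T \<and> (\<exists>K. \<forall>x\<in>carrier V. vnorm V (T x) \<le> K * vnorm V x)"

definition contractive :: "('v, 'm) normed_space_scheme \<Rightarrow> ('v \<Rightarrow> 'v) \<Rightarrow> bool" where
  "contractive V T \<longleftrightarrow> (\<forall>x\<in>carrier V. vnorm V (T x) \<le> vnorm V x)"

definition operator_norm :: "('v, 'm) normed_space_scheme \<Rightarrow> ('v \<Rightarrow> 'v) \<Rightarrow> real" where
  "operator_norm V T = (SUP x\<in>unit_ball V. vnorm V (T x))"

definition compact_map :: "('v, 'm) normed_space_scheme \<Rightarrow> ('v \<Rightarrow> 'v) \<Rightarrow> bool" where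
  "compact_map V T \<longleftrightarrow>
     bounded_linear_map V T \<and>
     compactin (vtopology V) (vtopology V closure_of (T ` unit_ball V))"


section \<open>$C^*$-algebras, states and completely positive maps\<close>

record 'v star_algebra = "'v normed_space" +
  star :: "'v \<Rightarrow> 'v"

locale cstar_algebra =
  complex_banach_space A for A :: "('v, 'm) star_algebra_scheme" (structure) +
  assumes mult_closed: "\<lbrakk>x \<in> carrier A; y \<in> carrier A\<rbrakk> \<Longrightarrow> x \<otimes> y \<in> carrier A"
    and mult_assoc: "\<lbrakk>x \<in> carrier A; y \<in> carrier A; z \<in> carrier A\<rbrakk> \<Longrightarrow> (x \<otimes> y) \<otimes> z = x \<otimes> (y \<otimes> z)"
    and mult_add_left: "\<lbrakk>x \<in> carrier A; y \<in> carrier A; z \<in> carrier A\<rbrakk> \<Longrightarrow> (x \<oplus> y) \<otimes> z = x \<otimes> z \<oplus> y \<otimes> z"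
    and mult_add_right: "\<lbrakk>x \<in> carrier A; y \<in> carrier A; z \<in> carrier A\<rbrakk> \<Longrightarrow> x \<otimes> (y \<oplus> z) = x \<otimes> y \<oplus> x \<otimes> z"
    and mult_smult_left: "\<lbrakk>x \<in> carrier A; y \<in> carrier A\<rbrakk> \<Longrightarrow> (c \<odot> x) \<otimes> y = c \<odot> (x \<otimes> y)"
    and mult_smult_right: "\<lbrakk>x \<in> carrier A; y \<in> carrier A\<rbrakk> \<Longrightarrow> x \<otimes> (c \<odot> y) = c \<odot> (x \<otimes> y)"
    and norm_mult: "\<lbrakk>x \<in> carrier A; y \<in> carrier A\<rbrakk> \<Longrightarrow> vnorm A (x \<otimes> y) \<le> vnorm A x * vnorm A y"
    and star_closed: "x \<in> carrier A \<Longrightarrow> star A x \<in> carrier A"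
    and star_add: "\<lbrakk>x \<in> carrier A; y \<in> carrier A\<rbrakk> \<Longrightarrow> star A (x \<oplus> y) = star A x \<oplus> star A y"
    and star_smult: "x \<in> carrier A \<Longrightarrow> star A (c \<odot> x) = cnj c \<odot> star A x"
    and star_star: "x \<in> carrier A \<Longrightarrow> star A (star A x) = x"
    and star_mult: "\<lbrakk>x \<in> carrier A; y \<in> carrier A\<rbrakk> \<Longrightarrow> star A (x \<otimes> y) = star A y \<otimes> star A x"
    and norm_star_mult: "x \<in> carrier A \<Longrightarrow> vnorm A (star A x \<otimes> x) = (vnorm A x)\<^sup>2"

definition positive :: "('v, 'm) star_algebra_scheme \<Rightarrow> 'v \<Rightarrow> bool" where
  "positive A x \<longleftrightarrow> (\<exists>y\<in>carrier A. x = star A y \<otimes>\<^bsub>A\<^esub> y)"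

definition state :: "('v, 'm) star_algebra_scheme \<Rightarrow> ('v \<Rightarrow> complex) \<Rightarrow> bool" where
  "state A \<phi> \<longleftrightarrow>
     (\<forall>x\<in>carrier A. \<forall>y\<in>carrier A. \<phi> (x \<oplus>\<^bsub>A\<^esub> y) = \<phi> x + \<phi> y) \<and>
     (\<forall>c. \<forall>x\<in>carrier A. \<phi> (c \<odot>\<^bsub>A\<^esub> x) = c * \<phi> x) \<and>
     (\<forall>x. positive A x \<longrightarrow> 0 \<le> \<phi> x) \<and>
     bdd_above ((\<lambda>x. cmod (\<phi> x)) ` unit_ball A) \<and>
     (SUP x\<in>unit_ball A. cmod (\<phi> x)) = 1"

text \<open>
  The state is complex-valued; the inequality is the order of \<^theory>\<open>HOL-Library.Complex_Order\<close>
  (equal imaginary parts), which is the order of the reals when both sides are real.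
\<close>

definition subinvariant :: "('v, 'm) star_algebra_scheme \<Rightarrow> ('v \<Rightarrow> complex) \<Rightarrow> ('v \<Rightarrow> 'v) \<Rightarrow> bool" where
  "subinvariant A \<phi> \<Phi> \<longleftrightarrow> (\<forall>x. positive A x \<longrightarrow> \<phi> (\<Phi> x) \<le> \<phi> x)"

text \<open>
  Positivity in the $C^*$-algebra $M_n(A)$: the matrix \<open>X\<close> has the form $Y^*Y$ with $Y \in M_n(A)$.
  Only entries with both indices below \<open>n\<close> matter.
\<close>

definition matrix_positive ::
    "('v, 'm) star_algebra_scheme \<Rightarrow> nat \<Rightarrow> (nat \<Rightarrow> nat \<Rightarrow> 'v) \<Rightarrow> bool" where
  "matrix_positive A n X \<longleftrightarrow>
     (\<exists>Y. (\<forall>i<n. \<forall>j<n. Y i j \<in> carrier A) \<and>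
          (\<forall>i<n. \<forall>j<n. X i j = (\<Oplus>\<^bsub>A\<^esub>k\<in>{..<n}. star A (Y k i) \<otimes>\<^bsub>A\<^esub> Y k j)))"

definition completely_positive :: "('v, 'm) star_algebra_scheme \<Rightarrow> ('v \<Rightarrow> 'v) \<Rightarrow> bool" where
  "completely_positive A \<Phi> \<longleftrightarrow>
     linear_map A \<Phi> \<and>
     (\<forall>n X. matrix_positive A n X \<longrightarrow> matrix_positive A n (\<lambda>i j. \<Phi> (X i j)))"


section \<open>Hilbert space completion of a semi-inner product\<close>

text \<open>
  Let \<open>s\<close> be a positive semidefinite form on \<open>V\<close>, conjugate-linear in the first argument, with
  seminorm \<open>p\<close> and null space $N = \{x : p(x) = 0\}$. The completion of $V/N$ consists of the
  \<open>p\<close>-Cauchy sequences in \<open>V\<close> modulo sequences tending to zero; the class of $x + N$ is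
  the class of the constant sequence \<open>x\<close>.
\<close>

definition seminorm :: "('v \<Rightarrow> 'v \<Rightarrow> complex) \<Rightarrow> 'v \<Rightarrow> real" where
  "seminorm s x = sqrt (Re (s x x))"

definition cauchy_seqs ::
    "('v, 'm) normed_space_scheme \<Rightarrow> ('v \<Rightarrow> 'v \<Rightarrow> complex) \<Rightarrow> (nat \<Rightarrow> 'v) set" where
  "cauchy_seqs V s =
     {X. range X \<subseteq> carrier V \<and>
         (\<forall>\<epsilon>>0. \<exists>N. \<forall>m\<ge>N. \<forall>n\<ge>N. seminorm s (X m \<ominus>\<^bsub>V\<^esub> X n) < \<epsilon>)}"

definition null_rel ::
    "('v, 'm) normed_space_scheme \<Rightarrow> ('v \<Rightarrow> 'v \<Rightarrow> complex) \<Rightarrow> ((nat \<Rightarrow> 'v) \<times> (nat \<Rightarrow> 'v)) set" where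
  "null_rel V s =
     {(X, Y). X \<in> cauchy_seqs V s \<and> Y \<in> cauchy_seqs V s \<and>
              (\<lambda>n. seminorm s (X n \<ominus>\<^bsub>V\<^esub> Y n)) \<longlonglongrightarrow> 0}"

definition seq_class ::
    "('v, 'm) normed_space_scheme \<Rightarrow> ('v \<Rightarrow> 'v \<Rightarrow> complex) \<Rightarrow> (nat \<Rightarrow> 'v) \<Rightarrow> (nat \<Rightarrow> 'v) set" where
  "seq_class V s X = null_rel V s `` {X}"

abbreviation class_rep :: "(nat \<Rightarrow> 'v) set \<Rightarrow> nat \<Rightarrow> 'v" where
  "class_rep \<xi> \<equiv> SOME X. X \<in> \<xi>"

record 'v inner_space = "'v normed_space" +
  vinner :: "'v \<Rightarrow> 'v \<Rightarrow> complex"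

definition completion_inner ::
    "('v \<Rightarrow> 'v \<Rightarrow> complex) \<Rightarrow> (nat \<Rightarrow> 'v) set \<Rightarrow> (nat \<Rightarrow> 'v) set \<Rightarrow> complex" where
  "completion_inner s \<xi> \<eta> = lim (\<lambda>n. s (class_rep \<xi> n) (class_rep \<eta> n))"

definition hilbert_completion ::
    "('v, 'm) normed_space_scheme \<Rightarrow> ('v \<Rightarrow> 'v \<Rightarrow> complex) \<Rightarrow> (nat \<Rightarrow> 'v) set inner_space" where
  "hilbert_completion V s =
     \<lparr>carrier = cauchy_seqs V s // null_rel V s,
      mult = undefined, one = undefined,
      zero = seq_class V s (\<lambda>_. \<zero>\<^bsub>V\<^esub>),
      add = (\<lambda>\<xi> \<eta>. seq_class V s (\<lambda>n. class_rep \<xi> n \<oplus>\<^bsub>V\<^esub> class_rep \<eta> n)),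
      smult = (\<lambda>c \<xi>. seq_class V s (\<lambda>n. c \<odot>\<^bsub>V\<^esub> class_rep \<xi> n)),
      vnorm = (\<lambda>\<xi>. sqrt (Re (completion_inner s \<xi> \<xi>))),
      vinner = completion_inner s\<rparr>"

definition embed :: "('v, 'm) normed_space_scheme \<Rightarrow> ('v \<Rightarrow> 'v \<Rightarrow> complex) \<Rightarrow> 'v \<Rightarrow> (nat \<Rightarrow> 'v) set" where
  "embed V s x = seq_class V s (\<lambda>_. x)"

text \<open>
  The bounded operator on the completion that extends $x + N \mapsto T(x) + N$. It is unique because
  the image of \<open>V\<close> is dense, and it exists iff \<open>T\<close> is bounded for the seminorm.
\<close>

definition induced_operator ::
    "('v, 'm) normed_space_scheme \<Rightarrow> ('v \<Rightarrow> 'v \<Rightarrow> complex) \<Rightarrow> ('v \<Rightarrow> 'v) \<Rightarrow>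
     (nat \<Rightarrow> 'v) set \<Rightarrow> (nat \<Rightarrow> 'v) set" where
  "induced_operator V s T =
     (THE S. S \<in> extensional (carrier (hilbert_completion V s)) \<and>
             bounded_linear_map (hilbert_completion V s) S \<and>
             (\<forall>x\<in>carrier V. S (embed V s x) = embed V s (T x)))"


section \<open>Nets\<close>

definition directed_set :: "'i set \<Rightarrow> ('i \<Rightarrow> 'i \<Rightarrow> bool) \<Rightarrow> bool" where
  "directed_set I below \<longleftrightarrow>
     I \<noteq> {} \<and>
     (\<forall>i\<in>I. below i i) \<and>
     (\<forall>i\<in>I. \<forall>j\<in>I. \<forall>k\<in>I. below i j \<longrightarrow> below j k \<longrightarrow> below i k) \<and>
     (\<forall>i\<in>I. \<forall>j\<in>I. \<exists>k\<in>I. below i k \<and> below j k)"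

definition net_filter :: "'i set \<Rightarrow> ('i \<Rightarrow> 'i \<Rightarrow> bool) \<Rightarrow> 'i filter" where
  "net_filter I below = (INF i\<in>I. principal {j \<in> I. below i j})"


section \<open>The Haagerup property of a $C^*$-algebra with a state\<close>

definition gns_form :: "('v, 'm) star_algebra_scheme \<Rightarrow> ('v \<Rightarrow> complex) \<Rightarrow> 'v \<Rightarrow> 'v \<Rightarrow> complex" where
  "gns_form A \<phi> a b = \<phi> (star A a \<otimes>\<^bsub>A\<^esub> b)"

abbreviation gns_space ::
    "('v, 'm) star_algebra_scheme \<Rightarrow> ('v \<Rightarrow> complex) \<Rightarrow> (nat \<Rightarrow> 'v) set inner_space" where
  "gns_space A \<phi> \<equiv> hilbert_completion A (gns_form A \<phi>)"

abbreviation gns_operator ::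
    "('v, 'm) star_algebra_scheme \<Rightarrow> ('v \<Rightarrow> complex) \<Rightarrow> ('v \<Rightarrow> 'v) \<Rightarrow>
     (nat \<Rightarrow> 'v) set \<Rightarrow> (nat \<Rightarrow> 'v) set" where
  "gns_operator A \<phi> \<Phi> \<equiv> induced_operator A (gns_form A \<phi>) \<Phi>"

text \<open>
  A definition cannot quantify over index types, so the type \<open>'i\<close> from which the directed index
  sets are taken is a parameter, here and for Fell bundles.
\<close>

definition haagerup_cstar ::
    "'i itself \<Rightarrow> ('v, 'm) star_algebra_scheme \<Rightarrow> ('v \<Rightarrow> complex) \<Rightarrow> bool" where
  "haagerup_cstar _ A \<phi> \<longleftrightarrow>
     (\<exists>(I :: 'i set) below \<Phi>.
        directed_set I below \<and>
        (\<forall>i\<in>I. completely_positive A (\<Phi> i) \<and> contractive A (\<Phi> i)) \<and>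
        (\<forall>i\<in>I. subinvariant A \<phi> (\<Phi> i)) \<and>
        (\<forall>i\<in>I. compact_map (gns_space A \<phi>) (gns_operator A \<phi> (\<Phi> i))) \<and>
        (\<forall>\<xi>\<in>carrier (gns_space A \<phi>).
           ((\<lambda>i. vnorm (gns_space A \<phi>) (gns_operator A \<phi> (\<Phi> i) \<xi> \<ominus>\<^bsub>gns_space A \<phi>\<^esub> \<xi>)) \<longlongrightarrow> 0) (net_filter I below)))"


section \<open>Fell bundles\<close>

text \<open>
  The fibres are disjoint subsets of one type, so that the product and the involution are operations
  on their union, the total space of the bundle.
\<close>

record ('g, 'v) fell_data =
  fibre :: "'g \<Rightarrow> 'v normed_space"
  bmult :: "'v \<Rightarrow> 'v \<Rightarrow> 'v" (infixl \<open>\<cdot>\<index>\<close> 70)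
  bstar :: "'v \<Rightarrow> 'v"

abbreviation elems :: "('g, 'v, 'b) fell_data_scheme \<Rightarrow> 'g \<Rightarrow> 'v set" where
  "elems B g \<equiv> carrier (fibre B g)"

abbreviation bnorm :: "('g, 'v, 'b) fell_data_scheme \<Rightarrow> 'g \<Rightarrow> 'v \<Rightarrow> real" where
  "bnorm B g \<equiv> vnorm (fibre B g)"

definition unit_fibre :: "('g, 'm) monoid_scheme \<Rightarrow> ('g, 'v, 'b) fell_data_scheme \<Rightarrow> 'v star_algebra" where
  "unit_fibre G B =
     (let E = fibre B \<one>\<^bsub>G\<^esub> in
      \<lparr>carrier = carrier E, mult = bmult B, one = undefined, zero = zero E, add = add E,
       smult = smult E, vnorm = vnorm E, star = bstar B\<rparr>)"

locale fell_bundle =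
  group G for G :: "('g, 'm) monoid_scheme" +
  fixes B :: "('g, 'v, 'b) fell_data_scheme" (structure)
  assumes fibre_banach: "g \<in> carrier G \<Longrightarrow> complex_banach_space (fibre B g)"
    and fibre_disjoint: "\<lbrakk>g \<in> carrier G; h \<in> carrier G; g \<noteq> h\<rbrakk> \<Longrightarrow> elems B g \<inter> elems B h = {}"
    and bmult_closed: "\<lbrakk>g \<in> carrier G; h \<in> carrier G; a \<in> elems B g; b \<in> elems B h\<rbrakk> \<Longrightarrow>
          a \<cdot> b \<in> elems B (g \<otimes>\<^bsub>G\<^esub> h)"
    and bmult_assoc: "\<lbrakk>g \<in> carrier G; h \<in> carrier G; k \<in> carrier G;
          a \<in> elems B g; b \<in> elems B h; d \<in> elems B k\<rbrakk> \<Longrightarrow> (a \<cdot> b) \<cdot> d = a \<cdot> (b \<cdot> d)"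
    and bmult_add_left: "\<lbrakk>g \<in> carrier G; h \<in> carrier G;
          a \<in> elems B g; a' \<in> elems B g; b \<in> elems B h\<rbrakk> \<Longrightarrow>
          (a \<oplus>\<^bsub>fibre B g\<^esub> a') \<cdot> b = a \<cdot> b \<oplus>\<^bsub>fibre B (g \<otimes>\<^bsub>G\<^esub> h)\<^esub> a' \<cdot> b"
    and bmult_add_right: "\<lbrakk>g \<in> carrier G; h \<in> carrier G;
          a \<in> elems B g; b \<in> elems B h; b' \<in> elems B h\<rbrakk> \<Longrightarrow>
          a \<cdot> (b \<oplus>\<^bsub>fibre B h\<^esub> b') = a \<cdot> b \<oplus>\<^bsub>fibre B (g \<otimes>\<^bsub>G\<^esub> h)\<^esub> a \<cdot> b'"
    and bmult_smult_left: "\<lbrakk>g \<in> carrier G; h \<in> carrier G; a \<in> elems B g; b \<in> elems B h\<rbrakk> \<Longrightarrow>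
          (c \<odot>\<^bsub>fibre B g\<^esub> a) \<cdot> b = c \<odot>\<^bsub>fibre B (g \<otimes>\<^bsub>G\<^esub> h)\<^esub> (a \<cdot> b)"
    and bmult_smult_right: "\<lbrakk>g \<in> carrier G; h \<in> carrier G; a \<in> elems B g; b \<in> elems B h\<rbrakk> \<Longrightarrow>
          a \<cdot> (c \<odot>\<^bsub>fibre B h\<^esub> b) = c \<odot>\<^bsub>fibre B (g \<otimes>\<^bsub>G\<^esub> h)\<^esub> (a \<cdot> b)"
    and bnorm_mult: "\<lbrakk>g \<in> carrier G; h \<in> carrier G; a \<in> elems B g; b \<in> elems B h\<rbrakk> \<Longrightarrow>
          bnorm B (g \<otimes>\<^bsub>G\<^esub> h) (a \<cdot> b) \<le> bnorm B g a * bnorm B h b"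
    and bstar_closed: "\<lbrakk>g \<in> carrier G; b \<in> elems B g\<rbrakk> \<Longrightarrow> bstar B b \<in> elems B (inv\<^bsub>G\<^esub> g)"
    and bstar_add: "\<lbrakk>g \<in> carrier G; a \<in> elems B g; b \<in> elems B g\<rbrakk> \<Longrightarrow>
          bstar B (a \<oplus>\<^bsub>fibre B g\<^esub> b) = bstar B a \<oplus>\<^bsub>fibre B (inv\<^bsub>G\<^esub> g)\<^esub> bstar B b"
    and bstar_smult: "\<lbrakk>g \<in> carrier G; b \<in> elems B g\<rbrakk> \<Longrightarrow>
          bstar B (c \<odot>\<^bsub>fibre B g\<^esub> b) = cnj c \<odot>\<^bsub>fibre B (inv\<^bsub>G\<^esub> g)\<^esub> bstar B b"
    and bstar_bstar: "\<lbrakk>g \<in> carrier G; b \<in> elems B g\<rbrakk> \<Longrightarrow> bstar B (bstar B b) = b"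
    and bstar_mult: "\<lbrakk>g \<in> carrier G; h \<in> carrier G; a \<in> elems B g; b \<in> elems B h\<rbrakk> \<Longrightarrow>
          bstar B (a \<cdot> b) = bstar B b \<cdot> bstar B a"
    and bnorm_bstar: "\<lbrakk>g \<in> carrier G; b \<in> elems B g\<rbrakk> \<Longrightarrow> bnorm B (inv\<^bsub>G\<^esub> g) (bstar B b) = bnorm B g b"
    and bnorm_bstar_mult: "\<lbrakk>g \<in> carrier G; b \<in> elems B g\<rbrakk> \<Longrightarrow>
          bnorm B \<one>\<^bsub>G\<^esub> (bstar B b \<cdot> b) = (bnorm B g b)\<^sup>2"
    and bstar_mult_positive: "\<lbrakk>g \<in> carrier G; b \<in> elems B g\<rbrakk> \<Longrightarrow> positive (unit_fibre G B) (bstar B b \<cdot> b)"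

lemma (in fell_bundle) cstar_algebra_unit_fibre: "cstar_algebra (unit_fibre G B)"
proof -
  let ?E = "fibre B \<one>\<^bsub>G\<^esub>" and ?A = "unit_fibre G B"
  interpret E: complex_banach_space ?E by (rule fibre_banach) simp
  have m: "a_minus ?A = a_minus ?E"
    by (intro ext) (simp add: a_minus_def a_inv_def m_inv_def unit_fibre_def Let_def)
  have d: "vdist ?A = vdist ?E"
    by (intro ext) (simp only: vdist_def m, simp add: unit_fibre_def Let_def)
  have ab: "abelian_group ?A"
    by (rule abelian_groupI)
      (auto simp: unit_fibre_def Let_def E.a_ac intro: E.add.l_inv_ex)
  have md: "Module.module complex_ring ?A"
    by (rule Module.moduleI[OF E.is_cring ab])
      (auto simp: unit_fibre_def Let_def E.smult_l_distr E.smult_r_distr E.smult_assoc1)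
  have bs: "complex_banach_space ?A"
    using md E.complete unfolding complex_banach_space_def complex_banach_space_axioms_def d
    by (auto simp: unit_fibre_def Let_def E.norm_nonneg E.norm_eq_zero E.norm_triangle E.norm_smult)
  note e = one_closed
  show ?thesis
    using bs bmult_closed[OF e e] bmult_assoc[OF e e e] bmult_add_left[OF e e]
      bmult_add_right[OF e e] bmult_smult_left[OF e e] bmult_smult_right[OF e e]
      bnorm_mult[OF e e] bstar_closed[OF e] bstar_add[OF e] bstar_smult[OF e] bstar_bstar[OF e]
      bstar_mult[OF e e] bnorm_bstar_mult[OF e]
    unfolding cstar_algebra_def cstar_algebra_axioms_def
    by (auto simp: unit_fibre_def Let_def)
qed


section \<open>The Haagerup property of a Fell bundle with a state\<close>

definition bundle_map ::
    "('g, 'm) monoid_scheme \<Rightarrow> ('g, 'v, 'b) fell_data_scheme \<Rightarrow> ('g \<Rightarrow> 'v \<Rightarrow> 'v) \<Rightarrow> bool" where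
  "bundle_map G B T \<longleftrightarrow> (\<forall>g\<in>carrier G. bounded_linear_map (fibre B g) (T g))"

definition positive_definite ::
    "('g, 'm) monoid_scheme \<Rightarrow> ('g, 'v, 'b) fell_data_scheme \<Rightarrow> ('g \<Rightarrow> 'v \<Rightarrow> 'v) \<Rightarrow> bool" where
  "positive_definite G B T \<longleftrightarrow>
     (\<forall>(n::nat) g a b.
        (\<forall>i<n. g i \<in> carrier G \<and> a i \<in> elems B (g i) \<and> b i \<in> elems B (g i)) \<longrightarrow>
        positive (unit_fibre G B)
          (\<Oplus>\<^bsub>unit_fibre G B\<^esub>i\<in>{..<n}. \<Oplus>\<^bsub>unit_fibre G B\<^esub>j\<in>{..<n}.
             b i \<cdot>\<^bsub>B\<^esub> T (inv\<^bsub>G\<^esub> (g i) \<otimes>\<^bsub>G\<^esub> g j) (bstar B (a i) \<cdot>\<^bsub>B\<^esub> a j) \<cdot>\<^bsub>B\<^esub> bstar B (b j)))"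

definition fibre_form :: "('g, 'v, 'b) fell_data_scheme \<Rightarrow> ('v \<Rightarrow> complex) \<Rightarrow> 'v \<Rightarrow> 'v \<Rightarrow> complex" where
  "fibre_form B \<psi> b c = \<psi> (bstar B b \<cdot>\<^bsub>B\<^esub> c)"

abbreviation fibre_space ::
    "('g, 'v, 'b) fell_data_scheme \<Rightarrow> ('v \<Rightarrow> complex) \<Rightarrow> 'g \<Rightarrow> (nat \<Rightarrow> 'v) set inner_space" where
  "fibre_space B \<psi> g \<equiv> hilbert_completion (fibre B g) (fibre_form B \<psi>)"

abbreviation fibre_operator ::
    "('g, 'v, 'b) fell_data_scheme \<Rightarrow> ('v \<Rightarrow> complex) \<Rightarrow> ('g \<Rightarrow> 'v \<Rightarrow> 'v) \<Rightarrow> 'g \<Rightarrow>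
     (nat \<Rightarrow> 'v) set \<Rightarrow> (nat \<Rightarrow> 'v) set" where
  "fibre_operator B \<psi> T g \<equiv> induced_operator (fibre B g) (fibre_form B \<psi>) (T g)"

definition haagerup_bundle ::
    "'i itself \<Rightarrow> ('g, 'm) monoid_scheme \<Rightarrow> ('g, 'v, 'b) fell_data_scheme \<Rightarrow> ('v \<Rightarrow> complex) \<Rightarrow> bool" where
  "haagerup_bundle _ G B \<psi> \<longleftrightarrow>
     (\<exists>(I :: 'i set) below T.
        directed_set I below \<and>
        (\<forall>i\<in>I. bundle_map G B (T i) \<and> positive_definite G B (T i)) \<and>
        (\<forall>i\<in>I. contractive (fibre B \<one>\<^bsub>G\<^esub>) (T i \<one>\<^bsub>G\<^esub>) \<and>
               subinvariant (unit_fibre G B) \<psi> (T i \<one>\<^bsub>G\<^esub>)) \<and>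
        (\<forall>i\<in>I. \<forall>g\<in>carrier G. compact_map (fibre_space B \<psi> g) (fibre_operator B \<psi> (T i) g)) \<and>
        (\<forall>i\<in>I. \<forall>\<epsilon>>0. finite {g \<in> carrier G.
                    operator_norm (fibre_space B \<psi> g) (fibre_operator B \<psi> (T i) g) \<ge> \<epsilon>}) \<and>
        (\<forall>g\<in>carrier G. \<forall>b\<in>elems B g.
           ((\<lambda>i. seminorm (fibre_form B \<psi>) (T i g b \<ominus>\<^bsub>fibre B g\<^esub> b)) \<longlongrightarrow> 0) (net_filter I below)))"

end

theory Submission
  imports Defs
begin

text \<open>
  The maps for \<open>(B_e, \<psi>)\<close> are the unit components \<open>\<Phi> = T_e\<close> of the given bundle maps. Contractivity,
  subinvariance and compactness are inherited, because the fibre over the unit and the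
  $C^*$-algebra \<open>A = B_e\<close> have the same completion. Taking all group elements equal to \<open>e\<close>, positive
  definiteness says that the sums \<open>\<Sum> b_i \<Phi>(a_i* a_j) b_j*\<close> are positive in \<open>A\<close>. Two points
  remain.

  \<^item> Complete positivity (\<open>completely_positive_if_positive_definite\<close>). A positive matrix \<open>Y*Y\<close> is a sum
    of matrices \<open>(y_i* y_j)\<close>, one for each row of \<open>Y\<close>, so the image \<open>X\<close> of \<open>Y*Y\<close> under \<open>\<Phi>\<close> satisfies
    \<open>\<langle>b, X b\<rangle> \<ge> 0\<close> for every column \<open>b\<close> over \<open>A\<close>. Such a matrix is of the form \<open>Z*Z\<close>
    (\<open>matrix_positive_if_inner_positive\<close>).
  \<^item> The operators on the GNS space are contractions, so that convergence on the dense image of \<open>A\<close> gives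
    strong convergence (\<open>strong_convergence\<close>). This is a Kadison-Schwarz argument: the same fact about
    2 x 2 matrices gives \<open>\<Phi>(e a)* \<Phi>(e a) \<le> \<Phi>(a* a)\<close> for every selfadjoint \<open>e\<close> in the unit ball, and
    if \<open>e\<close> runs through an approximate unit for \<open>a\<close> then \<open>\<psi>(\<Phi>(a)* \<Phi>(a)) \<le> \<psi>(\<Phi>(a* a)) \<le> \<psi>(a* a)\<close>
    (\<open>state_seminorm_contraction\<close>).

  Both rest on the order of a $C^*$-algebra, obtained here without spectra and without functional
  calculus. In a unital $C^*$-algebra a selfadjoint \<open>x\<close> is called positive if \<open>\<parallel>t - x\<parallel> \<le> t\<close> for some
  \<open>t \<ge> 0\<close>; these elements visibly form a convex cone. An iteration dominated by a real sequence gives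
  square roots (\<open>sqrt_contraction\<close>), and these give that squares of selfadjoint elements, products of
  commuting positive elements and finally all \<open>y* y\<close> are positive (\<open>pos_star_mult\<close>).

  Algebras without unit and matrix algebras are reached through adjointable operators: if \<open>E\<close> is a
  Banach space with an \<open>A\<close>-valued inner product, then the adjointable operators on \<open>E\<close> form a unital
  $C^*$-algebra (\<open>L_unital_cstar\<close>). The case \<open>E = A\<close>, with \<open>A\<close> acting by left multiplication, yields
  the order of \<open>A\<close>. This makes the columns of length \<open>n\<close> over \<open>A\<close> a Hilbert module, and the case of
  columns yields the order of the matrices over \<open>A\<close>.
\<close>

section \<open>Normed spaces and convergence of sequences\<close>

text \<open>
  A \<^locale>\<open>complex_banach_space\<close> without completeness; the completions of seminormed spaces
  below are used in this form.
\<close>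

locale complex_normed_space =
  Module.module complex_ring V for V :: "('v, 'm) normed_space_scheme" (structure) +
  assumes vnorm_nonneg: "x \<in> carrier V \<Longrightarrow> 0 \<le> vnorm V x"
    and vnorm_eq_zero: "x \<in> carrier V \<Longrightarrow> vnorm V x = 0 \<longleftrightarrow> x = \<zero>"
    and vnorm_triangle:
      "\<lbrakk>x \<in> carrier V; y \<in> carrier V\<rbrakk> \<Longrightarrow> vnorm V (x \<oplus> y) \<le> vnorm V x + vnorm V y"
    and vnorm_scale: "x \<in> carrier V \<Longrightarrow> vnorm V (c \<odot> x) = cmod c * vnorm V x"

text \<open>Norm convergence of a sequence of elements of the carrier to an element of the carrier.\<close>

definition tends_to :: "('v, 'm) normed_space_scheme \<Rightarrow> (nat \<Rightarrow> 'v) \<Rightarrow> 'v \<Rightarrow> bool" where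
  "tends_to V X l \<longleftrightarrow> range X \<subseteq> carrier V \<and> l \<in> carrier V \<and>
     (\<lambda>n. vnorm V (X n \<ominus>\<^bsub>V\<^esub> l)) \<longlonglongrightarrow> 0"

text \<open>Sequences in the carrier that are Cauchy for the norm.\<close>

definition norm_cauchy :: "('v, 'm) normed_space_scheme \<Rightarrow> (nat \<Rightarrow> 'v) \<Rightarrow> bool" where
  "norm_cauchy V X \<longleftrightarrow> range X \<subseteq> carrier V \<and>
     (\<forall>e>0. \<exists>N. \<forall>m\<ge>N. \<forall>n\<ge>N. vnorm V (X m \<ominus>\<^bsub>V\<^esub> X n) < e)"

context complex_normed_space
begin

lemma scale_closed [simp, intro]: "x \<in> carrier V \<Longrightarrow> c \<odot> x \<in> carrier V"
  by (rule smult_closed) (simp_all add: complex_ring_def)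

lemma scale_add_left: "x \<in> carrier V \<Longrightarrow> (a + b) \<odot> x = a \<odot> x \<oplus> b \<odot> x"
  using smult_l_distr[of a b x] by (simp add: complex_ring_def)

lemma scale_add_right:
  "x \<in> carrier V \<Longrightarrow> y \<in> carrier V \<Longrightarrow> a \<odot> (x \<oplus> y) = a \<odot> x \<oplus> a \<odot> y"
  using smult_r_distr[of a x y] by (simp add: complex_ring_def)

lemma scale_scale: "x \<in> carrier V \<Longrightarrow> a \<odot> (b \<odot> x) = (a * b) \<odot> x"
  using smult_assoc1[of a b x] by (simp add: complex_ring_def)

lemma scale_one [simp]: "x \<in> carrier V \<Longrightarrow> 1 \<odot> x = x"
  using smult_one[of x] by (simp add: complex_ring_def)

lemma scale_zero_left [simp]: "x \<in> carrier V \<Longrightarrow> 0 \<odot> x = \<zero>"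
  using smult_l_null[of x] by (simp add: complex_ring_def)

lemma scale_zero_right [simp]: "a \<odot> \<zero> = \<zero>"
  using smult_r_null[of a] by (simp add: complex_ring_def)

lemma minus_scale: "x \<in> carrier V \<Longrightarrow> \<ominus> x = (- 1) \<odot> x"
proof -
  assume x: "x \<in> carrier V"
  have "(- 1) \<odot> x \<oplus> x = (- 1 + 1) \<odot> x" using scale_add_left[OF x, of "-1" 1] x by simp
  then show ?thesis using x by (simp add: M.minus_equality)
qed

lemma scale_minus_right: "x \<in> carrier V \<Longrightarrow> a \<odot> (\<ominus> x) = \<ominus> (a \<odot> x)"
  by (simp add: minus_scale scale_scale)

lemma scale_minus_left: "x \<in> carrier V \<Longrightarrow> (- a) \<odot> x = \<ominus> (a \<odot> x)"
  by (simp add: minus_scale scale_scale)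

lemma scale_diff_right:
  "x \<in> carrier V \<Longrightarrow> y \<in> carrier V \<Longrightarrow> a \<odot> (x \<ominus> y) = a \<odot> x \<ominus> a \<odot> y"
  by (simp add: M.minus_eq scale_add_right scale_minus_right)

lemma scale_diff_left: "x \<in> carrier V \<Longrightarrow> (a - b) \<odot> x = a \<odot> x \<ominus> b \<odot> x"
  using scale_add_left[of x a "- b"] by (simp add: M.minus_eq scale_minus_left)

lemma scale_eq_iff:
  assumes "c \<noteq> 0" "x \<in> carrier V" "y \<in> carrier V" "c \<odot> x = c \<odot> y" shows "x = y"
proof -
  have "x = inverse c \<odot> (c \<odot> x)" using assms(1,2) by (simp add: scale_scale)
  also have "\<dots> = y" unfolding assms(4) using assms(1,3) by (simp add: scale_scale)
  finally show ?thesis .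
qed

lemma double: "x \<in> carrier V \<Longrightarrow> x \<oplus> x = 2 \<odot> x"
  using scale_add_left[of x 1 1] by simp

lemma minus_self [simp]: "x \<in> carrier V \<Longrightarrow> x \<ominus> x = \<zero>"
  by (simp add: M.minus_eq M.r_neg)

lemma diff_add_cancel: "x \<in> carrier V \<Longrightarrow> y \<in> carrier V \<Longrightarrow> (x \<ominus> y) \<oplus> y = x"
  by (simp add: M.minus_eq M.a_assoc M.l_neg)

lemma diff_eq_zero_iff:
  assumes "x \<in> carrier V" "y \<in> carrier V" shows "x \<ominus> y = \<zero> \<longleftrightarrow> x = y"
proof
  assume "x \<ominus> y = \<zero>"
  then show "x = y" using diff_add_cancel[OF assms] assms by simp
qed (use assms in simp)

lemma vnorm_zero [simp]: "vnorm V \<zero> = 0"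
  by (simp add: vnorm_eq_zero)

lemma vnorm_minus [simp]: "x \<in> carrier V \<Longrightarrow> vnorm V (\<ominus> x) = vnorm V x"
  by (simp add: minus_scale vnorm_scale)

lemma vnorm_diff: "x \<in> carrier V \<Longrightarrow> y \<in> carrier V \<Longrightarrow> vnorm V (x \<ominus> y) \<le> vnorm V x + vnorm V y"
  using vnorm_triangle[of x "\<ominus> y"] by (simp add: M.minus_eq)

lemma minus_diff: "x \<in> carrier V \<Longrightarrow> y \<in> carrier V \<Longrightarrow> \<ominus> (x \<ominus> y) = y \<ominus> x"
  by (simp add: M.minus_eq M.minus_add M.a_comm)

lemma vnorm_minus_commute:
  "x \<in> carrier V \<Longrightarrow> y \<in> carrier V \<Longrightarrow> vnorm V (x \<ominus> y) = vnorm V (y \<ominus> x)"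
  using vnorm_minus[of "x \<ominus> y"] by (simp add: minus_diff)

lemma diff_trans:
  assumes "x \<in> carrier V" "y \<in> carrier V" "z \<in> carrier V"
  shows "(x \<ominus> y) \<oplus> (y \<ominus> z) = x \<ominus> z"
  using assms by (simp add: M.minus_eq M.a_assoc M.r_neg1)

lemma vnorm_diff_triangle:
  assumes "x \<in> carrier V" "y \<in> carrier V" "z \<in> carrier V"
  shows "vnorm V (x \<ominus> z) \<le> vnorm V (x \<ominus> y) + vnorm V (y \<ominus> z)"
  using assms vnorm_triangle[of "x \<ominus> y" "y \<ominus> z"] by (simp add: diff_trans)

lemma vnorm_le_diff:
  assumes "x \<in> carrier V" "y \<in> carrier V"
  shows "vnorm V x \<le> vnorm V (x \<ominus> y) + vnorm V y"
  using assms vnorm_triangle[of "x \<ominus> y" y] by (simp add: M.minus_eq M.a_assoc M.l_neg)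

lemma tends_to_unique:
  assumes "tends_to V X l" "tends_to V X l'" shows "l = l'"
proof -
  have c: "range X \<subseteq> carrier V" "l \<in> carrier V" "l' \<in> carrier V" using assms by (auto simp: tends_to_def)
  have "(\<lambda>n. vnorm V (X n \<ominus> l) + vnorm V (X n \<ominus> l')) \<longlonglongrightarrow> 0 + 0"
    using assms unfolding tends_to_def by (intro tendsto_add) auto
  moreover have "vnorm V (l \<ominus> l') \<le> vnorm V (X n \<ominus> l) + vnorm V (X n \<ominus> l')" for n
    using c vnorm_diff_triangle[of l "X n" l'] vnorm_minus_commute[of l "X n"] by auto
  ultimately have "vnorm V (l \<ominus> l') \<le> 0"
    using LIMSEQ_le_const[of _ "0 + 0" "vnorm V (l \<ominus> l')"] by simp
  then have "vnorm V (l \<ominus> l') = 0" using c vnorm_nonneg[of "l \<ominus> l'"] by simp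
  then show ?thesis using c by (simp add: vnorm_eq_zero diff_eq_zero_iff)
qed

lemma tends_to_const: "l \<in> carrier V \<Longrightarrow> tends_to V (\<lambda>_. l) l"
  by (simp add: tends_to_def image_subset_iff)

lemma tends_to_squeeze:
  assumes "range X \<subseteq> carrier V" "l \<in> carrier V" "\<And>n. vnorm V (X n \<ominus> l) \<le> f n" "f \<longlonglongrightarrow> 0"
  shows "tends_to V X l"
proof -
  have "(\<lambda>n. vnorm V (X n \<ominus> l)) \<longlonglongrightarrow> 0"
    by (rule Lim_null_comparison[OF _ assms(4)]) (use assms(1-3) in \<open>auto simp: vnorm_nonneg image_subset_iff\<close>)
  then show ?thesis using assms by (simp add: tends_to_def)
qed

lemma add_diff_add:
  assumes "x \<in> carrier V" "y \<in> carrier V" "z \<in> carrier V" "w \<in> carrier V"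
  shows "(x \<oplus> y) \<ominus> (z \<oplus> w) = (x \<ominus> z) \<oplus> (y \<ominus> w)"
  using assms by (simp add: M.minus_eq M.minus_add M.a_ac)

lemma tends_to_add:
  assumes "tends_to V X x" "tends_to V Y y" shows "tends_to V (\<lambda>n. X n \<oplus> Y n) (x \<oplus> y)"
proof (rule tends_to_squeeze)
  show "(\<lambda>n. vnorm V (X n \<ominus> x) + vnorm V (Y n \<ominus> y)) \<longlonglongrightarrow> 0"
    using assms unfolding tends_to_def by (intro tendsto_eq_intros) auto
  show "vnorm V (X n \<oplus> Y n \<ominus> (x \<oplus> y)) \<le> vnorm V (X n \<ominus> x) + vnorm V (Y n \<ominus> y)" for n
    using assms by (auto simp: tends_to_def image_subset_iff add_diff_add intro!: vnorm_triangle)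
qed (use assms in \<open>auto simp: tends_to_def image_subset_iff\<close>)

lemma tends_to_scale:
  assumes "tends_to V X x" shows "tends_to V (\<lambda>n. c \<odot> X n) (c \<odot> x)"
proof (rule tends_to_squeeze)
  show "(\<lambda>n. cmod c * vnorm V (X n \<ominus> x)) \<longlonglongrightarrow> 0"
    using assms unfolding tends_to_def by (intro tendsto_eq_intros) auto
  show "vnorm V (c \<odot> X n \<ominus> c \<odot> x) \<le> cmod c * vnorm V (X n \<ominus> x)" for n
    using assms by (auto simp: tends_to_def image_subset_iff scale_diff_right[symmetric] vnorm_scale)
qed (use assms in \<open>auto simp: tends_to_def image_subset_iff\<close>)

lemma tends_to_scalar:
  assumes "c \<longlonglongrightarrow> d" "x \<in> carrier V" shows "tends_to V (\<lambda>n. c n \<odot> x) (d \<odot> x)"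
proof (rule tends_to_squeeze)
  show "(\<lambda>n. cmod (c n - d) * vnorm V x) \<longlonglongrightarrow> 0"
    using LIM_zero[OF assms(1)] tendsto_norm_zero tendsto_mult_left_zero by blast
  show "vnorm V (c n \<odot> x \<ominus> d \<odot> x) \<le> cmod (c n - d) * vnorm V x" for n
    using assms by (simp add: scale_diff_left[symmetric] vnorm_scale)
qed (use assms in auto)

lemma tends_to_minus: "tends_to V X x \<Longrightarrow> tends_to V (\<lambda>n. \<ominus> X n) (\<ominus> x)"
proof -
  assume a: "tends_to V X x"
  then have "(\<lambda>n. \<ominus> X n) = (\<lambda>n. (- 1) \<odot> X n)" "\<ominus> x = (-1) \<odot> x"
    by (auto simp: tends_to_def image_subset_iff minus_scale)
  then show ?thesis using tends_to_scale[OF a, of "-1"] by simp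
qed

lemma tends_to_diff:
  "tends_to V X x \<Longrightarrow> tends_to V Y y \<Longrightarrow> tends_to V (\<lambda>n. X n \<ominus> Y n) (x \<ominus> y)"
  unfolding M.minus_eq by (intro tends_to_add tends_to_minus)

lemma tends_to_vnorm:
  assumes "tends_to V X x" shows "(\<lambda>n. vnorm V (X n)) \<longlonglongrightarrow> vnorm V x"
proof -
  have c: "X n \<in> carrier V" "x \<in> carrier V" for n
    using assms by (auto simp: tends_to_def image_subset_iff)
  have le: "\<bar>vnorm V (X n) - vnorm V x\<bar> \<le> vnorm V (X n \<ominus> x)" for n
    using vnorm_le_diff[OF c] vnorm_le_diff[OF c(2) c(1)] vnorm_minus_commute[OF c(2) c(1)]
    by (smt (verit))
  have "(\<lambda>n. vnorm V (X n) - vnorm V x) \<longlonglongrightarrow> 0"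
  proof (rule Lim_null_comparison)
    show "(\<lambda>n. vnorm V (X n \<ominus> x)) \<longlonglongrightarrow> 0" using assms by (simp add: tends_to_def)
  qed (simp add: le)
  then show ?thesis by (rule LIM_zero_cancel)
qed

lemma tends_to_le:
  assumes "tends_to V X x" "\<And>n. vnorm V (X n) \<le> K" shows "vnorm V x \<le> K"
  using LIMSEQ_le_const2[OF tends_to_vnorm[OF assms(1)]] assms(2) by blast

lemma tends_to_Suc: "tends_to V X x \<Longrightarrow> tends_to V (\<lambda>n. X (Suc n)) x"
  unfolding tends_to_def by (auto dest: LIMSEQ_Suc simp: image_subset_iff)

lemma tends_to_cauchy:
  assumes "tends_to V X x" shows "norm_cauchy V X"
  unfolding norm_cauchy_def
proof (intro conjI allI impI)
  fix e :: real assume "e > 0"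
  then have "\<forall>\<^sub>F n in sequentially. vnorm V (X n \<ominus> x) < e / 2"
    using assms unfolding tends_to_def by (intro order_tendstoD(2)[of _ 0]) auto
  then obtain N where N: "\<And>n. n \<ge> N \<Longrightarrow> vnorm V (X n \<ominus> x) < e / 2"
    by (auto simp: eventually_sequentially)
  have "vnorm V (X m \<ominus> X n) < e" if "m \<ge> N" "n \<ge> N" for m n
    using N[OF that(1)] N[OF that(2)] vnorm_diff_triangle[of "X m" x "X n"]
      vnorm_minus_commute[of x "X n"] assms by (auto simp: tends_to_def image_subset_iff)
  then show "\<exists>N. \<forall>m\<ge>N. \<forall>n\<ge>N. vnorm V (X m \<ominus> X n) < e" by blast
qed (use assms in \<open>auto simp: tends_to_def\<close>)

lemma metric_space_vdist: "Metric_space (carrier V) (vdist V)"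
proof
  fix x y z
  show "0 \<le> vdist V x y" by (simp add: vdist_def vnorm_nonneg)
  show "vdist V x y = vdist V y x" by (simp add: vdist_def vnorm_minus_commute)
  assume "x \<in> carrier V" "y \<in> carrier V"
  then show "vdist V x y = 0 \<longleftrightarrow> x = y" by (simp add: vdist_def vnorm_eq_zero diff_eq_zero_iff)
  assume "z \<in> carrier V"
  then show "vdist V x z \<le> vdist V x y + vdist V y z"
    using \<open>x \<in> carrier V\<close> \<open>y \<in> carrier V\<close> by (simp add: vdist_def vnorm_diff_triangle)
qed

lemma limitin_iff_tends_to:
  assumes "range X \<subseteq> carrier V"
  shows "limitin (vtopology V) X l sequentially \<longleftrightarrow> tends_to V X l"
proof -
  interpret MS: Metric_space "carrier V" "vdist V" by (rule metric_space_vdist)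
  show ?thesis
    unfolding MS.limit_metric_sequentially tends_to_def LIMSEQ_def
    using assms by (auto simp: vdist_def image_subset_iff vnorm_nonneg)
qed

lemma mcomplete_iff:
  "Metric_space.mcomplete (carrier V) (vdist V) \<longleftrightarrow> (\<forall>X. norm_cauchy V X \<longrightarrow> (\<exists>l. tends_to V X l))"
proof -
  interpret MS: Metric_space "carrier V" "vdist V" by (rule metric_space_vdist)
  have "MS.MCauchy X \<longleftrightarrow> norm_cauchy V X" for X
    unfolding MS.MCauchy_def norm_cauchy_def by (fastforce simp: vdist_def image_subset_iff)
  then show ?thesis
    unfolding MS.mcomplete_def using limitin_iff_tends_to unfolding norm_cauchy_def by auto
qed

end

lemma complex_banach_spaceI:
  assumes "complex_normed_space V" "\<And>X. norm_cauchy V X \<Longrightarrow> \<exists>l. tends_to V X l"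
  shows "complex_banach_space V"
proof -
  interpret complex_normed_space V by fact
  show ?thesis
    by unfold_locales
      (auto simp: mcomplete_iff assms(2) vnorm_nonneg vnorm_eq_zero vnorm_triangle vnorm_scale)
qed

sublocale complex_banach_space \<subseteq> complex_normed_space
  by unfold_locales (auto simp: norm_nonneg norm_eq_zero norm_triangle norm_smult)

lemma (in complex_banach_space) norm_cauchy_tends_to:
  "norm_cauchy V X \<Longrightarrow> \<exists>l. tends_to V X l"
  using complete by (simp add: mcomplete_iff)

text \<open>A sequence converges if its increments are dominated by those of a convergent real sequence.\<close>

lemma (in complex_banach_space) dominated_tends_to:
  assumes X: "range X \<subseteq> carrier V" and "convergent f"
    and le: "\<And>n. vnorm V (X (Suc n) \<ominus> X n) \<le> f (Suc n) - f n"
  shows "\<exists>l. tends_to V X l"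
proof -
  have mono: "vnorm V (X (n + k) \<ominus> X n) \<le> f (n + k) - f n" for n k
  proof (induction k)
    case (Suc k)
    then show ?case
      using X le[of "n + k"] vnorm_diff_triangle[of "X (Suc (n + k))" "X (n + k)" "X n"]
      by (auto simp: image_subset_iff)
  qed (use X in \<open>auto simp: image_subset_iff\<close>)
  have "norm_cauchy V X"
    unfolding norm_cauchy_def
  proof (intro conjI allI impI)
    fix e :: real assume "e > 0"
    moreover have "Cauchy f" using assms(2) by (simp add: convergent_Cauchy)
    ultimately obtain N where N: "\<And>m n. m \<ge> N \<Longrightarrow> n \<ge> N \<Longrightarrow> \<bar>f m - f n\<bar> < e"
      by (metis Cauchy_iff real_norm_def)
    have "vnorm V (X m \<ominus> X n) < e" if "m \<ge> n" "n \<ge> N" for m n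
      using mono[of n "m - n"] N[of m n] that by force
    moreover have "vnorm V (X m \<ominus> X n) = vnorm V (X n \<ominus> X m)" for m n
      using X by (intro vnorm_minus_commute) auto
    ultimately have "vnorm V (X m \<ominus> X n) < e" if "m \<ge> N" "n \<ge> N" for m n
      using that by (metis nle_le)
    then show "\<exists>N. \<forall>m\<ge>N. \<forall>n\<ge>N. vnorm V (X m \<ominus> X n) < e" by blast
  qed (rule X)
  then show ?thesis by (rule norm_cauchy_tends_to)
qed

section \<open>Square roots in a unital $C^*$-algebra\<close>

context cstar_algebra
begin

declare mult_closed [simp, intro] star_closed [simp, intro] star_star [simp]

lemma star_minus: "x \<in> carrier A \<Longrightarrow> star A (\<ominus> x) = \<ominus> star A x"
  by (simp add: minus_scale star_smult)

lemma star_diff: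
  "x \<in> carrier A \<Longrightarrow> y \<in> carrier A \<Longrightarrow> star A (x \<ominus> y) = star A x \<ominus> star A y"
  by (simp add: M.minus_eq star_add star_minus)

lemma star_zero [simp]: "star A \<zero> = \<zero>"
  using star_smult[of \<zero> 0] by simp

lemma mult_zero_left [simp]: "x \<in> carrier A \<Longrightarrow> \<zero> \<otimes> x = \<zero>"
  using mult_smult_left[of \<zero> x 0] by simp

lemma mult_zero_right [simp]: "x \<in> carrier A \<Longrightarrow> x \<otimes> \<zero> = \<zero>"
  using mult_smult_right[of x \<zero> 0] by simp

lemma mult_minus_left: "x \<in> carrier A \<Longrightarrow> y \<in> carrier A \<Longrightarrow> (\<ominus> x) \<otimes> y = \<ominus> (x \<otimes> y)"
  by (simp add: minus_scale mult_smult_left)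

lemma mult_minus_right: "x \<in> carrier A \<Longrightarrow> y \<in> carrier A \<Longrightarrow> x \<otimes> (\<ominus> y) = \<ominus> (x \<otimes> y)"
  by (simp add: minus_scale mult_smult_right)

lemma mult_diff_left:
  "\<lbrakk>x \<in> carrier A; y \<in> carrier A; z \<in> carrier A\<rbrakk> \<Longrightarrow> (x \<ominus> y) \<otimes> z = x \<otimes> z \<ominus> y \<otimes> z"
  by (simp add: M.minus_eq mult_add_left mult_minus_left)

lemma mult_diff_right:
  "\<lbrakk>x \<in> carrier A; y \<in> carrier A; z \<in> carrier A\<rbrakk> \<Longrightarrow> x \<otimes> (y \<ominus> z) = x \<otimes> y \<ominus> x \<otimes> z"
  by (simp add: M.minus_eq mult_add_right mult_minus_right)

lemma vnorm_star [simp]: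
  assumes "x \<in> carrier A" shows "vnorm A (star A x) = vnorm A x"
proof -
  have le: "vnorm A y \<le> vnorm A (star A y)" if "y \<in> carrier A" for y
  proof (cases "vnorm A y = 0")
    case False
    have "vnorm A y * vnorm A y \<le> vnorm A (star A y) * vnorm A y"
      using norm_star_mult[OF that] norm_mult[OF star_closed[OF that] that]
      by (simp add: power2_eq_square)
    then show ?thesis using False vnorm_nonneg[OF that] by simp
  qed (use vnorm_nonneg[of "star A y"] that in simp)
  show ?thesis using le[OF assms] le[OF star_closed[OF assms]] assms by simp
qed

lemma vnorm_mult_star: "x \<in> carrier A \<Longrightarrow> vnorm A (x \<otimes> star A x) = (vnorm A x)\<^sup>2"
  using norm_star_mult[of "star A x"] by simp

lemma vnorm_selfadjoint_square:
  "x \<in> carrier A \<Longrightarrow> star A x = x \<Longrightarrow> vnorm A (x \<otimes> x) = (vnorm A x)\<^sup>2"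
  using norm_star_mult[of x] by simp

lemma tends_to_mult:
  assumes "tends_to A X x" "tends_to A Y y" shows "tends_to A (\<lambda>n. X n \<otimes> Y n) (x \<otimes> y)"
proof (rule tends_to_squeeze)
  have c: "X n \<in> carrier A" "x \<in> carrier A" "Y n \<in> carrier A" "y \<in> carrier A" for n
    using assms by (auto simp: tends_to_def image_subset_iff)
  show "range (\<lambda>n. X n \<otimes> Y n) \<subseteq> carrier A" "x \<otimes> y \<in> carrier A" using c by auto
  show "(\<lambda>n. vnorm A (X n) * vnorm A (Y n \<ominus> y) + vnorm A (X n \<ominus> x) * vnorm A y) \<longlonglongrightarrow> 0"
    using assms tends_to_vnorm[OF assms(1)] unfolding tends_to_def
    by (intro tendsto_eq_intros) auto
  fix n
  have "X n \<otimes> Y n \<ominus> x \<otimes> y = X n \<otimes> (Y n \<ominus> y) \<oplus> (X n \<ominus> x) \<otimes> y"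
    using c by (simp add: mult_diff_left mult_diff_right diff_trans)
  then show "vnorm A (X n \<otimes> Y n \<ominus> x \<otimes> y)
      \<le> vnorm A (X n) * vnorm A (Y n \<ominus> y) + vnorm A (X n \<ominus> x) * vnorm A y"
    using c vnorm_triangle[of "X n \<otimes> (Y n \<ominus> y)" "(X n \<ominus> x) \<otimes> y"]
      norm_mult[of "X n" "Y n \<ominus> y"] norm_mult[of "X n \<ominus> x" y]
    by simp
qed

lemma tends_to_star: "tends_to A X x \<Longrightarrow> tends_to A (\<lambda>n. star A (X n)) (star A x)"
  unfolding tends_to_def by (auto simp: image_subset_iff star_diff[symmetric])

lemma mult_interchange:
  assumes "a \<in> carrier A" "b \<in> carrier A" "c \<in> carrier A" "d \<in> carrier A" "b \<otimes> c = c \<otimes> b"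
  shows "(a \<otimes> b) \<otimes> (c \<otimes> d) = (a \<otimes> c) \<otimes> (b \<otimes> d)"
proof -
  have "(a \<otimes> b) \<otimes> (c \<otimes> d) = a \<otimes> ((b \<otimes> c) \<otimes> d)" using assms(1-4) by (simp add: mult_assoc)
  also have "\<dots> = (a \<otimes> c) \<otimes> (b \<otimes> d)" unfolding assms(5) using assms(1-4) by (simp add: mult_assoc)
  finally show ?thesis .
qed

end

text \<open>
  Closed real Jordan subspaces: norm-closed real subspaces (the empty set is not excluded) that contain
  the square of each of their elements. The selfadjoint elements, the bicommutant of an element and the
  image of a closed subalgebra are examples, so membership of square roots in such sets expresses at once
  that they are selfadjoint, that they commute with whatever commutes with \<open>x\<close>, and that they lie
  in a given subalgebra.
\<close>

definition closed_jordan :: "('v, 'm) star_algebra_scheme \<Rightarrow> 'v set \<Rightarrow> bool" where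
  "closed_jordan A D \<longleftrightarrow> D \<subseteq> carrier A \<and>
     (\<forall>x\<in>D. \<forall>y\<in>D. x \<oplus>\<^bsub>A\<^esub> y \<in> D) \<and>
     (\<forall>r. \<forall>x\<in>D. complex_of_real r \<odot>\<^bsub>A\<^esub> x \<in> D) \<and>
     (\<forall>x\<in>D. x \<otimes>\<^bsub>A\<^esub> x \<in> D) \<and>
     (\<forall>X l. range X \<subseteq> D \<longrightarrow> tends_to A X l \<longrightarrow> l \<in> D)"

text \<open>The elements that commute with everything that commutes with \<open>x\<close>.\<close>

definition bicommutant :: "('v, 'm) star_algebra_scheme \<Rightarrow> 'v \<Rightarrow> 'v set" where
  "bicommutant A x = {p \<in> carrier A. \<forall>c\<in>carrier A. c \<otimes>\<^bsub>A\<^esub> x = x \<otimes>\<^bsub>A\<^esub> c \<longrightarrow> c \<otimes>\<^bsub>A\<^esub> p = p \<otimes>\<^bsub>A\<^esub> c}"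

context cstar_algebra
begin

lemma closed_jordan_selfadjoint: "closed_jordan A {x \<in> carrier A. star A x = x}"
  unfolding closed_jordan_def
proof (intro conjI allI ballI impI)
  fix X l assume X: "range X \<subseteq> {x \<in> carrier A. star A x = x}" and l: "tends_to A X l"
  then have "star A (X n) = X n" for n by (auto simp: image_subset_iff)
  then have "tends_to A X (star A l)" using tends_to_star[OF l] by simp
  then have "star A l = l" using tends_to_unique[OF _ l] by blast
  then show "l \<in> {x \<in> carrier A. star A x = x}" using l by (simp add: tends_to_def)
qed (auto simp: star_add star_smult star_mult)

lemma bicommutant_mult:
  assumes "p \<in> bicommutant A x" "q \<in> bicommutant A x" shows "p \<otimes> q \<in> bicommutant A x"
  unfolding bicommutant_def
proof (clarsimp, intro conjI ballI impI)
  have pq: "p \<in> carrier A" "q \<in> carrier A" using assms by (auto simp: bicommutant_def)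
  then show "p \<otimes> q \<in> carrier A" by simp
  fix c assume c: "c \<in> carrier A" "c \<otimes> x = x \<otimes> c"
  then have cp: "c \<otimes> p = p \<otimes> c" and cq: "c \<otimes> q = q \<otimes> c"
    using assms by (auto simp: bicommutant_def)
  have "c \<otimes> (p \<otimes> q) = (c \<otimes> p) \<otimes> q" using pq c(1) by (simp add: mult_assoc)
  also have "\<dots> = p \<otimes> (c \<otimes> q)" unfolding cp using pq c(1) by (simp add: mult_assoc)
  also have "\<dots> = (p \<otimes> q) \<otimes> c" unfolding cq using pq c(1) by (simp add: mult_assoc)
  finally show "c \<otimes> (p \<otimes> q) = (p \<otimes> q) \<otimes> c" .
qed

lemma closed_jordan_bicommutant: "closed_jordan A (bicommutant A x)"
  unfolding closed_jordan_def
proof (intro conjI allI ballI impI)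
  fix X l assume X: "range X \<subseteq> bicommutant A x" and l: "tends_to A X l"
  have lc: "l \<in> carrier A" using l by (simp add: tends_to_def)
  have "c \<otimes> l = l \<otimes> c" if c: "c \<in> carrier A" "c \<otimes> x = x \<otimes> c" for c
  proof -
    have "c \<otimes> X n = X n \<otimes> c" for n
      using X that by (auto simp: bicommutant_def image_subset_iff)
    then have "tends_to A (\<lambda>n. X n \<otimes> c) (c \<otimes> l)"
      using tends_to_mult[OF tends_to_const[OF c(1)] l] by simp
    then show ?thesis using tends_to_unique tends_to_mult[OF l tends_to_const[OF c(1)]] by blast
  qed
  then show "l \<in> bicommutant A x" using lc by (simp add: bicommutant_def)
next
  fix p assume "p \<in> bicommutant A x"
  then show "p \<otimes> p \<in> bicommutant A x" by (intro bicommutant_mult)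
qed (auto simp: bicommutant_def mult_add_left mult_add_right mult_smult_left mult_smult_right)

lemma bicommutant_closed: "p \<in> bicommutant A x \<Longrightarrow> p \<in> carrier A"
  by (simp add: bicommutant_def)

lemma bicommutant_self: "x \<in> carrier A \<Longrightarrow> x \<in> bicommutant A x"
  by (simp add: bicommutant_def)

lemma bicommutant_commute:
  assumes "p \<in> bicommutant A x" "q \<in> bicommutant A x" "x \<in> carrier A"
  shows "p \<otimes> q = q \<otimes> p"
proof -
  have "p \<in> carrier A" "p \<otimes> x = x \<otimes> p" using assms(1,3) unfolding bicommutant_def by fastforce+
  then show ?thesis using assms(2) unfolding bicommutant_def by blast
qed

lemma bicommutant_diff: "p \<in> bicommutant A x \<Longrightarrow> q \<in> bicommutant A x \<Longrightarrow> p \<ominus> q \<in> bicommutant A x"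
  by (auto simp: bicommutant_def mult_diff_left mult_diff_right)

lemma bicommutant_scale: "p \<in> bicommutant A x \<Longrightarrow> c \<odot> p \<in> bicommutant A x"
  by (auto simp: bicommutant_def mult_smult_left mult_smult_right)

end

text \<open>
  The component \<open>one\<close> of the record is now the unit. It may be zero, in which case the algebra is zero.
\<close>

locale unital_cstar = cstar_algebra A for A :: "('v, 'm) star_algebra_scheme" (structure) +
  assumes unit_closed [simp, intro]: "\<one> \<in> carrier A"
    and mult_one_left [simp]: "x \<in> carrier A \<Longrightarrow> \<one> \<otimes> x = x"
    and mult_one_right [simp]: "x \<in> carrier A \<Longrightarrow> x \<otimes> \<one> = x"
begin

sublocale U: ring A
  by (rule ringI)
    (auto intro!: M.abelian_group_axioms monoidI simp: mult_assoc mult_add_left mult_add_right)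

lemma star_one [simp]: "star A \<one> = \<one>"
  using star_mult[of \<one> "star A \<one>"] by simp

lemma vnorm_one_le: "vnorm A \<one> \<le> 1"
proof -
  have "vnorm A \<one> = (vnorm A \<one>)\<^sup>2" using norm_star_mult[of \<one>] by simp
  then have "vnorm A \<one> = 0 \<or> vnorm A \<one> = 1" by (auto simp: power2_eq_square)
  then show ?thesis by auto
qed

lemma bicommutant_one: "\<one> \<in> bicommutant A x"
  by (simp add: bicommutant_def)

lemma scalar_mult [simp]: "x \<in> carrier A \<Longrightarrow> (c \<odot> \<one>) \<otimes> x = c \<odot> x"
  by (simp add: mult_smult_left)

lemma mult_scalar [simp]: "x \<in> carrier A \<Longrightarrow> x \<otimes> (c \<odot> \<one>) = c \<odot> x"
  by (simp add: mult_smult_right)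

text \<open>
  With \<open>h = 1 - x\<close>, a solution of \<open>2 y = h + y^2\<close> gives \<open>(1 - y)^2 = x\<close>. The iteration
  \<open>y_{n+1} = (h + y_n^2) / 2\<close> from \<open>y_0 = 0\<close> has increments dominated by those of the same iteration
  \<open>\<eta>\<close> for the real number \<open>h = 1\<close>, which increases to 1. The elements \<open>w_n = \<eta>_n - y_n\<close> obey
  \<open>w_{n+1} = (x + 2 \<eta>_n w_n - w_n^2) / 2\<close>, where the unit does not occur, so they and their limit
  \<open>1 - y\<close> stay in every closed real Jordan subspace that contains \<open>x\<close>.
\<close>

lemma sqrt_contraction:
  assumes x: "x \<in> carrier A" and x1: "vnorm A (\<one> \<ominus> x) \<le> 1"
  obtains k where "k \<in> carrier A" "k \<otimes> k = x" "vnorm A (\<one> \<ominus> k) \<le> 1"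
    "\<And>D. closed_jordan A D \<Longrightarrow> x \<in> D \<Longrightarrow> k \<in> D"
proof -
  define h where "h = \<one> \<ominus> x"
  define \<eta> :: "nat \<Rightarrow> real" where "\<eta> = rec_nat 0 (\<lambda>_ e. (1 + e\<^sup>2) / 2)"
  define y where "y = rec_nat \<zero> (\<lambda>_ v. (1/2) \<odot> (h \<oplus> v \<otimes> v))"
  have \<eta>0: "\<eta> 0 = 0" and \<eta>S: "\<eta> (Suc n) = (1 + (\<eta> n)\<^sup>2) / 2" for n by (simp_all add: \<eta>_def)
  have y0: "y 0 = \<zero>" and yS: "y (Suc n) = (1/2) \<odot> (h \<oplus> y n \<otimes> y n)" for n by (simp_all add: y_def)
  have h: "h \<in> carrier A" using x by (simp add: h_def)
  have \<eta>b: "0 \<le> \<eta> n \<and> \<eta> n \<le> 1" for n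
    by (induction n) (auto simp: \<eta>0 \<eta>S power_le_one)
  have \<eta>inc: "\<eta> n \<le> \<eta> (Suc n)" for n
    using zero_le_power2[of "1 - \<eta> n"] by (simp add: \<eta>S power2_diff)
  have conv: "convergent \<eta>"
    using \<eta>b \<eta>inc by (intro Bseq_mono_convergent BseqI'[of _ 1]) (auto intro: lift_Suc_mono_le)
  then obtain L where L: "\<eta> \<longlonglongrightarrow> L" by (auto simp: convergent_def)
  have "(\<lambda>n. \<eta> (Suc n)) \<longlonglongrightarrow> (1 + L\<^sup>2) / 2" unfolding \<eta>S by (intro tendsto_intros L) auto
  then have "L = (1 + L\<^sup>2) / 2" using LIMSEQ_unique LIMSEQ_Suc[OF L] by blast
  then have "(L - 1)\<^sup>2 = 0" by (simp add: power2_diff)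
  then have L1: "\<eta> \<longlonglongrightarrow> 1" using L by simp
  have yc: "y n \<in> carrier A" for n by (induction n) (auto simp: y0 yS h)
  have yn: "vnorm A (y n) \<le> \<eta> n" for n
  proof (induction n)
    case (Suc n)
    have "vnorm A (h \<oplus> y n \<otimes> y n) \<le> vnorm A h + vnorm A (y n) * vnorm A (y n)"
      using vnorm_triangle[of h "y n \<otimes> y n"] norm_mult[OF yc yc, of n n] h yc by simp
    also have "\<dots> \<le> 1 + \<eta> n * \<eta> n"
      using x1 Suc \<eta>b[of n] vnorm_nonneg[OF yc] unfolding h_def by (intro add_mono mult_mono) auto
    finally show ?case using h yc by (simp add: yS \<eta>S vnorm_scale power2_eq_square)
  qed (simp add: y0 \<eta>0)
  have inc: "vnorm A (y (Suc n) \<ominus> y n) \<le> \<eta> (Suc n) - \<eta> n" for n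
  proof (induction n)
    case 0
    show ?case using x1 h by (simp add: yS y0 \<eta>S \<eta>0 M.minus_eq vnorm_scale h_def)
  next
    case (Suc n)
    let ?a = "y (Suc n)" and ?b = "y n"
    have c: "?a \<in> carrier A" "?b \<in> carrier A" by (rule yc)+
    have "(h \<oplus> ?a \<otimes> ?a) \<ominus> (h \<oplus> ?b \<otimes> ?b) = ?a \<otimes> (?a \<ominus> ?b) \<oplus> (?a \<ominus> ?b) \<otimes> ?b"
      using c h by algebra
    then have "y (Suc (Suc n)) \<ominus> y (Suc n) = (1/2) \<odot> (?a \<otimes> (?a \<ominus> ?b) \<oplus> (?a \<ominus> ?b) \<otimes> ?b)"
      using c h by (simp add: yS[of "Suc n"] yS[of n, symmetric] scale_diff_right[symmetric])
        (simp add: yS[of n] scale_diff_right[symmetric])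
    then have "vnorm A (y (Suc (Suc n)) \<ominus> y (Suc n))
        = vnorm A (?a \<otimes> (?a \<ominus> ?b) \<oplus> (?a \<ominus> ?b) \<otimes> ?b) / 2"
      using c by (simp add: vnorm_scale)
    also have "\<dots> \<le> (vnorm A ?a * vnorm A (?a \<ominus> ?b) + vnorm A (?a \<ominus> ?b) * vnorm A ?b) / 2"
      using c vnorm_triangle[of "?a \<otimes> (?a \<ominus> ?b)" "(?a \<ominus> ?b) \<otimes> ?b"]
        norm_mult[of ?a "?a \<ominus> ?b"] norm_mult[of "?a \<ominus> ?b" ?b] by simp
    also have "\<dots> \<le> (\<eta> (Suc n) * (\<eta> (Suc n) - \<eta> n) + (\<eta> (Suc n) - \<eta> n) * \<eta> n) / 2"
      using Suc yn[of n] yn[of "Suc n"] c \<eta>b[of "Suc n"] \<eta>b[of n] \<eta>inc[of n]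
      by (intro divide_right_mono add_mono mult_mono) (auto simp: vnorm_nonneg)
    also have "\<dots> = \<eta> (Suc (Suc n)) - \<eta> (Suc n)"
    proof -
      have e: "\<eta> n * \<eta> n = 2 * \<eta> (Suc n) - 1" by (simp add: \<eta>S power2_eq_square add_divide_distrib)
      have "\<eta> (Suc n) * (\<eta> (Suc n) - \<eta> n) + (\<eta> (Suc n) - \<eta> n) * \<eta> n
          = \<eta> (Suc n) * \<eta> (Suc n) - \<eta> n * \<eta> n" by (simp add: algebra_simps)
      then show ?thesis unfolding e \<eta>S[of "Suc n"] power2_eq_square by simp
    qed
    finally show ?case .
  qed
  obtain l where l: "tends_to A y l"
    using dominated_tends_to[of y \<eta>, OF _ conv inc] yc by (auto simp: image_subset_iff)
  have lc: "l \<in> carrier A" using l by (simp add: tends_to_def)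
  define w where "w n = complex_of_real (\<eta> n) \<odot> \<one> \<ominus> y n" for n
  define k where "k = \<one> \<ominus> l"
  have wc: "w n \<in> carrier A" for n by (simp add: w_def yc)
  have kc: "k \<in> carrier A" by (simp add: k_def lc)
  have wk: "tends_to A w k"
    unfolding w_def k_def
    using tends_to_diff[OF tends_to_scalar[of "\<lambda>n. complex_of_real (\<eta> n)" 1 \<one>] l]
      tendsto_of_real[OF L1, where 'a = complex] by simp
  have wS: "w (Suc n) = (1/2) \<odot> (x \<oplus> ((complex_of_real (2 * \<eta> n) \<odot> w n) \<ominus> w n \<otimes> w n))" for n
  proof -
    define s where "s = complex_of_real (\<eta> n) \<odot> \<one>"
    have s: "s \<in> carrier A" by (simp add: s_def)
    have ss: "s \<otimes> s = (complex_of_real (\<eta> n))\<^sup>2 \<odot> \<one>"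
      by (simp add: s_def scale_scale power2_eq_square)
    have sw: "complex_of_real (2 * \<eta> n) \<odot> w n = s \<otimes> w n \<oplus> w n \<otimes> s"
      using wc[of n] by (simp add: s_def double scale_scale)
    have w: "w n = s \<ominus> y n" by (simp add: w_def s_def)
    have "complex_of_real (\<eta> (Suc n)) \<odot> \<one> = (1/2) \<odot> (\<one> \<oplus> s \<otimes> s)"
      by (simp add: \<eta>S ss scale_add_right scale_scale scale_add_left[symmetric] add_divide_distrib)
    then have "w (Suc n) = (1/2) \<odot> ((\<one> \<oplus> s \<otimes> s) \<ominus> (h \<oplus> y n \<otimes> y n))"
      using s h yc[of n] by (simp add: w_def yS scale_diff_right)
    also have "(\<one> \<oplus> s \<otimes> s) \<ominus> (h \<oplus> y n \<otimes> y n)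
        = x \<oplus> ((s \<otimes> (s \<ominus> y n) \<oplus> (s \<ominus> y n) \<otimes> s) \<ominus> (s \<ominus> y n) \<otimes> (s \<ominus> y n))"
      unfolding h_def using s yc[of n] x unit_closed by algebra
    finally show ?thesis unfolding sw unfolding w .
  qed
  have "tends_to A (\<lambda>n. w (Suc n)) ((1/2) \<odot> (x \<oplus> (2 \<odot> k \<ominus> k \<otimes> k)))"
    unfolding wS
  proof (intro tends_to_scale tends_to_add tends_to_diff tends_to_mult wk tends_to_const x)
    have "tends_to A (\<lambda>n. (complex_of_real (2 * \<eta> n) \<odot> \<one>) \<otimes> w n) ((2 \<odot> \<one>) \<otimes> k)"
      using tendsto_of_real[OF tendsto_mult_left[OF L1, of 2], where 'a = complex]
      by (intro tends_to_mult tends_to_scalar wk) auto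
    then show "tends_to A (\<lambda>n. complex_of_real (2 * \<eta> n) \<odot> w n) (2 \<odot> k)"
      using wc kc by simp
  qed
  then have "k = (1/2) \<odot> (x \<oplus> (2 \<odot> k \<ominus> k \<otimes> k))"
    using tends_to_unique tends_to_Suc[OF wk] by blast
  then have "2 \<odot> k = 2 \<odot> ((1/2) \<odot> (x \<oplus> (2 \<odot> k \<ominus> k \<otimes> k)))" by simp
  also have "\<dots> = x \<oplus> (2 \<odot> k \<ominus> k \<otimes> k)" using x kc by (subst scale_scale) auto
  finally have "k \<oplus> k = x \<oplus> (k \<oplus> k \<ominus> k \<otimes> k)" using kc by (simp add: double)
  then have "(k \<oplus> k) \<oplus> (k \<otimes> k \<ominus> (k \<oplus> k)) = (x \<oplus> (k \<oplus> k \<ominus> k \<otimes> k)) \<oplus> (k \<otimes> k \<ominus> (k \<oplus> k))" by simp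
  moreover have "(k \<oplus> k) \<oplus> (k \<otimes> k \<ominus> (k \<oplus> k)) = k \<otimes> k"
    "(x \<oplus> (k \<oplus> k \<ominus> k \<otimes> k)) \<oplus> (k \<otimes> k \<ominus> (k \<oplus> k)) = x" using kc x by algebra+
  ultimately have kk: "k \<otimes> k = x" by simp
  have "vnorm A l \<le> 1" using tends_to_le[OF l] yn \<eta>b by (meson order_trans)
  moreover have "\<one> \<ominus> k = l" unfolding k_def using lc unit_closed by algebra
  ultimately have k1: "vnorm A (\<one> \<ominus> k) \<le> 1" by simp
  have kD: "k \<in> D" if D: "closed_jordan A D" "x \<in> D" for D
  proof -
    have add: "\<And>a b. a \<in> D \<Longrightarrow> b \<in> D \<Longrightarrow> a \<oplus> b \<in> D"
      and sc: "\<And>r a. a \<in> D \<Longrightarrow> complex_of_real r \<odot> a \<in> D"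
      and sq: "\<And>a. a \<in> D \<Longrightarrow> a \<otimes> a \<in> D"
      and lim: "\<And>X l. range X \<subseteq> D \<Longrightarrow> tends_to A X l \<Longrightarrow> l \<in> D"
      using D(1) by (auto simp: closed_jordan_def)
    have "w n \<in> D" for n
    proof (induction n)
      case 0
      have "w 0 = complex_of_real 0 \<odot> x" using x by (simp add: w_def \<eta>0 y0)
      then show ?case using sc[OF D(2)] by metis
    next
      case (Suc n)
      have "w (Suc n) = complex_of_real (1/2) \<odot>
          (x \<oplus> (complex_of_real (2 * \<eta> n) \<odot> w n \<oplus> complex_of_real (- 1) \<odot> (w n \<otimes> w n)))"
        using wc[of n] by (simp add: wS M.minus_eq minus_scale)
      then show ?case using Suc by (simp only:) (intro sc add sq D(2))
    qed
    then show ?thesis using lim[OF _ wk] by auto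
  qed
  show ?thesis using that[OF kc kk k1 kD] .
qed

end

section \<open>The order of a unital $C^*$-algebra\<close>

text \<open>
  Positivity by the norm: for a selfadjoint element the condition says that its spectrum lies in
  \<open>[0, 2 t]\<close>. By \<open>pos_star_mult\<close> and \<open>sqrt_pos\<close> it agrees with being of the form \<open>y* y\<close>.
\<close>

definition (in unital_cstar) pos :: "'v \<Rightarrow> bool" where
  "pos x \<longleftrightarrow> x \<in> carrier A \<and> star A x = x \<and>
     (\<exists>t\<ge>0. vnorm A (complex_of_real t \<odot> \<one> \<ominus> x) \<le> t)"

context unital_cstar
begin

lemma pos_star: "pos x \<Longrightarrow> star A x = x"
  by (simp add: pos_def)

lemma posI:
  assumes "x \<in> carrier A" "star A x = x" "0 \<le> t" "vnorm A (complex_of_real t \<odot> \<one> \<ominus> x) \<le> t"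
  shows "pos x"
  using assms by (auto simp: pos_def)

lemma pos_add:
  assumes "pos x" "pos y" shows "pos (x \<oplus> y)"
proof -
  obtain s t where s: "0 \<le> s" "vnorm A (complex_of_real s \<odot> \<one> \<ominus> x) \<le> s"
    and t: "0 \<le> t" "vnorm A (complex_of_real t \<odot> \<one> \<ominus> y) \<le> t"
    using assms by (auto simp: pos_def)
  have c: "x \<in> carrier A" "y \<in> carrier A" using assms by (auto simp: pos_def)
  have "complex_of_real (s + t) \<odot> \<one> \<ominus> (x \<oplus> y)
      = (complex_of_real s \<odot> \<one> \<ominus> x) \<oplus> (complex_of_real t \<odot> \<one> \<ominus> y)"
    using c by (simp add: scale_add_left add_diff_add)
  then have "vnorm A (complex_of_real (s + t) \<odot> \<one> \<ominus> (x \<oplus> y)) \<le> s + t"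
    using s t c vnorm_triangle[of "complex_of_real s \<odot> \<one> \<ominus> x" "complex_of_real t \<odot> \<one> \<ominus> y"]
    by simp
  then show ?thesis
    using posI[of "x \<oplus> y" "s + t"] s t c assms by (simp add: star_add pos_star)
qed

lemma pos_scale:
  assumes "pos x" "0 \<le> r" shows "pos (complex_of_real r \<odot> x)"
proof -
  obtain t where t: "0 \<le> t" "vnorm A (complex_of_real t \<odot> \<one> \<ominus> x) \<le> t"
    using assms by (auto simp: pos_def)
  have c: "x \<in> carrier A" using assms by (auto simp: pos_def)
  have "complex_of_real (r * t) \<odot> \<one> \<ominus> complex_of_real r \<odot> x
      = complex_of_real r \<odot> (complex_of_real t \<odot> \<one> \<ominus> x)"
    using c by (simp add: scale_diff_right scale_scale)
  then have "vnorm A (complex_of_real (r * t) \<odot> \<one> \<ominus> complex_of_real r \<odot> x) \<le> r * t"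
    using t c assms(2) by (simp add: vnorm_scale mult_left_mono)
  then show ?thesis
    using posI[of "complex_of_real r \<odot> x" "r * t"] t c assms by (simp add: star_smult pos_star)
qed

lemma sqrt_pos:
  assumes "pos x"
  obtains k where "pos k" "k \<otimes> k = x" "\<And>D. closed_jordan A D \<Longrightarrow> x \<in> D \<Longrightarrow> k \<in> D"
proof -
  obtain t0 where t0: "0 \<le> t0" "vnorm A (complex_of_real t0 \<odot> \<one> \<ominus> x) \<le> t0"
    using assms by (auto simp: pos_def)
  have c: "x \<in> carrier A" "star A x = x" using assms by (auto simp: pos_def)
  define t where "t = t0 + 1"
  have tpos: "t > 0" using t0 by (simp add: t_def)
  have "complex_of_real t \<odot> \<one> \<ominus> x = (complex_of_real t0 \<odot> \<one> \<ominus> x) \<oplus> \<one>"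
    using c by (simp add: t_def scale_add_left M.minus_eq M.a_ac)
  then have t: "vnorm A (complex_of_real t \<odot> \<one> \<ominus> x) \<le> t"
    using vnorm_triangle[of "complex_of_real t0 \<odot> \<one> \<ominus> x" \<one>] vnorm_one_le t0 c by (simp add: t_def)
  define z where "z = complex_of_real (1 / t) \<odot> x"
  have z: "z \<in> carrier A" using c by (simp add: z_def)
  have "\<one> \<ominus> z = complex_of_real (1 / t) \<odot> (complex_of_real t \<odot> \<one> \<ominus> x)"
    using c tpos unfolding z_def by (subst scale_diff_right) (simp_all add: scale_scale)
  then have "vnorm A (\<one> \<ominus> z) \<le> 1"
    using t tpos c by (simp add: vnorm_scale del: of_real_divide)
  then obtain k where k: "k \<in> carrier A" "k \<otimes> k = z" "vnorm A (\<one> \<ominus> k) \<le> 1"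
    and kD: "\<And>D. closed_jordan A D \<Longrightarrow> z \<in> D \<Longrightarrow> k \<in> D"
    using sqrt_contraction[OF z] by blast
  have zD: "z \<in> D" if "closed_jordan A D" "x \<in> D" for D
    using that unfolding z_def closed_jordan_def by blast
  define q where "q = complex_of_real (sqrt t) \<odot> k"
  have D: "q \<in> D" if "closed_jordan A D" "x \<in> D" for D
    using kD[OF that(1) zD[OF that]] that(1) unfolding q_def closed_jordan_def by blast
  have "q \<otimes> q = complex_of_real (sqrt t * sqrt t) \<odot> z"
    using k z by (simp add: q_def mult_smult_left mult_smult_right scale_scale
        del: real_sqrt_mult_self)
  also have "\<dots> = complex_of_real t \<odot> (complex_of_real (1 / t) \<odot> x)" using tpos by (simp add: z_def)
  also have "\<dots> = x" using c tpos by (simp add: scale_scale)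
  finally have qq: "q \<otimes> q = x" .
  have qs: "star A q = q" using D[OF closed_jordan_selfadjoint] c by simp
  have "complex_of_real (sqrt t) \<odot> \<one> \<ominus> q = complex_of_real (sqrt t) \<odot> (\<one> \<ominus> k)"
    using k by (simp add: q_def scale_diff_right)
  then have "vnorm A (complex_of_real (sqrt t) \<odot> \<one> \<ominus> q) \<le> sqrt t"
    using k tpos by (simp add: vnorm_scale mult_left_le)
  then have "pos q" using k qs tpos by (intro posI[of q "sqrt t"]) (auto simp: q_def)
  then show ?thesis using that[OF _ qq D] by blast
qed

text \<open>The element \<open>u = h + i k\<close> satisfies \<open>u* u = h^2 + k^2\<close>, and \<open>2 i k = u - u*\<close>.\<close>

lemma norm_le_of_sum_squares:
  assumes h: "h \<in> carrier A" "star A h = h" and k: "k \<in> carrier A" "star A k = k"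
    and hk: "h \<otimes> k = k \<otimes> h" and s: "0 \<le> s" "h \<otimes> h \<oplus> k \<otimes> k = complex_of_real s \<odot> \<one>"
  shows "(vnorm A k)\<^sup>2 \<le> s"
proof -
  define j where "j = \<i> \<odot> k"
  have j: "j \<in> carrier A" "star A j = \<ominus> j" "j \<otimes> j = \<ominus> (k \<otimes> k)" "h \<otimes> j = j \<otimes> h"
    using h k hk
    by (simp_all add: j_def star_smult scale_minus_left mult_smult_left mult_smult_right scale_scale)
  define u where "u = h \<oplus> j"
  have u: "u \<in> carrier A" "star A u = h \<ominus> j" using h j by (simp_all add: u_def star_add M.minus_eq)
  have "(h \<ominus> j) \<otimes> (h \<oplus> j) = h \<otimes> h \<oplus> (h \<otimes> j \<ominus> j \<otimes> h) \<ominus> j \<otimes> j" using h j(1) by algebra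
  then have "star A u \<otimes> u = complex_of_real s \<odot> \<one>"
    using u h j k s(2) by (simp add: u_def M.minus_eq M.r_neg)
  then have un: "(vnorm A u)\<^sup>2 \<le> s"
    using norm_star_mult[OF u(1)] s(1) vnorm_one_le
    by (simp add: vnorm_scale) (metis mult.right_neutral mult_left_mono)
  have "u \<ominus> star A u = j \<oplus> j" unfolding u(2) unfolding u_def using h j(1) by algebra
  then have "vnorm A (u \<ominus> star A u) = 2 * vnorm A k"
    using k by (simp add: double j_def scale_scale vnorm_scale Real_Vector_Spaces.norm_mult)
  then have "2 * vnorm A k \<le> vnorm A u + vnorm A u"
    using vnorm_diff[OF u(1) star_closed[OF u(1)]] vnorm_star[OF u(1)] by simp
  then have "(vnorm A k)\<^sup>2 \<le> (vnorm A u)\<^sup>2" using vnorm_nonneg[OF k(1)] by (intro power_mono) auto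
  then show ?thesis using un by simp
qed

text \<open>
  After scaling, \<open>h^2 + k^2 = 1\<close> with \<open>k\<close> the square root of \<open>1 - h^2\<close>, and then
  \<open>\<parallel>1 - h^2\<parallel> = \<parallel>k\<parallel>^2 \<le> 1\<close>.
\<close>

lemma pos_square:
  assumes h: "h \<in> carrier A" "star A h = h" shows "pos (h \<otimes> h)"
proof -
  define t where "t = (vnorm A h)\<^sup>2 + 1"
  have t: "t > 0" by (simp add: t_def add_nonneg_pos)
  define g where "g = complex_of_real (1 / sqrt t) \<odot> h"
  have g: "g \<in> carrier A" "star A g = g" using h by (simp_all add: g_def star_smult)
  have gg: "g \<otimes> g = complex_of_real (1 / t) \<odot> (h \<otimes> h)"
    using h t by (simp add: g_def mult_smult_left mult_smult_right scale_scale
        flip: of_real_mult)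
  have "vnorm A (g \<otimes> g) = \<bar>1 / t\<bar> * (vnorm A h)\<^sup>2"
    unfolding gg using h by (simp add: vnorm_scale vnorm_selfadjoint_square del: of_real_divide)
  also have "\<dots> \<le> 1" using t by (simp add: divide_le_eq) (simp add: t_def)
  finally have "vnorm A (g \<otimes> g) \<le> 1" .
  moreover have "\<one> \<ominus> (\<one> \<ominus> g \<otimes> g) = g \<otimes> g" using g(1) unit_closed by algebra
  ultimately have "vnorm A (\<one> \<ominus> (\<one> \<ominus> g \<otimes> g)) \<le> 1" by simp
  then obtain k where k: "k \<in> carrier A" "k \<otimes> k = \<one> \<ominus> g \<otimes> g"
    and kD: "\<And>D. closed_jordan A D \<Longrightarrow> \<one> \<ominus> g \<otimes> g \<in> D \<Longrightarrow> k \<in> D"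
    using sqrt_contraction[of "\<one> \<ominus> g \<otimes> g"] g by (metis M.minus_closed mult_closed unit_closed)
  have ks: "star A k = k"
    using kD[OF closed_jordan_selfadjoint] g by (simp add: star_diff star_mult)
  have "\<one> \<ominus> g \<otimes> g \<in> bicommutant A g"
    using g by (intro bicommutant_diff bicommutant_mult bicommutant_one bicommutant_self)
  then have "g \<otimes> k = k \<otimes> g"
    using kD[OF closed_jordan_bicommutant] bicommutant_commute bicommutant_self g by metis
  moreover have "g \<otimes> g \<oplus> k \<otimes> k = complex_of_real 1 \<odot> \<one>"
  proof -
    have "g \<otimes> g \<oplus> (\<one> \<ominus> g \<otimes> g) = \<one>" using g(1) unit_closed by algebra
    then show ?thesis by (simp add: k)
  qed
  ultimately have "(vnorm A k)\<^sup>2 \<le> 1" using norm_le_of_sum_squares[OF g k(1) ks] by force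
  then have "vnorm A (complex_of_real 1 \<odot> \<one> \<ominus> g \<otimes> g) \<le> 1"
    using k ks vnorm_selfadjoint_square[of k] by simp
  then have "pos (g \<otimes> g)" using g by (intro posI[of _ 1]) (auto simp: star_mult)
  then have "pos (complex_of_real t \<odot> (g \<otimes> g))" using t by (intro pos_scale) auto
  then show ?thesis using t h by (simp add: gg scale_scale)
qed

lemma commuting_roots:
  assumes "pos p" "pos q" "p \<in> bicommutant A x" "q \<in> bicommutant A x" "x \<in> carrier A"
  obtains h k where "pos h" "pos k" "h \<otimes> h = p" "k \<otimes> k = q" "h \<otimes> k = k \<otimes> h"
proof -
  obtain h where h: "pos h" "h \<otimes> h = p" "h \<in> bicommutant A x"
    using sqrt_pos[OF assms(1)] closed_jordan_bicommutant assms(3) by metis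
  obtain k where k: "pos k" "k \<otimes> k = q" "k \<in> bicommutant A x"
    using sqrt_pos[OF assms(2)] closed_jordan_bicommutant assms(4) by metis
  show ?thesis using that[OF h(1) k(1) h(2) k(2)] bicommutant_commute[OF h(3) k(3) assms(5)] .
qed

lemma pos_mult:
  assumes "pos p" "pos q" "p \<in> bicommutant A x" "q \<in> bicommutant A x" "x \<in> carrier A"
  shows "pos (p \<otimes> q)"
proof -
  obtain h k where hk: "pos h" "pos k" "h \<otimes> h = p" "k \<otimes> k = q" "h \<otimes> k = k \<otimes> h"
    using commuting_roots[OF assms] .
  have c: "h \<in> carrier A" "k \<in> carrier A" "star A h = h" "star A k = k"
    using hk by (auto simp: pos_def)
  have "pos ((h \<otimes> k) \<otimes> (h \<otimes> k))" using c hk by (intro pos_square) (auto simp: star_mult)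
  then show ?thesis using mult_interchange[of h h k k] c hk by simp
qed

lemma pos_norm_le:
  assumes "pos p" "pos (complex_of_real s \<odot> \<one> \<ominus> p)" "0 \<le> s" shows "vnorm A p \<le> s"
proof -
  have p: "p \<in> carrier A" using assms by (simp add: pos_def)
  have "complex_of_real s \<odot> \<one> \<ominus> p \<in> bicommutant A p"
    using p by (intro bicommutant_diff bicommutant_scale bicommutant_one bicommutant_self)
  then obtain h k where hk: "pos h" "pos k" "h \<otimes> h = p" "k \<otimes> k = complex_of_real s \<odot> \<one> \<ominus> p"
      "h \<otimes> k = k \<otimes> h"
    using commuting_roots[OF assms(1,2) bicommutant_self[OF p] _ p] by metis
  have c: "h \<in> carrier A" "k \<in> carrier A" "star A h = h" "star A k = k"
    using hk by (auto simp: pos_def)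
  have "(vnorm A h)\<^sup>2 \<le> s"
    using norm_le_of_sum_squares[of k h s] c hk assms(3) p by (simp add: diff_add_cancel)
  then show ?thesis using vnorm_selfadjoint_square[of h] c hk by simp
qed

lemma pos_norm_minus:
  assumes "x \<in> carrier A" "star A x = x" "vnorm A x \<le> s"
  shows "pos (complex_of_real s \<odot> \<one> \<ominus> x)"
proof (rule posI)
  have "complex_of_real s \<odot> \<one> \<ominus> (complex_of_real s \<odot> \<one> \<ominus> x) = x"
    using assms(1) scale_closed[OF unit_closed] by algebra
  then show "vnorm A (complex_of_real s \<odot> \<one> \<ominus> (complex_of_real s \<odot> \<one> \<ominus> x)) \<le> s"
    using assms by simp
qed (use assms vnorm_nonneg[of x] in \<open>auto simp: star_diff star_smult\<close>)

lemma pos_norm_mono: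
  assumes "pos p" "q \<in> carrier A" "pos (q \<ominus> p)" shows "vnorm A p \<le> vnorm A q"
proof -
  have p: "p \<in> carrier A" "star A p = p" using assms by (auto simp: pos_def)
  have "star A q = star A ((q \<ominus> p) \<oplus> p)" using assms p by (simp add: diff_add_cancel)
  also have "\<dots> = (q \<ominus> p) \<oplus> p"
    using assms(2) p by (subst star_add) (simp_all only: pos_star[OF assms(3)] M.minus_closed p)
  also have "\<dots> = q" using assms p by (simp add: diff_add_cancel)
  finally have "pos (complex_of_real (vnorm A q) \<odot> \<one> \<ominus> q)"
    using assms(2) by (intro pos_norm_minus) auto
  then have "pos ((complex_of_real (vnorm A q) \<odot> \<one> \<ominus> q) \<oplus> (q \<ominus> p))" by (rule pos_add[OF _ assms(3)])
  then show ?thesis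
    using assms p by (intro pos_norm_le) (auto simp: diff_trans vnorm_nonneg)
qed

lemma pos_antisym:
  assumes "pos p" "pos (\<ominus> p)" shows "p = \<zero>"
proof -
  have p: "p \<in> carrier A" using assms by (simp add: pos_def)
  have "vnorm A p \<le> 0" using assms p by (intro pos_norm_le) (auto simp: M.minus_eq)
  then show ?thesis using vnorm_nonneg[OF p] vnorm_eq_zero[OF p] by simp
qed

text \<open>
  If \<open>r\<close> is the absolute value of \<open>x\<close>, the square root of \<open>x^2\<close>, then \<open>w = r - x\<close> (twice the negative
  part of \<open>x\<close>) satisfies \<open>w x = - r w\<close>, so that \<open>w x w\<close> is minus a square.
\<close>

lemma selfadjoint_compression:
  assumes x: "x \<in> carrier A" "star A x = x"
  obtains w k where "w \<in> carrier A" "star A w = w" "k \<in> carrier A" "star A k = k"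
    "w \<otimes> x \<otimes> w = \<ominus> (k \<otimes> k)" "k = \<zero> \<Longrightarrow> pos x"
proof -
  obtain r where r: "pos r" "r \<otimes> r = x \<otimes> x"
    and rD: "\<And>D. closed_jordan A D \<Longrightarrow> x \<otimes> x \<in> D \<Longrightarrow> r \<in> D"
    using sqrt_pos[OF pos_square[OF x]] by metis
  have rb: "r \<in> bicommutant A x"
    using x by (intro rD closed_jordan_bicommutant bicommutant_mult bicommutant_self)
  obtain s where s: "pos s" "s \<otimes> s = r" "s \<in> bicommutant A x"
    using sqrt_pos[OF r(1)] closed_jordan_bicommutant rb by metis
  define w where "w = r \<ominus> x"
  have wb: "w \<in> bicommutant A x"
    unfolding w_def using x rb by (intro bicommutant_diff bicommutant_self)
  have c: "r \<in> carrier A" "s \<in> carrier A" "w \<in> carrier A" "star A r = r" "star A s = s"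
    using r(1) s(1) x by (simp_all add: pos_def w_def)
  have ws: "star A w = w" using c x by (simp add: w_def star_diff)
  have comm: "w \<otimes> s = s \<otimes> w" "w \<otimes> r = r \<otimes> w" "r \<otimes> x = x \<otimes> r"
    using bicommutant_commute x(1) wb s(3) rb bicommutant_self[OF x(1)] by metis+
  define k where "k = w \<otimes> s"
  have k: "k \<in> carrier A" "star A k = k" using c ws comm by (simp_all add: k_def star_mult)
  have wx: "w \<otimes> x = \<ominus> (r \<otimes> w)"
  proof -
    have "w \<otimes> x = r \<otimes> x \<ominus> r \<otimes> r" using c x r by (simp add: w_def mult_diff_left)
    also have "\<dots> = \<ominus> (r \<otimes> w)" using c x by (simp add: w_def mult_diff_right minus_diff)
    finally show ?thesis .
  qed
  have rw: "r \<otimes> w = s \<otimes> k" 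
    unfolding k_def comm(1) by (subst s(2)[symmetric]) (simp add: mult_assoc c)
  have "(s \<otimes> s) \<otimes> (w \<otimes> w) = (s \<otimes> w) \<otimes> (s \<otimes> w)"
    using c comm by (intro mult_interchange) auto
  then have "r \<otimes> w \<otimes> w = k \<otimes> k" using c s comm by (simp add: k_def mult_assoc)
  then have "w \<otimes> x \<otimes> w = \<ominus> (k \<otimes> k)" using c x by (simp add: wx mult_minus_left)
  moreover have "pos x" if "k = \<zero>"
  proof -
    have "r \<otimes> w = \<zero>" using rw that c by simp
    then have "w \<otimes> w = \<zero>"
      using wx comm c x by (subst (2) w_def) (simp add: mult_diff_right)
    then have "vnorm A w = 0" using vnorm_selfadjoint_square[OF c(3) ws] by simp
    then have "r = x" using c x by (simp add: vnorm_eq_zero w_def diff_eq_zero_iff)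
    then show ?thesis using r(1) by simp
  qed
  ultimately show ?thesis using that c(3) ws k by blast
qed

text \<open>
  This replaces the comparison of the spectra of \<open>z* z\<close> and \<open>z z*\<close>. If \<open>z \<noteq> 0\<close>, scale to \<open>\<parallel>z\<parallel> = 1\<close>, and let
  \<open>z* z = - p\<close> and \<open>z z* = q\<close>. The element \<open>v = z (1 - p) = (1 + q) z\<close> would satisfy both
  \<open>\<parallel>v\<parallel>^2 = \<parallel>(1 - p) p (1 - p)\<parallel> \<le> 1/4\<close> and \<open>\<parallel>v\<parallel>^2 = \<parallel>(1 + q) q (1 + q)\<parallel> \<ge> \<parallel>q\<parallel> = 1\<close>.
\<close>

lemma star_mult_nonpositive:
  assumes z: "z \<in> carrier A" and p: "pos p" "star A z \<otimes> z = \<ominus> p" and q: "pos (z \<otimes> star A z)"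
  shows "z = \<zero>"
proof (rule ccontr)
  assume "z \<noteq> \<zero>"
  define c where "c = vnorm A z"
  have c: "c > 0" using \<open>z \<noteq> \<zero>\<close> vnorm_nonneg[OF z] vnorm_eq_zero[OF z] by (simp add: c_def)
  define z1 where "z1 = complex_of_real (1 / c) \<odot> z"
  define p1 where "p1 = complex_of_real (1 / c\<^sup>2) \<odot> p"
  define q1 where "q1 = z1 \<otimes> star A z1"
  have pc: "p \<in> carrier A" using p(1) by (simp add: pos_def)
  have z1: "z1 \<in> carrier A" using z by (simp add: z1_def)
  have "vnorm A z1 = \<bar>1 / c\<bar> * vnorm A z"
    unfolding z1_def using z by (simp add: vnorm_scale del: of_real_divide)
  then have z1n: "vnorm A z1 = 1" using c by (simp add: c_def)
  have p1: "pos p1" "star A z1 \<otimes> z1 = \<ominus> p1"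
    using p z pc pos_scale[OF p(1), of "1 / c\<^sup>2"]
    by (simp_all add: z1_def p1_def star_smult mult_smult_left mult_smult_right scale_scale
        scale_minus_right power2_eq_square)
  have q1: "pos q1"
    using z pos_scale[OF q, of "1 / c\<^sup>2"]
    by (simp_all add: z1_def q1_def star_smult mult_smult_left mult_smult_right scale_scale
        power2_eq_square)
  have cc: "p1 \<in> carrier A" "q1 \<in> carrier A" "star A p1 = p1" "star A q1 = q1"
    using p1 q1 by (auto simp: pos_def)
  have pn: "vnorm A p1 = 1" using norm_star_mult[OF z1] cc p1(2) z1n by simp
  have qn: "vnorm A q1 = 1" using vnorm_mult_star[OF z1] z1n by (simp add: q1_def)
  define v where "v = z1 \<otimes> (\<one> \<ominus> p1)"
  have v: "v \<in> carrier A" using z1 cc by (simp add: v_def)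
  have v2: "v = (\<one> \<oplus> q1) \<otimes> z1"
  proof -
    have "z1 \<otimes> (\<ominus> p1) = q1 \<otimes> z1"
      using z1 by (simp add: p1(2)[symmetric] q1_def mult_assoc)
    then show ?thesis
      using z1 cc by (simp add: v_def M.minus_eq mult_add_left mult_add_right)
  qed
  have "star A v \<otimes> v = (\<one> \<ominus> p1) \<otimes> (star A z1 \<otimes> z1) \<otimes> (\<one> \<ominus> p1)"
    using z1 cc by (simp add: v_def star_mult star_diff mult_assoc)
  also have "\<dots> = \<ominus> ((\<one> \<ominus> p1) \<otimes> (p1 \<otimes> (\<one> \<ominus> p1)))"
    using cc by (simp add: p1(2) mult_minus_left mult_minus_right mult_assoc)
  finally have "(vnorm A v)\<^sup>2 = vnorm A ((\<one> \<ominus> p1) \<otimes> (p1 \<otimes> (\<one> \<ominus> p1)))"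
    using norm_star_mult[OF v] cc by simp
  also have "\<dots> \<le> vnorm A (\<one> \<ominus> p1) * vnorm A (p1 \<otimes> (\<one> \<ominus> p1))"
    using cc by (intro norm_mult) auto
  also have "\<dots> \<le> 1 * (1 / 4)"
  proof (intro mult_mono)
    have pb: "\<one> \<ominus> p1 \<in> bicommutant A p1" "p1 \<in> bicommutant A p1"
      using cc by (auto intro: bicommutant_diff bicommutant_one bicommutant_self)
    have pos1: "pos (\<one> \<ominus> p1)" using pos_norm_minus[of p1 1] cc pn by simp
    have "\<one> \<ominus> (\<one> \<ominus> p1) = p1" using cc(1) unit_closed by algebra
    then show "vnorm A (\<one> \<ominus> p1) \<le> 1" using pos_norm_le[OF pos1, of 1] p1 by simp
    have "complex_of_real (1/4) \<odot> \<one> \<ominus> p1 \<otimes> (\<one> \<ominus> p1)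
        = (complex_of_real (1/2) \<odot> \<one> \<ominus> p1) \<otimes> (complex_of_real (1/2) \<odot> \<one> \<ominus> p1)"
    proof -
      define s where "s = complex_of_real (1/2) \<odot> \<one>"
      have s: "s \<in> carrier A" "s \<otimes> s = complex_of_real (1/4) \<odot> \<one>" "s \<otimes> p1 \<oplus> p1 \<otimes> s = p1"
        using cc by (simp_all add: s_def scale_scale flip: scale_add_left)
      have "(s \<ominus> p1) \<otimes> (s \<ominus> p1) = s \<otimes> s \<ominus> (s \<otimes> p1 \<oplus> p1 \<otimes> s) \<oplus> p1 \<otimes> p1"
        using s(1) cc(1) by algebra
      also have "\<dots> = complex_of_real (1/4) \<odot> \<one> \<ominus> p1 \<otimes> (\<one> \<ominus> p1)"
        unfolding s(2,3) using cc
          by (simp add: mult_add_right mult_minus_right M.minus_eq M.minus_add M.a_assoc)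
      finally show ?thesis by (simp add: s_def)
    qed
    moreover have "pos \<dots>" using cc by (intro pos_square) (auto simp: star_diff star_smult)
    ultimately show "vnorm A (p1 \<otimes> (\<one> \<ominus> p1)) \<le> 1 / 4"
      using pos_norm_le[OF pos_mult[OF p1(1) pos1 pb(2,1) cc(1)], of "1/4"] by simp
  qed (use cc in \<open>auto simp: vnorm_nonneg\<close>)
  finally have v4: "(vnorm A v)\<^sup>2 \<le> 1 / 4" by simp
  have "v \<otimes> star A v = (\<one> \<oplus> q1) \<otimes> q1 \<otimes> (\<one> \<oplus> q1)"
    using z1 cc unfolding v2 by (simp add: star_mult star_add q1_def mult_assoc)
  also have "\<dots> \<ominus> q1 = q1 \<otimes> q1 \<oplus> (q1 \<otimes> q1 \<oplus> q1 \<otimes> (q1 \<otimes> q1))"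
    using cc(2) unit_closed by algebra (simp add: M.r_neg1)
  finally have "v \<otimes> star A v \<ominus> q1 = q1 \<otimes> q1 \<oplus> (q1 \<otimes> q1 \<oplus> q1 \<otimes> (q1 \<otimes> q1))" .
  moreover have "pos \<dots>"
    using cc q1 by (intro pos_add pos_mult[where x = q1] bicommutant_mult bicommutant_self) auto
  ultimately have "vnorm A q1 \<le> vnorm A (v \<otimes> star A v)"
    using v q1 by (intro pos_norm_mono) auto
  then show False using vnorm_mult_star[OF v] qn v4 by simp
qed

text \<open>
  Kaplansky's theorem. With \<open>w\<close> and \<open>k\<close> from \<open>selfadjoint_compression\<close> for \<open>x = y* y\<close>, the element
  \<open>z = y w\<close> has \<open>z* z = - k^2\<close>, and \<open>z z* + z* z\<close> is a sum of squares.
\<close>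

lemma pos_star_mult:
  assumes y: "y \<in> carrier A" shows "pos (star A y \<otimes> y)"
proof -
  have x: "star A y \<otimes> y \<in> carrier A" "star A (star A y \<otimes> y) = star A y \<otimes> y"
    using y by (simp_all add: star_mult)
  obtain w k where w: "w \<in> carrier A" "star A w = w" and k: "k \<in> carrier A" "star A k = k"
    and wk: "w \<otimes> (star A y \<otimes> y) \<otimes> w = \<ominus> (k \<otimes> k)" and imp: "k = \<zero> \<Longrightarrow> pos (star A y \<otimes> y)"
    using selfadjoint_compression[OF x] by metis
  define z where "z = y \<otimes> w"
  have z: "z \<in> carrier A" using y w by (simp add: z_def)
  have zz: "star A z \<otimes> z = \<ominus> (k \<otimes> k)"
    using y w wk by (simp add: z_def star_mult mult_assoc)
  define a where "a = z \<oplus> star A z"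
  define b where "b = \<i> \<odot> (z \<ominus> star A z)"
  have ab: "a \<in> carrier A" "star A a = a" "b \<in> carrier A" "star A b = b"
    using z by (simp_all add: a_def b_def star_add star_smult star_diff M.a_comm scale_minus_left
        minus_diff flip: scale_minus_right)
  \<comment> \<open>Real and imaginary parts of \<open>2 z\<close>: \<open>2 (z z* + z* z) = a^2 + b^2\<close>.\<close>
  define d where "d = z \<ominus> star A z"
  have d: "d \<in> carrier A" "b \<otimes> b = \<ominus> (d \<otimes> d)"
    using z by (simp_all add: d_def b_def mult_smult_left mult_smult_right scale_scale minus_scale)
  have "(a \<otimes> a \<oplus> b \<otimes> b) \<oplus> ((k \<otimes> k) \<oplus> (k \<otimes> k)) = z \<otimes> star A z \<oplus> z \<otimes> star A z"
  proof -
    have "(a \<otimes> a \<ominus> d \<otimes> d) \<oplus> ((\<ominus> (star A z \<otimes> z)) \<oplus> (\<ominus> (star A z \<otimes> z)))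
        = z \<otimes> star A z \<oplus> z \<otimes> star A z"
      unfolding a_def d_def using z star_closed[OF z] by algebra
    then show ?thesis using k by (simp add: zz d(2) M.minus_eq)
  qed
  moreover have "pos ((a \<otimes> a \<oplus> b \<otimes> b) \<oplus> ((k \<otimes> k) \<oplus> (k \<otimes> k)))"
    by (intro pos_add pos_square ab k)
  ultimately have "pos (complex_of_real (1/2) \<odot> (2 \<odot> (z \<otimes> star A z)))"
    using z by (intro pos_scale) (auto simp: double)
  then have "pos (z \<otimes> star A z)" using z by (simp add: scale_scale)
  then have "z = \<zero>" using star_mult_nonpositive[OF z pos_square[OF k] zz] by simp
  then have "k \<otimes> k = \<zero>" using zz k z by (metis M.minus_minus U.minus_zero mult_closed mult_zero_right star_closed)
  then have "k = \<zero>" using vnorm_selfadjoint_square[OF k] vnorm_eq_zero[OF k(1)] by simp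
  then show ?thesis by (rule imp)
qed

text \<open>
  The element \<open>e = 1 - (1 - x)^m\<close> with \<open>m = 2^n\<close> is an approximate unit for \<open>x\<close>, since
  \<open>m x (1 - x)^m \<le> 1 - (1 - x)^m\<close>. Repeated squaring, instead of all powers, keeps \<open>e\<close> in every closed
  real Jordan subspace containing \<open>x\<close>, and makes the estimate an induction: for \<open>y = (1 - x)^m\<close>,
  \<open>1 - y^2 - 2 m x y^2 = 2 y (1 - y - m x y) + (1 - y)^2\<close>.
\<close>

lemma approximate_unit:
  assumes x: "pos x" "vnorm A x \<le> 1" and "0 < \<epsilon>"
  obtains e where "pos e" "vnorm A e \<le> 1" "vnorm A (\<one> \<ominus> e) \<le> 1" "vnorm A (x \<otimes> (\<one> \<ominus> e)) < \<epsilon>"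
    "\<And>D. closed_jordan A D \<Longrightarrow> x \<in> D \<Longrightarrow> e \<in> D"
proof -
  have xc: "x \<in> carrier A" "star A x = x" using x by (auto simp: pos_def)
  define y where "y = rec_nat (\<one> \<ominus> x) (\<lambda>_ v. v \<otimes> v)"
  have y0: "y 0 = \<one> \<ominus> x" and yS: "y (Suc n) = y n \<otimes> y n" for n by (simp_all add: y_def)
  have yb: "y n \<in> bicommutant A x" for n
  proof (induction n)
    case 0
    show ?case unfolding y0 using xc by (intro bicommutant_diff bicommutant_one bicommutant_self)
  qed (auto simp: yS intro: bicommutant_mult)
  have yc: "y n \<in> carrier A" for n using yb bicommutant_closed by blast
  have ypos: "pos (y n)" for n
  proof (induction n)
    case 0
    show ?case using pos_norm_minus[of x 1] x xc by (simp add: y0)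
  next
    case (Suc n)
    then show ?case unfolding yS using yb xc by (intro pos_mult[where x = x])
  qed
  have ey: "pos (\<one> \<ominus> y n)" for n
  proof (induction n)
    case 0
    have "\<one> \<ominus> (\<one> \<ominus> x) = x" using xc(1) unit_closed by algebra
    then show ?case using x by (simp add: y0)
  next
    case (Suc n)
    have "\<one> \<ominus> y n \<otimes> y n = (\<one> \<ominus> y n) \<oplus> (\<one> \<ominus> y n) \<otimes> y n" using yc[of n] unit_closed by algebra
    then show ?case unfolding yS
      using Suc ypos yb xc by (auto intro!: pos_add pos_mult[where x = x] bicommutant_diff bicommutant_one)
  qed
  define s where "s n = complex_of_real (2 ^ n) \<odot> \<one>" for n
  have sc: "s n \<in> carrier A" for n by (simp add: s_def)
  have R: "pos (\<one> \<ominus> y n \<ominus> s n \<otimes> (x \<otimes> y n))" for n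
  proof (induction n)
    case 0
    have "\<one> \<ominus> (\<one> \<ominus> x) \<ominus> (x \<otimes> (\<one> \<ominus> x)) = x \<otimes> x"
      using xc(1) unit_closed by algebra (simp add: M.r_neg2)
    then show ?case using xc pos_square[of x] by (simp add: y0 s_def)
  next
    case (Suc n)
    let ?y = "y n"
    have com: "s (Suc n) \<otimes> (x \<otimes> (?y \<otimes> ?y)) = ?y \<otimes> (s n \<otimes> (x \<otimes> ?y)) \<oplus> ?y \<otimes> (s n \<otimes> (x \<otimes> ?y))"
    proof -
      have "?y \<otimes> (x \<otimes> ?y) = x \<otimes> (?y \<otimes> ?y)"
        using yc[of n] xc bicommutant_commute[OF yb[of n] bicommutant_self xc(1)]
        by (metis mult_assoc)
      then show ?thesis
        using xc yc[of n] by (simp add: s_def mult_smult_right double scale_scale)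
    qed
    have "\<one> \<ominus> ?y \<otimes> ?y \<ominus> (?y \<otimes> (s n \<otimes> (x \<otimes> ?y)) \<oplus> ?y \<otimes> (s n \<otimes> (x \<otimes> ?y)))
        = (?y \<otimes> (\<one> \<ominus> ?y \<ominus> s n \<otimes> (x \<otimes> ?y)) \<oplus> ?y \<otimes> (\<one> \<ominus> ?y \<ominus> s n \<otimes> (x \<otimes> ?y)))
          \<oplus> (\<one> \<ominus> ?y) \<otimes> (\<one> \<ominus> ?y)"
      using yc[of n] xc(1) sc[of n] unit_closed by algebra (simp add: M.r_neg1)
    moreover have "\<one> \<ominus> ?y \<ominus> s n \<otimes> (x \<otimes> ?y) \<in> bicommutant A x"
      using xc yb by (auto simp: s_def intro!: bicommutant_diff bicommutant_one bicommutant_mult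
          bicommutant_scale bicommutant_self)
    ultimately show ?case unfolding yS com
      using Suc ypos[of n] ey[of n] yb[of n] xc
      by (auto intro!: pos_add pos_mult[where x = x] bicommutant_diff bicommutant_one)
  qed
  have bound: "vnorm A (x \<otimes> y n) \<le> 1 / 2 ^ n" for n
  proof -
    have xy: "pos (x \<otimes> y n)" using x ypos yb xc by (intro pos_mult[where x = x] bicommutant_self)
    have "complex_of_real 1 \<odot> \<one> \<ominus> s n \<otimes> (x \<otimes> y n)
        = (\<one> \<ominus> y n \<ominus> s n \<otimes> (x \<otimes> y n)) \<oplus> y n"
      using yc[of n] xc(1) sc[of n] unit_closed by simp algebra
    then have "pos (complex_of_real 1 \<odot> \<one> \<ominus> s n \<otimes> (x \<otimes> y n))"
      using pos_add[OF R ypos] by simp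
    moreover have "s n \<otimes> (x \<otimes> y n) = complex_of_real (2 ^ n) \<odot> (x \<otimes> y n)"
      using xc yc by (simp add: s_def)
    ultimately have "vnorm A (complex_of_real (2 ^ n) \<odot> (x \<otimes> y n)) \<le> 1"
      using pos_norm_le[OF pos_scale[OF xy, of "2 ^ n"], of 1] by simp
    then show ?thesis using xc yc by (simp add: vnorm_scale norm_power field_simps)
  qed
  obtain n where n: "1 / 2 ^ n < \<epsilon>"
    using \<open>0 < \<epsilon>\<close> real_arch_pow_inv[of \<epsilon> "1/2"] by (auto simp: power_one_over)
  define e where "e = \<one> \<ominus> y n"
  have ee: "\<one> \<ominus> e = y n" unfolding e_def using yc[of n] unit_closed by algebra
  have "pos e" using ey by (simp add: e_def)
  moreover have "vnorm A e \<le> 1" using pos_norm_le[OF \<open>pos e\<close>, of 1] ypos[of n] ee by simp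
  moreover have "vnorm A (\<one> \<ominus> e) \<le> 1" using pos_norm_le[OF ypos[of n], of 1] ey[of n] ee by simp
  moreover have "vnorm A (x \<otimes> (\<one> \<ominus> e)) < \<epsilon>" using bound[of n] n ee by simp
  moreover have "e \<in> D" if D: "closed_jordan A D" "x \<in> D" for D
  proof -
    have add: "\<And>a b. a \<in> D \<Longrightarrow> b \<in> D \<Longrightarrow> a \<oplus> b \<in> D"
      and sc: "\<And>r a. a \<in> D \<Longrightarrow> complex_of_real r \<odot> a \<in> D"
      and sq: "\<And>a. a \<in> D \<Longrightarrow> a \<otimes> a \<in> D"
      using D(1) by (auto simp: closed_jordan_def)
    have "\<one> \<ominus> y m \<in> D" for m
    proof (induction m)
      case 0
      have "\<one> \<ominus> (\<one> \<ominus> x) = x" using xc(1) unit_closed by algebra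
      then show ?case using D by (simp add: y0)
    next
      case (Suc m)
      let ?f = "\<one> \<ominus> y m"
      have "\<one> \<ominus> y m \<otimes> y m = (?f \<oplus> ?f) \<oplus> (\<ominus> (?f \<otimes> ?f))"
        using yc[of m] unit_closed by algebra (simp add: M.r_neg1)
      also have "\<ominus> (?f \<otimes> ?f) = complex_of_real (- 1) \<odot> (?f \<otimes> ?f)"
        using yc[of m] by (simp add: minus_scale)
      finally show ?case unfolding yS using add sc sq Suc by metis
    qed
    then show ?thesis by (simp add: e_def)
  qed
  ultimately show ?thesis using that by blast
qed

end

section \<open>The algebra of adjointable operators\<close>

text \<open>
  A Banach space \<open>E\<close> with an inner product with values in a $C^*$-algebra \<open>A\<close>, conjugate-linear in the
  first argument. A module structure on \<open>E\<close> is not needed. The Cauchy-Schwarz inequality is an assumption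
  because for \<open>E = A\<close> it is trivial and precedes the order of \<open>A\<close>, whereas for columns over \<open>A\<close>
  it is deduced from that order.
\<close>

locale adjoint_space =
  E: complex_banach_space E + A: cstar_algebra A
  for E :: "('e, 'm) normed_space_scheme" and A :: "('v, 'n) star_algebra_scheme" +
  fixes inn :: "'e \<Rightarrow> 'e \<Rightarrow> 'v"
  assumes inn_closed [simp, intro]: "x \<in> carrier E \<Longrightarrow> y \<in> carrier E \<Longrightarrow> inn x y \<in> carrier A"
    and inn_add_right: "\<lbrakk>x \<in> carrier E; y \<in> carrier E; z \<in> carrier E\<rbrakk> \<Longrightarrow>
      inn x (y \<oplus>\<^bsub>E\<^esub> z) = inn x y \<oplus>\<^bsub>A\<^esub> inn x z"
    and inn_scale_right: "\<lbrakk>x \<in> carrier E; y \<in> carrier E\<rbrakk> \<Longrightarrow>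
      inn x (c \<odot>\<^bsub>E\<^esub> y) = c \<odot>\<^bsub>A\<^esub> inn x y"
    and inn_star: "\<lbrakk>x \<in> carrier E; y \<in> carrier E\<rbrakk> \<Longrightarrow> star A (inn x y) = inn y x"
    and inn_norm: "x \<in> carrier E \<Longrightarrow> vnorm A (inn x x) = (vnorm E x)\<^sup>2"
    and inn_cauchy_schwarz: "\<lbrakk>x \<in> carrier E; y \<in> carrier E\<rbrakk> \<Longrightarrow>
      vnorm A (inn x y) \<le> vnorm E x * vnorm E y"

text \<open>
  An adjointable operator is encoded as the pair of the operator and its adjoint, so that the involution
  exchanges the components. Both maps are extensional on the carrier, so that equality of pairs is
  equality of operators (\<open>adjointable_unique\<close>); they are linear because the inner product is
  nondegenerate.
\<close>

definition adjointable ::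
    "('e, 'm) normed_space_scheme \<Rightarrow> ('e \<Rightarrow> 'e \<Rightarrow> 'v) \<Rightarrow> (('e \<Rightarrow> 'e) \<times> ('e \<Rightarrow> 'e)) set" where
  "adjointable E inn = {(S, S'). S \<in> carrier E \<rightarrow>\<^sub>E carrier E \<and> S' \<in> carrier E \<rightarrow>\<^sub>E carrier E \<and>
     (\<forall>x\<in>carrier E. \<forall>y\<in>carrier E. inn (S x) y = inn x (S' y)) \<and>
     (\<exists>K. \<forall>x\<in>carrier E. vnorm E (S x) \<le> K * vnorm E x \<and> vnorm E (S' x) \<le> K * vnorm E x)}"

text \<open>The $C^*$-algebra of adjointable operators with the operator norm.\<close>

definition adjointable_algebra ::
    "('e, 'm) normed_space_scheme \<Rightarrow> ('e \<Rightarrow> 'e \<Rightarrow> 'v) \<Rightarrow> (('e \<Rightarrow> 'e) \<times> ('e \<Rightarrow> 'e)) star_algebra" where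
  "adjointable_algebra E inn =
     \<lparr>carrier = adjointable E inn,
      mult = (\<lambda>p q. (\<lambda>x\<in>carrier E. fst p (fst q x), \<lambda>x\<in>carrier E. snd q (snd p x))),
      one = (\<lambda>x\<in>carrier E. x, \<lambda>x\<in>carrier E. x),
      zero = (\<lambda>x\<in>carrier E. \<zero>\<^bsub>E\<^esub>, \<lambda>x\<in>carrier E. \<zero>\<^bsub>E\<^esub>),
      add = (\<lambda>p q. (\<lambda>x\<in>carrier E. fst p x \<oplus>\<^bsub>E\<^esub> fst q x, \<lambda>x\<in>carrier E. snd p x \<oplus>\<^bsub>E\<^esub> snd q x)),
      smult = (\<lambda>c p. (\<lambda>x\<in>carrier E. c \<odot>\<^bsub>E\<^esub> fst p x, \<lambda>x\<in>carrier E. cnj c \<odot>\<^bsub>E\<^esub> snd p x)),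
      vnorm = (\<lambda>p. operator_norm E (fst p)),
      star = (\<lambda>p. (snd p, fst p))\<rparr>"

context adjoint_space
begin

abbreviation "L \<equiv> adjointable_algebra E inn"

lemma inn_add_left:
  assumes "x \<in> carrier E" "y \<in> carrier E" "z \<in> carrier E"
  shows "inn (x \<oplus>\<^bsub>E\<^esub> y) z = inn x z \<oplus>\<^bsub>A\<^esub> inn y z"
  using assms inn_star[of z "x \<oplus>\<^bsub>E\<^esub> y", symmetric]
  by (simp add: inn_add_right A.star_add inn_star)

lemma inn_scale_left:
  assumes "x \<in> carrier E" "y \<in> carrier E" shows "inn (c \<odot>\<^bsub>E\<^esub> x) y = cnj c \<odot>\<^bsub>A\<^esub> inn x y"
  using assms inn_star[of y "c \<odot>\<^bsub>E\<^esub> x", symmetric]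
  by (simp add: inn_scale_right A.star_smult inn_star)

lemma inn_minus_right:
  "x \<in> carrier E \<Longrightarrow> y \<in> carrier E \<Longrightarrow> inn x (\<ominus>\<^bsub>E\<^esub> y) = \<ominus>\<^bsub>A\<^esub> inn x y"
  by (simp add: E.minus_scale A.minus_scale inn_scale_right)

lemma inn_diff_right:
  "\<lbrakk>x \<in> carrier E; y \<in> carrier E; z \<in> carrier E\<rbrakk> \<Longrightarrow>
    inn x (y \<ominus>\<^bsub>E\<^esub> z) = inn x y \<ominus>\<^bsub>A\<^esub> inn x z"
  by (simp add: a_minus_def inn_add_right inn_minus_right)

lemma inn_zero_right [simp]: "x \<in> carrier E \<Longrightarrow> inn x \<zero>\<^bsub>E\<^esub> = \<zero>\<^bsub>A\<^esub>"
  using inn_scale_right[of x "\<zero>\<^bsub>E\<^esub>" 0] by simp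

lemma inn_zero_left [simp]: "x \<in> carrier E \<Longrightarrow> inn \<zero>\<^bsub>E\<^esub> x = \<zero>\<^bsub>A\<^esub>"
  using inn_scale_left[of "\<zero>\<^bsub>E\<^esub>" x 0] by simp

lemma inn_self_eq_zero: "x \<in> carrier E \<Longrightarrow> inn x x = \<zero>\<^bsub>A\<^esub> \<Longrightarrow> x = \<zero>\<^bsub>E\<^esub>"
  using inn_norm[of x] E.vnorm_eq_zero[of x] by simp

lemma inn_ext:
  assumes "x \<in> carrier E" "y \<in> carrier E" "\<And>z. z \<in> carrier E \<Longrightarrow> inn z x = inn z y" shows "x = y"
proof -
  have "inn (x \<ominus>\<^bsub>E\<^esub> y) (x \<ominus>\<^bsub>E\<^esub> y) = \<zero>\<^bsub>A\<^esub>"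
    using assms(1,2) assms(3)[of "x \<ominus>\<^bsub>E\<^esub> y"] by (simp add: inn_diff_right)
  then show ?thesis using assms(1,2) inn_self_eq_zero[of "x \<ominus>\<^bsub>E\<^esub> y"] E.diff_eq_zero_iff by simp
qed

lemma tends_to_inn:
  assumes "tends_to E X x" "y \<in> carrier E" shows "tends_to A (\<lambda>n. inn y (X n)) (inn y x)"
proof (rule A.tends_to_squeeze)
  have c: "X n \<in> carrier E" "x \<in> carrier E" for n
    using assms(1) by (auto simp: tends_to_def image_subset_iff)
  show "range (\<lambda>n. inn y (X n)) \<subseteq> carrier A" "inn y x \<in> carrier A" using c assms(2) by auto
  show "vnorm A (inn y (X n) \<ominus>\<^bsub>A\<^esub> inn y x) \<le> vnorm E y * vnorm E (X n \<ominus>\<^bsub>E\<^esub> x)" for n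
    using inn_cauchy_schwarz[of y "X n \<ominus>\<^bsub>E\<^esub> x"] c assms(2) by (simp add: inn_diff_right)
  show "(\<lambda>n. vnorm E y * vnorm E (X n \<ominus>\<^bsub>E\<^esub> x)) \<longlonglongrightarrow> 0"
    using assms(1) unfolding tends_to_def by (intro tendsto_mult_right_zero) auto
qed

lemma adjointable_mem:
  assumes "(S, S') \<in> adjointable E inn"
  shows "x \<in> carrier E \<Longrightarrow> S x \<in> carrier E" "x \<in> carrier E \<Longrightarrow> S' x \<in> carrier E"
    "\<lbrakk>x \<in> carrier E; y \<in> carrier E\<rbrakk> \<Longrightarrow> inn (S x) y = inn x (S' y)"
  using assms by (auto simp: adjointable_def)

lemma adjointable_swap:
  assumes "(S, S') \<in> adjointable E inn" shows "(S', S) \<in> adjointable E inn"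
proof -
  have "inn (S' x) y = inn x (S y)" if xy: "x \<in> carrier E" "y \<in> carrier E" for x y
  proof -
    have "inn (S' x) y = star A (inn y (S' x))"
      using adjointable_mem[OF assms] xy by (simp add: inn_star)
    also have "\<dots> = star A (inn (S y) x)" using adjointable_mem[OF assms] xy by simp
    also have "\<dots> = inn x (S y)" using adjointable_mem(1)[OF assms] xy by (simp add: inn_star)
    finally show ?thesis .
  qed
  then show ?thesis using assms unfolding adjointable_def by auto
qed

lemma adjointableI:
  assumes "\<And>x. x \<in> carrier E \<Longrightarrow> S x \<in> carrier E" "\<And>x. x \<in> carrier E \<Longrightarrow> S' x \<in> carrier E"
    and "\<And>x y. x \<in> carrier E \<Longrightarrow> y \<in> carrier E \<Longrightarrow> inn (S x) y = inn x (S' y)"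
    and "\<And>x. x \<in> carrier E \<Longrightarrow> vnorm E (S x) \<le> K * vnorm E x"
    and "\<And>x. x \<in> carrier E \<Longrightarrow> vnorm E (S' x) \<le> K * vnorm E x"
  shows "(restrict S (carrier E), restrict S' (carrier E)) \<in> adjointable E inn"
  using assms(1-3) unfolding adjointable_def
  by (auto intro!: exI[of _ K] assms(4,5))

lemma adjointable_unique:
  assumes "(S, S') \<in> adjointable E inn" "(T, T') \<in> adjointable E inn"
    and eq: "\<And>x. x \<in> carrier E \<Longrightarrow> S x = T x"
  shows "(S, S') = (T, T')"
proof -
  have "S' y = T' y" if "y \<in> carrier E" for y
  proof (rule inn_ext)
    fix z assume z: "z \<in> carrier E"
    show "inn z (S' y) = inn z (T' y)"
      using adjointable_mem(3)[OF assms(1) z that] adjointable_mem(3)[OF assms(2) z that] eq[OF z]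
      by simp
  qed (use adjointable_mem(2)[OF assms(1)] adjointable_mem(2)[OF assms(2)] that in auto)
  then show ?thesis
    using assms unfolding adjointable_def
    by (auto intro!: extensionalityI[of _ "carrier E"] simp: PiE_def)
qed

lemma adjointable_add:
  assumes "(S, S') \<in> adjointable E inn" "x \<in> carrier E" "y \<in> carrier E"
  shows "S (x \<oplus>\<^bsub>E\<^esub> y) = S x \<oplus>\<^bsub>E\<^esub> S y"
  using adjointable_mem[OF assms(1)] adjointable_mem[OF adjointable_swap[OF assms(1)]] assms(2,3)
  by (intro inn_ext) (auto simp: inn_add_right simp flip: adjointable_mem(3)[OF adjointable_swap[OF assms(1)]])

lemma adjointable_scale:
  assumes "(S, S') \<in> adjointable E inn" "x \<in> carrier E"
  shows "S (c \<odot>\<^bsub>E\<^esub> x) = c \<odot>\<^bsub>E\<^esub> S x"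
  using adjointable_mem[OF assms(1)] adjointable_mem[OF adjointable_swap[OF assms(1)]] assms(2)
  by (intro inn_ext) (auto simp: inn_scale_right simp flip: adjointable_mem(3)[OF adjointable_swap[OF assms(1)]])

lemma adjointable_bound:
  assumes "(S, S') \<in> adjointable E inn"
  obtains K where "0 \<le> K" "\<And>x. x \<in> carrier E \<Longrightarrow> vnorm E (S x) \<le> K * vnorm E x"
    "\<And>x. x \<in> carrier E \<Longrightarrow> vnorm E (S' x) \<le> K * vnorm E x"
proof -
  obtain K where K: "\<forall>x\<in>carrier E. vnorm E (S x) \<le> K * vnorm E x \<and> vnorm E (S' x) \<le> K * vnorm E x"
    using assms by (auto simp: adjointable_def)
  have "K * vnorm E x \<le> \<bar>K\<bar> * vnorm E x" if "x \<in> carrier E" for x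
    using E.vnorm_nonneg[OF that] by (intro mult_right_mono) auto
  then show ?thesis using K by (intro that[of "\<bar>K\<bar>"]) (auto intro: order_trans)
qed

lemma operator_norm_bdd:
  assumes "(S, S') \<in> adjointable E inn"
  shows "bdd_above ((\<lambda>x. vnorm E (S x)) ` unit_ball E)"
proof -
  obtain K where K: "0 \<le> K" "\<And>x. x \<in> carrier E \<Longrightarrow> vnorm E (S x) \<le> K * vnorm E x"
    using adjointable_bound[OF assms] by metis
  have "vnorm E (S x) \<le> K" if "x \<in> unit_ball E" for x
    using K(2)[of x] mult_left_mono[of "vnorm E x" 1 K] K(1) that by simp
  then show ?thesis by (intro bdd_aboveI2[of _ _ K])
qed

lemma operator_norm_bound:
  assumes "(S, S') \<in> adjointable E inn" "x \<in> carrier E"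
  shows "vnorm E (S x) \<le> operator_norm E S * vnorm E x"
proof (cases "x = \<zero>\<^bsub>E\<^esub>")
  case True
  have "S \<zero>\<^bsub>E\<^esub> = \<zero>\<^bsub>E\<^esub>"
    using adjointable_scale[OF assms(1) E.M.zero_closed, of 0] adjointable_mem[OF assms(1)] by simp
  then show ?thesis using True by simp
next
  case False
  define r where "r = vnorm E x"
  have r: "r > 0" using False assms(2) E.vnorm_nonneg[of x] E.vnorm_eq_zero[of x] by (simp add: r_def)
  define u where "u = complex_of_real (1 / r) \<odot>\<^bsub>E\<^esub> x"
  have u: "u \<in> unit_ball E"
    using assms(2) r by (simp add: u_def E.vnorm_scale del: of_real_divide) (simp add: r_def)
  have "vnorm E (S u) \<le> operator_norm E S"
    unfolding operator_norm_def by (rule cSUP_upper[OF u operator_norm_bdd[OF assms(1)]])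
  moreover have "vnorm E (S u) = (1 / r) * vnorm E (S x)"
    using adjointable_scale[OF assms] adjointable_mem[OF assms(1)] assms(2) r
    by (simp add: u_def E.vnorm_scale del: of_real_divide)
  ultimately show ?thesis using r by (simp add: field_simps r_def)
qed

lemma operator_norm_le:
  assumes "0 \<le> K" "\<And>x. x \<in> carrier E \<Longrightarrow> vnorm E (S x) \<le> K * vnorm E x"
  shows "operator_norm E S \<le> K"
  unfolding operator_norm_def
proof (rule cSUP_least)
  show "unit_ball E \<noteq> {}" using E.M.zero_closed by force
  show "vnorm E (S x) \<le> K" if "x \<in> unit_ball E" for x
    using assms(2)[of x] mult_left_mono[of "vnorm E x" 1 K] assms(1) that by simp
qed

lemma operator_norm_nonneg:
  assumes "(S, S') \<in> adjointable E inn" shows "0 \<le> operator_norm E S"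
proof -
  have "\<zero>\<^bsub>E\<^esub> \<in> unit_ball E" by simp
  then have "vnorm E (S \<zero>\<^bsub>E\<^esub>) \<le> operator_norm E S"
    unfolding operator_norm_def by (rule cSUP_upper[OF _ operator_norm_bdd[OF assms]])
  then show ?thesis
    using E.vnorm_nonneg[of "S \<zero>\<^bsub>E\<^esub>"] adjointable_mem(1)[OF assms, of "\<zero>\<^bsub>E\<^esub>"] by simp
qed

lemma L_closed [simp, intro]:
  assumes "p \<in> carrier L" "x \<in> carrier E" shows "fst p x \<in> carrier E" "snd p x \<in> carrier E"
  using assms adjointable_mem[of "fst p" "snd p"] by (auto simp: adjointable_algebra_def)

lemma L_adjoint:
  "\<lbrakk>p \<in> carrier L; x \<in> carrier E; y \<in> carrier E\<rbrakk> \<Longrightarrow> inn (fst p x) y = inn x (snd p y)"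
  using adjointable_mem[of "fst p" "snd p"] by (auto simp: adjointable_algebra_def)

lemma L_eqI:
  assumes "p \<in> carrier L" "q \<in> carrier L" "\<And>x. x \<in> carrier E \<Longrightarrow> fst p x = fst q x"
  shows "p = q"
  using adjointable_unique[of "fst p" "snd p" "fst q" "snd q"] assms
  by (simp add: adjointable_algebra_def)

lemma fst_L_add:
  "\<lbrakk>p \<in> carrier L; x \<in> carrier E; y \<in> carrier E\<rbrakk> \<Longrightarrow> fst p (x \<oplus>\<^bsub>E\<^esub> y) = fst p x \<oplus>\<^bsub>E\<^esub> fst p y"
  using adjointable_add[of "fst p" "snd p"] by (simp add: adjointable_algebra_def)

lemma fst_L_scale:
  "\<lbrakk>p \<in> carrier L; x \<in> carrier E\<rbrakk> \<Longrightarrow> fst p (c \<odot>\<^bsub>E\<^esub> x) = c \<odot>\<^bsub>E\<^esub> fst p x"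
  using adjointable_scale[of "fst p" "snd p"] by (simp add: adjointable_algebra_def)

lemma L_bound:
  "\<lbrakk>p \<in> carrier L; x \<in> carrier E\<rbrakk> \<Longrightarrow> vnorm E (fst p x) \<le> vnorm L p * vnorm E x"
  using operator_norm_bound[of "fst p" "snd p"] by (simp add: adjointable_algebra_def)

lemma L_norm_le:
  "\<lbrakk>0 \<le> K; \<And>x. x \<in> carrier E \<Longrightarrow> vnorm E (fst p x) \<le> K * vnorm E x\<rbrakk> \<Longrightarrow> vnorm L p \<le> K"
  using operator_norm_le[of K "fst p"] by (simp add: adjointable_algebra_def)

lemma L_norm_nonneg: "p \<in> carrier L \<Longrightarrow> 0 \<le> vnorm L p"
  using operator_norm_nonneg[of "fst p" "snd p"] by (simp add: adjointable_algebra_def)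

lemma fst_L [simp]:
  assumes "x \<in> carrier E"
  shows "fst (p \<oplus>\<^bsub>L\<^esub> q) x = fst p x \<oplus>\<^bsub>E\<^esub> fst q x"
    "fst (p \<otimes>\<^bsub>L\<^esub> q) x = fst p (fst q x)"
    "fst (c \<odot>\<^bsub>L\<^esub> p) x = c \<odot>\<^bsub>E\<^esub> fst p x"
    "fst \<zero>\<^bsub>L\<^esub> x = \<zero>\<^bsub>E\<^esub>" "fst \<one>\<^bsub>L\<^esub> x = x" "fst (star L p) x = snd p x"
    "snd (star L p) x = fst p x"
  using assms by (simp_all add: adjointable_algebra_def)

lemma L_star_closed: "p \<in> carrier L \<Longrightarrow> star L p \<in> carrier L"
  using adjointable_swap[of "fst p" "snd p"] by (simp add: adjointable_algebra_def)

lemma L_ops_closed: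
  assumes p: "p \<in> carrier L" and q: "q \<in> carrier L"
  shows "p \<oplus>\<^bsub>L\<^esub> q \<in> carrier L" "p \<otimes>\<^bsub>L\<^esub> q \<in> carrier L" "c \<odot>\<^bsub>L\<^esub> p \<in> carrier L"
proof -
  obtain K where K: "0 \<le> K" "\<And>x. x \<in> carrier E \<Longrightarrow> vnorm E (fst p x) \<le> K * vnorm E x"
    "\<And>x. x \<in> carrier E \<Longrightarrow> vnorm E (snd p x) \<le> K * vnorm E x"
    using adjointable_bound[of "fst p" "snd p"] p by (auto simp: adjointable_algebra_def)
  obtain M where M: "0 \<le> M" "\<And>x. x \<in> carrier E \<Longrightarrow> vnorm E (fst q x) \<le> M * vnorm E x"
    "\<And>x. x \<in> carrier E \<Longrightarrow> vnorm E (snd q x) \<le> M * vnorm E x"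
    using adjointable_bound[of "fst q" "snd q"] q by (auto simp: adjointable_algebra_def)
  note c = L_closed[OF p] L_closed[OF q]
  have "(\<lambda>x\<in>carrier E. fst p x \<oplus>\<^bsub>E\<^esub> fst q x, \<lambda>x\<in>carrier E. snd p x \<oplus>\<^bsub>E\<^esub> snd q x)
      \<in> adjointable E inn"
  proof (rule adjointableI[where K = "K + M"])
    fix x assume x: "x \<in> carrier E"
    show "vnorm E (fst p x \<oplus>\<^bsub>E\<^esub> fst q x) \<le> (K + M) * vnorm E x"
      using E.vnorm_triangle[OF c(1,3)[OF x]] K(2)[OF x] M(2)[OF x] by (simp add: distrib_right)
    show "vnorm E (snd p x \<oplus>\<^bsub>E\<^esub> snd q x) \<le> (K + M) * vnorm E x"
      using E.vnorm_triangle[OF c(2,4)[OF x]] K(3)[OF x] M(3)[OF x] by (simp add: distrib_right)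
  qed (use c in \<open>auto simp: inn_add_left inn_add_right L_adjoint[OF p] L_adjoint[OF q]\<close>)
  then show "p \<oplus>\<^bsub>L\<^esub> q \<in> carrier L" by (simp add: adjointable_algebra_def)
  have "(\<lambda>x\<in>carrier E. fst p (fst q x), \<lambda>x\<in>carrier E. snd q (snd p x)) \<in> adjointable E inn"
  proof (rule adjointableI[where K = "K * M"])
    fix x assume x: "x \<in> carrier E"
    show "vnorm E (fst p (fst q x)) \<le> K * M * vnorm E x"
      using K(2)[OF c(3)[OF x]] mult_left_mono[OF M(2)[OF x] K(1)] by (simp add: mult.assoc)
    show "vnorm E (snd q (snd p x)) \<le> K * M * vnorm E x"
      using M(3)[OF c(2)[OF x]] mult_left_mono[OF K(3)[OF x] M(1)] by (simp add: mult_ac)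
  qed (use c in \<open>auto simp: L_adjoint[OF p] L_adjoint[OF q]\<close>)
  then show "p \<otimes>\<^bsub>L\<^esub> q \<in> carrier L" by (simp add: adjointable_algebra_def)
  have "(\<lambda>x\<in>carrier E. c \<odot>\<^bsub>E\<^esub> fst p x, \<lambda>x\<in>carrier E. cnj c \<odot>\<^bsub>E\<^esub> snd p x) \<in> adjointable E inn"
  proof (rule adjointableI[where K = "cmod c * K"])
    fix x assume x: "x \<in> carrier E"
    show "vnorm E (c \<odot>\<^bsub>E\<^esub> fst p x) \<le> cmod c * K * vnorm E x"
      using mult_left_mono[OF K(2)[OF x], of "cmod c"] c x by (simp add: E.vnorm_scale mult.assoc)
    show "vnorm E (cnj c \<odot>\<^bsub>E\<^esub> snd p x) \<le> cmod c * K * vnorm E x"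
      using mult_left_mono[OF K(3)[OF x], of "cmod c"] c x by (simp add: E.vnorm_scale mult.assoc)
  qed (use c in \<open>auto simp: inn_scale_left inn_scale_right L_adjoint[OF p]\<close>)
  then show "c \<odot>\<^bsub>L\<^esub> p \<in> carrier L" by (simp add: adjointable_algebra_def)
qed

lemma L_zero_one_closed: "\<zero>\<^bsub>L\<^esub> \<in> carrier L" "\<one>\<^bsub>L\<^esub> \<in> carrier L"
proof -
  have "(\<lambda>x\<in>carrier E. \<zero>\<^bsub>E\<^esub>, \<lambda>x\<in>carrier E. \<zero>\<^bsub>E\<^esub>) \<in> adjointable E inn"
    by (rule adjointableI[where K = 0]) auto
  then show "\<zero>\<^bsub>L\<^esub> \<in> carrier L" by (simp add: adjointable_algebra_def)
  have "(\<lambda>x\<in>carrier E. x, \<lambda>x\<in>carrier E. x) \<in> adjointable E inn"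
    by (rule adjointableI[where K = 1]) auto
  then show "\<one>\<^bsub>L\<^esub> \<in> carrier L" by (simp add: adjointable_algebra_def)
qed

lemma L_star_norm_le:
  assumes p: "p \<in> carrier L"
  shows "(vnorm L p)\<^sup>2 \<le> vnorm L (star L p \<otimes>\<^bsub>L\<^esub> p)"
proof -
  let ?q = "star L p \<otimes>\<^bsub>L\<^esub> p"
  have q: "?q \<in> carrier L" using p L_star_closed L_ops_closed by blast
  have "vnorm E (fst p x) \<le> sqrt (vnorm L ?q) * vnorm E x" if x: "x \<in> carrier E" for x
  proof -
    have "(vnorm E (fst p x))\<^sup>2 = vnorm A (inn (fst p x) (fst p x))" using p x by (simp add: inn_norm)
    also have "inn (fst p x) (fst p x) = inn x (fst ?q x)" using p x by (simp add: L_adjoint)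
    also have "vnorm A \<dots> \<le> vnorm E x * vnorm E (fst ?q x)"
      using inn_cauchy_schwarz[of x "fst ?q x"] q x by blast
    also have "\<dots> \<le> vnorm E x * (vnorm L ?q * vnorm E x)"
      using L_bound[OF q x] E.vnorm_nonneg[OF x] by (intro mult_left_mono) auto
    also have "\<dots> = (sqrt (vnorm L ?q) * vnorm E x)\<^sup>2"
      using L_norm_nonneg[OF q] by (simp add: power2_eq_square mult_ac)
    finally show ?thesis
      by (rule power2_le_imp_le) (use L_norm_nonneg[OF q] E.vnorm_nonneg[OF x] in simp)
  qed
  then have "vnorm L p \<le> sqrt (vnorm L ?q)" using L_norm_nonneg[OF q] by (intro L_norm_le) auto
  then show ?thesis using L_norm_nonneg[OF p] L_norm_nonneg[OF q]
    by (metis power_mono real_sqrt_pow2)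
qed

lemma L_norm_mult:
  assumes "p \<in> carrier L" "q \<in> carrier L" shows "vnorm L (p \<otimes>\<^bsub>L\<^esub> q) \<le> vnorm L p * vnorm L q"
proof (rule L_norm_le)
  show "0 \<le> vnorm L p * vnorm L q" using assms by (simp add: L_norm_nonneg)
  fix x assume x: "x \<in> carrier E"
  have "vnorm E (fst p (fst q x)) \<le> vnorm L p * vnorm E (fst q x)" using assms x by (intro L_bound) auto
  also have "\<dots> \<le> vnorm L p * (vnorm L q * vnorm E x)"
    using assms x by (intro mult_left_mono L_bound L_norm_nonneg) auto
  finally show "vnorm E (fst (p \<otimes>\<^bsub>L\<^esub> q) x) \<le> vnorm L p * vnorm L q * vnorm E x"
    using x by (simp add: mult.assoc)
qed

lemma L_norm_star:
  assumes p: "p \<in> carrier L" shows "vnorm L (star L p) = vnorm L p"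
proof -
  have le: "vnorm L q \<le> vnorm L (star L q)" if q: "q \<in> carrier L" for q
  proof (cases "vnorm L q = 0")
    case False
    have "vnorm L q * vnorm L q \<le> vnorm L (star L q) * vnorm L q"
      using L_star_norm_le[OF q] L_norm_mult[OF L_star_closed[OF q] q]
      by (simp add: power2_eq_square)
    then show ?thesis using False L_norm_nonneg[OF q] by simp
  qed (use L_norm_nonneg[OF L_star_closed[OF q]] in simp)
  have "star L (star L p) = p" by (simp add: adjointable_algebra_def)
  then show ?thesis using le[OF p] le[OF L_star_closed[OF p]] by simp
qed

lemma L_normed: "complex_normed_space L"
proof -
  have ab: "abelian_group L"
  proof (rule abelian_groupI)
    fix p assume p: "p \<in> carrier L"
    show "\<zero>\<^bsub>L\<^esub> \<oplus>\<^bsub>L\<^esub> p = p" using p L_zero_one_closed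
      by (intro L_eqI) (auto simp: L_ops_closed)
    have "(- 1) \<odot>\<^bsub>L\<^esub> p \<oplus>\<^bsub>L\<^esub> p = \<zero>\<^bsub>L\<^esub>"
      using p L_zero_one_closed
      by (intro L_eqI) (auto simp: L_ops_closed E.M.l_neg simp flip: E.minus_scale)
    then show "\<exists>q\<in>carrier L. q \<oplus>\<^bsub>L\<^esub> p = \<zero>\<^bsub>L\<^esub>" using p L_ops_closed by blast
    fix q assume q: "q \<in> carrier L"
    show "p \<oplus>\<^bsub>L\<^esub> q = q \<oplus>\<^bsub>L\<^esub> p"
      using p q by (intro L_eqI) (auto simp: L_ops_closed E.M.a_comm)
    fix r assume r: "r \<in> carrier L"
    show "p \<oplus>\<^bsub>L\<^esub> q \<oplus>\<^bsub>L\<^esub> r = p \<oplus>\<^bsub>L\<^esub> (q \<oplus>\<^bsub>L\<^esub> r)"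
      using p q r by (intro L_eqI) (auto simp: L_ops_closed E.M.a_assoc)
  qed (auto simp: L_ops_closed L_zero_one_closed)
  have md: "Module.module complex_ring L"
  proof (rule Module.moduleI[OF E.is_cring ab])
    fix a b p assume p: "p \<in> carrier L"
    show "a \<odot>\<^bsub>L\<^esub> p \<in> carrier L" using p by (simp add: L_ops_closed)
    show "(a \<oplus>\<^bsub>complex_ring\<^esub> b) \<odot>\<^bsub>L\<^esub> p = a \<odot>\<^bsub>L\<^esub> p \<oplus>\<^bsub>L\<^esub> b \<odot>\<^bsub>L\<^esub> p"
      using p by (intro L_eqI) (auto simp: L_ops_closed complex_ring_def E.scale_add_left)
    show "(a \<otimes>\<^bsub>complex_ring\<^esub> b) \<odot>\<^bsub>L\<^esub> p = a \<odot>\<^bsub>L\<^esub> (b \<odot>\<^bsub>L\<^esub> p)"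
      using p by (intro L_eqI) (auto simp: L_ops_closed complex_ring_def E.scale_scale)
    show "\<one>\<^bsub>complex_ring\<^esub> \<odot>\<^bsub>L\<^esub> p = p"
      using p by (intro L_eqI) (auto simp: L_ops_closed complex_ring_def)
    fix q assume q: "q \<in> carrier L"
    show "a \<odot>\<^bsub>L\<^esub> (p \<oplus>\<^bsub>L\<^esub> q) = a \<odot>\<^bsub>L\<^esub> p \<oplus>\<^bsub>L\<^esub> a \<odot>\<^bsub>L\<^esub> q"
      using p q by (intro L_eqI) (auto simp: L_ops_closed E.scale_add_right)
  qed
  show ?thesis
  proof (intro complex_normed_space.intro complex_normed_space_axioms.intro md)
    fix p assume p: "p \<in> carrier L"
    show "0 \<le> vnorm L p" by (rule L_norm_nonneg[OF p])
    show "vnorm L p = 0 \<longleftrightarrow> p = \<zero>\<^bsub>L\<^esub>"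
    proof
      assume "vnorm L p = 0"
      then have "fst p x = \<zero>\<^bsub>E\<^esub>" if "x \<in> carrier E" for x
        using L_bound[OF p that] p that E.vnorm_nonneg[of "fst p x"] E.vnorm_eq_zero[of "fst p x"] by simp
      then show "p = \<zero>\<^bsub>L\<^esub>" using p by (intro L_eqI) (auto simp: L_zero_one_closed)
    next
      assume "p = \<zero>\<^bsub>L\<^esub>"
      then have "vnorm L p \<le> 0" by (intro L_norm_le) auto
      then show "vnorm L p = 0" using L_norm_nonneg[OF p] by simp
    qed
    have le: "vnorm L (c \<odot>\<^bsub>L\<^esub> q) \<le> cmod c * vnorm L q" if q: "q \<in> carrier L" for c q
    proof (rule L_norm_le)
      show "0 \<le> cmod c * vnorm L q" using q by (simp add: L_norm_nonneg)
      fix x assume "x \<in> carrier E"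
      then show "vnorm E (fst (c \<odot>\<^bsub>L\<^esub> q) x) \<le> cmod c * vnorm L q * vnorm E x"
        using mult_left_mono[OF L_bound[OF q], of x "cmod c"] q by (simp add: E.vnorm_scale mult.assoc)
    qed
    show "vnorm L (c \<odot>\<^bsub>L\<^esub> p) = cmod c * vnorm L p" for c
    proof (cases "c = 0")
      case True
      then show ?thesis using le[OF p, of c] L_norm_nonneg[of "c \<odot>\<^bsub>L\<^esub> p"] p by (simp add: L_ops_closed)
    next
      case False
      have "inverse c \<odot>\<^bsub>L\<^esub> (c \<odot>\<^bsub>L\<^esub> p) = p"
        using p False by (intro L_eqI) (auto simp: L_ops_closed E.scale_scale)
      then have "vnorm L p \<le> vnorm L (c \<odot>\<^bsub>L\<^esub> p) / cmod c"
        using le[of "c \<odot>\<^bsub>L\<^esub> p" "inverse c"] p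
        by (simp add: L_ops_closed norm_inverse divide_inverse mult.commute)
      then show ?thesis using le[OF p, of c] False by (simp add: field_simps)
    qed
    fix q assume q: "q \<in> carrier L"
    show "vnorm L (p \<oplus>\<^bsub>L\<^esub> q) \<le> vnorm L p + vnorm L q"
    proof (rule L_norm_le)
      fix x assume x: "x \<in> carrier E"
      then show "vnorm E (fst (p \<oplus>\<^bsub>L\<^esub> q) x) \<le> (vnorm L p + vnorm L q) * vnorm E x"
        using E.vnorm_triangle[of "fst p x" "fst q x"] L_bound[OF p x] L_bound[OF q x] p q
        by (simp add: distrib_right)
    qed (use p q in \<open>simp add: L_norm_nonneg\<close>)
  qed
qed

lemma fst_L_diff:
  assumes "p \<in> carrier L" "q \<in> carrier L" "x \<in> carrier E"
  shows "fst (p \<ominus>\<^bsub>L\<^esub> q) x = fst p x \<ominus>\<^bsub>E\<^esub> fst q x"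
proof -
  interpret N: complex_normed_space L by (rule L_normed)
  show ?thesis using assms by (simp add: a_minus_def N.minus_scale E.minus_scale)
qed

lemma L_complete:
  assumes X: "norm_cauchy L X" shows "\<exists>p. tends_to L X p"
proof -
  interpret N: complex_normed_space L by (rule L_normed)
  have Xc: "X n \<in> carrier L" for n using X by (auto simp: norm_cauchy_def)
  have cauchy: "norm_cauchy E (\<lambda>n. fst (Y n) x)" if Y: "norm_cauchy L Y" and x: "x \<in> carrier E" for Y x
    unfolding norm_cauchy_def
  proof (intro conjI allI impI)
    have Yc: "Y n \<in> carrier L" for n using Y by (auto simp: norm_cauchy_def)
    show "range (\<lambda>n. fst (Y n) x) \<subseteq> carrier E" using Yc x by auto
    fix e :: real assume e: "e > 0"
    have x1: "vnorm E x + 1 > 0" using E.vnorm_nonneg[OF x] by simp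
    then obtain N where N: "\<And>m n. m \<ge> N \<Longrightarrow> n \<ge> N \<Longrightarrow> vnorm L (Y m \<ominus>\<^bsub>L\<^esub> Y n) < e / (vnorm E x + 1)"
      using Y e unfolding norm_cauchy_def by (meson divide_pos_pos)
    have "vnorm E (fst (Y m) x \<ominus>\<^bsub>E\<^esub> fst (Y n) x) < e" if "m \<ge> N" "n \<ge> N" for m n
    proof -
      have "vnorm E (fst (Y m) x \<ominus>\<^bsub>E\<^esub> fst (Y n) x) \<le> vnorm L (Y m \<ominus>\<^bsub>L\<^esub> Y n) * vnorm E x"
        using L_bound[of "Y m \<ominus>\<^bsub>L\<^esub> Y n" x] Yc x by (simp add: fst_L_diff)
      also have "\<dots> \<le> vnorm L (Y m \<ominus>\<^bsub>L\<^esub> Y n) * (vnorm E x + 1)"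
        using Yc by (intro mult_left_mono L_norm_nonneg) auto
      also have "\<dots> < e" using N[OF that] x1 by (simp add: field_simps)
      finally show ?thesis .
    qed
    then show "\<exists>N. \<forall>m\<ge>N. \<forall>n\<ge>N. vnorm E (fst (Y m) x \<ominus>\<^bsub>E\<^esub> fst (Y n) x) < e" by blast
  qed
  have star_diff: "vnorm L (star L p \<ominus>\<^bsub>L\<^esub> star L q) = vnorm L (p \<ominus>\<^bsub>L\<^esub> q)"
    if pq: "p \<in> carrier L" "q \<in> carrier L" for p q
  proof -
    have "star L (p \<ominus>\<^bsub>L\<^esub> q) = star L p \<ominus>\<^bsub>L\<^esub> star L q"
    proof -
      have "star L (p \<oplus>\<^bsub>L\<^esub> (- 1) \<odot>\<^bsub>L\<^esub> q) = star L p \<oplus>\<^bsub>L\<^esub> (- 1) \<odot>\<^bsub>L\<^esub> star L q"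
        by (simp add: adjointable_algebra_def)
      then show ?thesis using pq by (simp add: a_minus_def N.minus_scale L_star_closed)
    qed
    then show ?thesis using L_norm_star[of "p \<ominus>\<^bsub>L\<^esub> q"] pq by simp
  qed
  have Xs: "norm_cauchy L (\<lambda>n. star L (X n))"
    using X Xc unfolding norm_cauchy_def by (auto simp: star_diff L_star_closed)
  have "\<forall>x\<in>carrier E. \<exists>l. tends_to E (\<lambda>n. fst (X n) x) l"
    using cauchy[OF X] E.norm_cauchy_tends_to by blast
  then obtain S where S: "\<And>x. x \<in> carrier E \<Longrightarrow> tends_to E (\<lambda>n. fst (X n) x) (S x)" by metis
  have "\<forall>x\<in>carrier E. \<exists>l. tends_to E (\<lambda>n. snd (X n) x) l"
    using cauchy[OF Xs] E.norm_cauchy_tends_to by fastforce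
  then obtain S' where S': "\<And>x. x \<in> carrier E \<Longrightarrow> tends_to E (\<lambda>n. snd (X n) x) (S' x)" by metis
  have Sc: "S x \<in> carrier E" "S' x \<in> carrier E" if "x \<in> carrier E" for x
    using S[OF that] S'[OF that] by (auto simp: tends_to_def)
  have adj: "inn (S x) y = inn x (S' y)" if "x \<in> carrier E" "y \<in> carrier E" for x y
  proof -
    have "tends_to A (\<lambda>n. star A (inn y (fst (X n) x))) (star A (inn y (S x)))"
      using A.tends_to_star tends_to_inn[OF S] that by blast
    moreover have "star A (inn y (fst (X n) x)) = inn x (snd (X n) y)" for n
      using that Xc by (simp add: inn_star L_adjoint)
    ultimately have "tends_to A (\<lambda>n. inn x (snd (X n) y)) (inn (S x) y)"
      using that Sc by (simp add: inn_star)
    then show ?thesis using tends_to_inn[OF S'] that A.tends_to_unique by blast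
  qed
  obtain N where N: "\<And>m. m \<ge> N \<Longrightarrow> vnorm L (X m \<ominus>\<^bsub>L\<^esub> X N) < 1"
    using X unfolding norm_cauchy_def by (meson order_refl zero_less_one)
  define K where "K = vnorm L (X N) + 1"
  have bd: "vnorm L (X m) \<le> K" if "m \<ge> N" for m
    using N[OF that] N.vnorm_le_diff[OF Xc[of m] Xc[of N]] by (simp add: K_def)
  have shift: "tends_to E (\<lambda>n. Y (n + N)) l" if "tends_to E Y l" for Y l
    using that unfolding tends_to_def
    by (auto simp: image_subset_iff intro: LIMSEQ_ignore_initial_segment)
  have SK: "vnorm E (S x) \<le> K * vnorm E x" if x: "x \<in> carrier E" for x
  proof (rule E.tends_to_le[OF shift[OF S[OF x]]])
    fix n
    have "vnorm E (fst (X (n + N)) x) \<le> vnorm L (X (n + N)) * vnorm E x"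
      using Xc x by (intro L_bound)
    also have "\<dots> \<le> K * vnorm E x" using bd[of "n + N"] E.vnorm_nonneg[OF x] by (intro mult_right_mono) auto
    finally show "vnorm E (fst (X (n + N)) x) \<le> K * vnorm E x" .
  qed
  have SK': "vnorm E (S' x) \<le> K * vnorm E x" if x: "x \<in> carrier E" for x
  proof (rule E.tends_to_le[OF shift[OF S'[OF x]]])
    fix n
    have "vnorm E (fst (star L (X (n + N))) x) \<le> vnorm L (star L (X (n + N))) * vnorm E x"
      using Xc x by (intro L_bound L_star_closed)
    also have "\<dots> \<le> K * vnorm E x"
      using bd[of "n + N"] E.vnorm_nonneg[OF x] L_norm_star[OF Xc] by (intro mult_right_mono) auto
    finally show "vnorm E (snd (X (n + N)) x) \<le> K * vnorm E x" using x by simp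
  qed
  define p where "p = (restrict S (carrier E), restrict S' (carrier E))"
  have p: "p \<in> carrier L"
    using adjointableI[OF Sc adj SK SK'] by (simp add: p_def adjointable_algebra_def)
  have "(\<lambda>n. vnorm L (X n \<ominus>\<^bsub>L\<^esub> p)) \<longlonglongrightarrow> 0"
  proof (rule LIMSEQ_I)
    fix e :: real assume e: "e > 0"
    obtain M where M: "\<And>m n. m \<ge> M \<Longrightarrow> n \<ge> M \<Longrightarrow> vnorm L (X m \<ominus>\<^bsub>L\<^esub> X n) < e / 2"
      using X e unfolding norm_cauchy_def by (meson half_gt_zero)
    have "vnorm L (X n \<ominus>\<^bsub>L\<^esub> p) \<le> e / 2" if n: "n \<ge> M" for n
    proof (rule L_norm_le)
      fix x assume x: "x \<in> carrier E"
      have sh: "tends_to E (\<lambda>m. fst (X (m + M)) x) (S x)"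
        using S[OF x] unfolding tends_to_def
        by (auto simp: image_subset_iff intro: LIMSEQ_ignore_initial_segment)
      have "vnorm E (fst (X n) x \<ominus>\<^bsub>E\<^esub> S x) \<le> e / 2 * vnorm E x"
      proof (rule E.tends_to_le[OF E.tends_to_diff[OF E.tends_to_const sh]])
        show "fst (X n) x \<in> carrier E" using Xc x by simp
        fix m
        have "vnorm E (fst (X n \<ominus>\<^bsub>L\<^esub> X (m + M)) x) \<le> vnorm L (X n \<ominus>\<^bsub>L\<^esub> X (m + M)) * vnorm E x"
          using Xc x by (intro L_bound) auto
        also have "\<dots> \<le> e / 2 * vnorm E x"
          using M[OF n, of "m + M"] E.vnorm_nonneg[OF x] by (intro mult_right_mono) auto
        finally show "vnorm E (fst (X n) x \<ominus>\<^bsub>E\<^esub> fst (X (m + M)) x) \<le> e / 2 * vnorm E x"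
          using Xc x by (simp add: fst_L_diff)
      qed
      then show "vnorm E (fst (X n \<ominus>\<^bsub>L\<^esub> p) x) \<le> e / 2 * vnorm E x"
        using Xc x p by (simp add: fst_L_diff) (simp add: p_def)
    qed (use e in simp)
    then show "\<exists>no. \<forall>n\<ge>no. norm (vnorm L (X n \<ominus>\<^bsub>L\<^esub> p) - 0) < e"
      using e Xc p by (intro exI[of _ M]) (force simp: L_norm_nonneg)
  qed
  then have "tends_to L X p" using Xc p by (auto simp: tends_to_def)
  then show ?thesis by blast
qed

lemma L_unital_cstar: "unital_cstar L"
proof -
  interpret N: complex_banach_space L by (rule complex_banach_spaceI[OF L_normed L_complete])
  show ?thesis
  proof unfold_locales
    fix p q assume p: "p \<in> carrier L" and q: "q \<in> carrier L"
    show "p \<otimes>\<^bsub>L\<^esub> q \<in> carrier L" using p q by (rule L_ops_closed)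
    show "vnorm L (p \<otimes>\<^bsub>L\<^esub> q) \<le> vnorm L p * vnorm L q" using p q by (rule L_norm_mult)
    show "star L (p \<oplus>\<^bsub>L\<^esub> q) = star L p \<oplus>\<^bsub>L\<^esub> star L q"
      "star L (p \<otimes>\<^bsub>L\<^esub> q) = star L q \<otimes>\<^bsub>L\<^esub> star L p"
      by (simp_all add: adjointable_algebra_def)
    fix c
    show "(c \<odot>\<^bsub>L\<^esub> p) \<otimes>\<^bsub>L\<^esub> q = c \<odot>\<^bsub>L\<^esub> (p \<otimes>\<^bsub>L\<^esub> q)"
      "p \<otimes>\<^bsub>L\<^esub> (c \<odot>\<^bsub>L\<^esub> q) = c \<odot>\<^bsub>L\<^esub> (p \<otimes>\<^bsub>L\<^esub> q)"
      using p q by (auto intro!: L_eqI simp: L_ops_closed fst_L_scale)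
    fix r assume r: "r \<in> carrier L"
    show "p \<otimes>\<^bsub>L\<^esub> q \<otimes>\<^bsub>L\<^esub> r = p \<otimes>\<^bsub>L\<^esub> (q \<otimes>\<^bsub>L\<^esub> r)"
      "(p \<oplus>\<^bsub>L\<^esub> q) \<otimes>\<^bsub>L\<^esub> r = p \<otimes>\<^bsub>L\<^esub> r \<oplus>\<^bsub>L\<^esub> q \<otimes>\<^bsub>L\<^esub> r"
      "p \<otimes>\<^bsub>L\<^esub> (q \<oplus>\<^bsub>L\<^esub> r) = p \<otimes>\<^bsub>L\<^esub> q \<oplus>\<^bsub>L\<^esub> p \<otimes>\<^bsub>L\<^esub> r"
      using p q r by (auto intro!: L_eqI simp: L_ops_closed fst_L_add)
  next
    fix p assume p: "p \<in> carrier L"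
    show "star L p \<in> carrier L" using p by (rule L_star_closed)
    show "star L (c \<odot>\<^bsub>L\<^esub> p) = cnj c \<odot>\<^bsub>L\<^esub> star L p" for c
      by (simp add: adjointable_algebra_def)
    show "star L (star L p) = p" by (simp add: adjointable_algebra_def)
    show "vnorm L (star L p \<otimes>\<^bsub>L\<^esub> p) = (vnorm L p)\<^sup>2"
      using L_star_norm_le[OF p] L_norm_mult[OF L_star_closed[OF p] p] L_norm_star[OF p]
      by (simp add: power2_eq_square)
    show "\<one>\<^bsub>L\<^esub> \<otimes>\<^bsub>L\<^esub> p = p" "p \<otimes>\<^bsub>L\<^esub> \<one>\<^bsub>L\<^esub> = p"
      using p by (auto intro!: L_eqI simp: L_ops_closed L_zero_one_closed)
  qed (rule L_zero_one_closed)
qed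

sublocale L: unital_cstar L
  by (rule L_unital_cstar)

text \<open>By polarisation an operator is determined by its quadratic form.\<close>

lemma L_ext_inn:
  assumes p: "p \<in> carrier L" and z: "\<And>b. b \<in> carrier E \<Longrightarrow> inn b (fst p b) = \<zero>\<^bsub>A\<^esub>"
  shows "p = \<zero>\<^bsub>L\<^esub>"
proof (rule L_eqI[OF p])
  fix c assume c: "c \<in> carrier E"
  have "inn b (fst p c) = \<zero>\<^bsub>A\<^esub>" if b: "b \<in> carrier E" for b
  proof -
    let ?u = "inn b (fst p c)" and ?v = "inn c (fst p b)"
    have uv: "?u \<in> carrier A" "?v \<in> carrier A" using b c p by auto
    have "?u \<oplus>\<^bsub>A\<^esub> ?v = \<zero>\<^bsub>A\<^esub>"
      using z[of "b \<oplus>\<^bsub>E\<^esub> c"] z[OF b] z[OF c] b c p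
      by (simp add: fst_L_add inn_add_left inn_add_right A.M.a_comm)
    moreover have "\<i> \<odot>\<^bsub>A\<^esub> ?u \<ominus>\<^bsub>A\<^esub> \<i> \<odot>\<^bsub>A\<^esub> ?v = \<zero>\<^bsub>A\<^esub>"
      using z[of "b \<oplus>\<^bsub>E\<^esub> \<i> \<odot>\<^bsub>E\<^esub> c"] z[OF b] z[OF c] b c p
      by (simp add: fst_L_add fst_L_scale inn_add_left inn_add_right inn_scale_left inn_scale_right
          A.scale_scale a_minus_def A.scale_minus_left A.M.a_comm)
    then have "\<i> \<odot>\<^bsub>A\<^esub> ?u = \<i> \<odot>\<^bsub>A\<^esub> ?v" using uv by (simp add: A.diff_eq_zero_iff)
    then have "?u = ?v" using A.scale_eq_iff[of "\<i>"] uv by simp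
    ultimately have "2 \<odot>\<^bsub>A\<^esub> ?u = 2 \<odot>\<^bsub>A\<^esub> \<zero>\<^bsub>A\<^esub>" using uv by (simp add: A.double)
    then show ?thesis using A.scale_eq_iff[of 2 ?u "\<zero>\<^bsub>A\<^esub>"] uv by simp
  qed
  then show "fst p c = fst \<zero>\<^bsub>L\<^esub> c" using p c by (intro inn_ext) auto
qed auto

end

section \<open>Finite sums\<close>

lemma (in complex_normed_space) scale_finsum:
  "finite S \<Longrightarrow> f \<in> S \<rightarrow> carrier V \<Longrightarrow> c \<odot> (\<Oplus>i\<in>S. f i) = (\<Oplus>i\<in>S. c \<odot> f i)"
  by (induction S rule: finite_induct) (simp_all add: Pi_def scale_add_right)

lemma (in complex_normed_space) vnorm_finsum_le:
  "finite S \<Longrightarrow> f \<in> S \<rightarrow> carrier V \<Longrightarrow> vnorm V (\<Oplus>i\<in>S. f i) \<le> (\<Sum>i\<in>S. vnorm V (f i))"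
proof (induction S rule: finite_induct)
  case (insert x S)
  then show ?case
    using vnorm_triangle[of "f x" "\<Oplus>i\<in>S. f i"] by (force simp: Pi_def)
qed simp

lemma (in abelian_monoid) finsum_swap:
  assumes "finite S" "finite T" "\<And>i j. i \<in> S \<Longrightarrow> j \<in> T \<Longrightarrow> f i j \<in> carrier G"
  shows "(\<Oplus>i\<in>S. \<Oplus>j\<in>T. f i j) = (\<Oplus>j\<in>T. \<Oplus>i\<in>S. f i j)"
  using assms(1,3)
proof (induction S rule: finite_induct)
  case (insert x S)
  then have "(\<Oplus>j\<in>T. \<Oplus>i\<in>insert x S. f i j) = (\<Oplus>j\<in>T. f x j \<oplus> (\<Oplus>i\<in>S. f i j))"
    by (intro finsum_cong') (auto intro!: finsum_closed)
  also have "\<dots> = (\<Oplus>j\<in>T. f x j) \<oplus> (\<Oplus>j\<in>T. \<Oplus>i\<in>S. f i j)"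
    using insert by (intro finsum_addf) (auto intro!: finsum_closed)
  finally show ?case using insert by (subst finsum_insert) (auto intro!: finsum_closed)
qed simp

context cstar_algebra
begin

lemma mult_finsum_right:
  "finite S \<Longrightarrow> f \<in> S \<rightarrow> carrier A \<Longrightarrow> a \<in> carrier A \<Longrightarrow> a \<otimes> (\<Oplus>i\<in>S. f i) = (\<Oplus>i\<in>S. a \<otimes> f i)"
  by (induction S rule: finite_induct) (simp_all add: Pi_def mult_add_right)

lemma mult_finsum_left:
  "finite S \<Longrightarrow> f \<in> S \<rightarrow> carrier A \<Longrightarrow> a \<in> carrier A \<Longrightarrow> (\<Oplus>i\<in>S. f i) \<otimes> a = (\<Oplus>i\<in>S. f i \<otimes> a)"
  by (induction S rule: finite_induct) (simp_all add: Pi_def mult_add_left)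

lemma star_finsum:
  "finite S \<Longrightarrow> f \<in> S \<rightarrow> carrier A \<Longrightarrow> star A (\<Oplus>i\<in>S. f i) = (\<Oplus>i\<in>S. star A (f i))"
  by (induction S rule: finite_induct) (simp_all add: Pi_def star_add)

section \<open>The order of a $C^*$-algebra\<close>

text \<open>The inner product of \<open>A\<close> as a Hilbert module over itself.\<close>

lemma adjoint_space_self: "adjoint_space A A (\<lambda>x y. star A x \<otimes> y)"
proof
  fix x y assume "x \<in> carrier A" "y \<in> carrier A"
  then show "vnorm A (star A x \<otimes> y) \<le> vnorm A x * vnorm A y"
    using norm_mult[of "star A x" y] by simp
qed (auto simp: mult_add_right mult_smult_right star_mult norm_star_mult)

interpretation self: adjoint_space A A "\<lambda>x y. star A x \<otimes> y"
  by (rule adjoint_space_self)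

text \<open>The left regular representation of \<open>A\<close>; it is isometric, with closed image.\<close>

definition left_mult :: "'v \<Rightarrow> ('v \<Rightarrow> 'v) \<times> ('v \<Rightarrow> 'v)" where
  "left_mult a = (\<lambda>x\<in>carrier A. a \<otimes> x, \<lambda>x\<in>carrier A. star A a \<otimes> x)"

lemma left_mult_closed [simp]: "a \<in> carrier A \<Longrightarrow> left_mult a \<in> carrier self.L"
  unfolding left_mult_def adjointable_algebra_def
  using norm_mult[of a] norm_mult[of "star A a"]
  by (auto intro!: self.adjointableI[where K = "vnorm A a"] simp: star_mult mult_assoc)

lemma fst_left_mult [simp]: "x \<in> carrier A \<Longrightarrow> fst (left_mult a) x = a \<otimes> x"
  by (simp add: left_mult_def)

lemma left_mult_hom:
  assumes "a \<in> carrier A" "b \<in> carrier A"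
  shows "left_mult a \<oplus>\<^bsub>self.L\<^esub> left_mult b = left_mult (a \<oplus> b)"
    "left_mult a \<otimes>\<^bsub>self.L\<^esub> left_mult b = left_mult (a \<otimes> b)"
    "c \<odot>\<^bsub>self.L\<^esub> left_mult a = left_mult (c \<odot> a)"
    "star self.L (left_mult a) = left_mult (star A a)"
    "left_mult a \<ominus>\<^bsub>self.L\<^esub> left_mult b = left_mult (a \<ominus> b)"
    "\<zero>\<^bsub>self.L\<^esub> = left_mult \<zero>"
  using assms
  by (auto intro!: self.L_eqI self.L.star_closed self.L.scale_closed self.L.mult_closed
      simp: self.fst_L_diff mult_add_left mult_assoc mult_smult_left mult_diff_left)
    (simp add: left_mult_def)

lemma vnorm_left_mult:
  assumes a: "a \<in> carrier A" shows "vnorm self.L (left_mult a) = vnorm A a"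
proof (rule antisym)
  show "vnorm self.L (left_mult a) \<le> vnorm A a"
    using a norm_mult[of a] by (intro self.L_norm_le) (auto simp: vnorm_nonneg)
  have "vnorm A a * vnorm A a \<le> vnorm self.L (left_mult a) * vnorm A a"
    using self.L_bound[of "left_mult a" "star A a"] a vnorm_mult_star[OF a]
    by (simp add: power2_eq_square)
  then show "vnorm A a \<le> vnorm self.L (left_mult a)"
    using vnorm_nonneg[OF a] self.L_norm_nonneg[OF left_mult_closed[OF a]]
    by (cases "vnorm A a = 0") auto
qed

lemma left_mult_inject:
  assumes "a \<in> carrier A" "b \<in> carrier A" "left_mult a = left_mult b" shows "a = b"
proof -
  have "left_mult (a \<ominus> b) = \<zero>\<^bsub>self.L\<^esub>"
    using assms left_mult_closed[OF assms(2)] by (simp add: left_mult_hom(5)[symmetric])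
  then have "vnorm A (a \<ominus> b) = 0" using vnorm_left_mult[of "a \<ominus> b"] assms by simp
  then show ?thesis using assms by (simp add: vnorm_eq_zero diff_eq_zero_iff)
qed

lemma closed_jordan_left_mult: "closed_jordan self.L (left_mult ` carrier A)"
  unfolding closed_jordan_def
proof (intro conjI allI ballI impI)
  fix X l assume X: "range X \<subseteq> left_mult ` carrier A" and l: "tends_to self.L X l"
  have "\<exists>a. a \<in> carrier A \<and> X n = left_mult a" for n using X by auto
  then obtain a where a: "\<And>n. a n \<in> carrier A" "\<And>n. X n = left_mult (a n)" by metis
  have "norm_cauchy A a"
    using self.L.tends_to_cauchy[OF l] a
    by (auto simp: norm_cauchy_def left_mult_hom vnorm_left_mult)
  then obtain b where b: "tends_to A a b" using norm_cauchy_tends_to by blast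
  then have "tends_to self.L X (left_mult b)"
    using a by (auto simp: tends_to_def left_mult_hom vnorm_left_mult)
  then have "l = left_mult b" using self.L.tends_to_unique[OF l] by blast
  moreover have "b \<in> carrier A" using b by (simp add: tends_to_def)
  ultimately show "l \<in> left_mult ` carrier A" by blast
qed (auto simp: left_mult_hom)

lemma positive_closed: "positive A x \<Longrightarrow> x \<in> carrier A"
  by (auto simp: positive_def)

lemma positive_iff_left_mult:
  assumes a: "a \<in> carrier A" shows "positive A a \<longleftrightarrow> self.L.pos (left_mult a)"
proof
  assume "positive A a"
  then obtain y where y: "y \<in> carrier A" "a = star A y \<otimes> y" by (auto simp: positive_def)
  then show "self.L.pos (left_mult a)"
    using self.L.pos_star_mult[of "left_mult y"] by (simp add: left_mult_hom)
next
  assume "self.L.pos (left_mult a)"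
  then obtain k where k: "self.L.pos k" "k \<otimes>\<^bsub>self.L\<^esub> k = left_mult a" "k \<in> left_mult ` carrier A"
    using self.L.sqrt_pos closed_jordan_left_mult a by (metis image_eqI)
  then obtain h where h: "h \<in> carrier A" "k = left_mult h" by blast
  have "left_mult (star A h) = left_mult h"
    using self.L.pos_star[OF k(1)] h by (simp add: left_mult_hom)
  then have "star A h = h" using left_mult_inject h by blast
  moreover have "h \<otimes> h = a"
    using k(2) h a left_mult_inject[of "h \<otimes> h" a] by (simp add: left_mult_hom)
  ultimately show "positive A a" unfolding positive_def using h by metis
qed

lemma positive_zero: "positive A \<zero>"
  unfolding positive_def using M.zero_closed by force

lemma positive_star_mult: "x \<in> carrier A \<Longrightarrow> positive A (star A x \<otimes> x)"
  unfolding positive_def by blast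

lemma positive_add: "positive A x \<Longrightarrow> positive A y \<Longrightarrow> positive A (x \<oplus> y)"
  using positive_closed[of x] positive_closed[of y] positive_iff_left_mult
    self.L.pos_add[of "left_mult x" "left_mult y"]
  by (simp add: left_mult_hom)

lemma positive_scale: "positive A x \<Longrightarrow> 0 \<le> r \<Longrightarrow> positive A (complex_of_real r \<odot> x)"
  using positive_closed[of x] positive_iff_left_mult self.L.pos_scale[of "left_mult x" r]
  by (simp add: left_mult_hom)

lemma positive_finsum:
  assumes "finite S" "\<And>i. i \<in> S \<Longrightarrow> positive A (f i)" shows "positive A (\<Oplus>i\<in>S. f i)"
  using assms
  by (induction S rule: finite_induct) (auto simp: positive_zero positive_add positive_closed Pi_def)

lemma positive_antisym:
  assumes "positive A x" "positive A (\<ominus> x)" shows "x = \<zero>"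
proof -
  have x: "x \<in> carrier A" by (rule positive_closed[OF assms(1)])
  have "\<ominus>\<^bsub>self.L\<^esub> left_mult x = left_mult (\<ominus> x)"
    using x by (simp add: minus_scale self.L.minus_scale left_mult_hom)
  then have "left_mult x = \<zero>\<^bsub>self.L\<^esub>"
    using assms x by (intro self.L.pos_antisym) (auto simp: positive_iff_left_mult)
  then show ?thesis using left_mult_inject[OF x M.zero_closed] left_mult_hom(6)[OF x x] by simp
qed

lemma positive_norm_mono:
  assumes "positive A p" "q \<in> carrier A" "positive A (q \<ominus> p)" shows "vnorm A p \<le> vnorm A q"
proof -
  have p: "p \<in> carrier A" by (rule positive_closed[OF assms(1)])
  have "vnorm self.L (left_mult p) \<le> vnorm self.L (left_mult q)"
    using assms p by (intro self.L.pos_norm_mono) (auto simp: positive_iff_left_mult left_mult_hom)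
  then show ?thesis using p assms by (simp add: vnorm_left_mult)
qed

text \<open>
  This is \<open>a* b a \<le> \<parallel>b\<parallel> a* a\<close>. If \<open>k\<close> is the square root of \<open>\<parallel>b\<parallel> - b\<close> in the algebra of operators,
  the difference is \<open>(k a)* (k a)\<close>, and \<open>k a\<close> lies in \<open>A\<close> even if \<open>A\<close> has no unit.
\<close>

lemma positive_conjugation_bound:
  assumes b: "positive A b" and a: "a \<in> carrier A"
  shows "positive A (complex_of_real (vnorm A b) \<odot> (star A a \<otimes> a) \<ominus> star A a \<otimes> (b \<otimes> a))"
proof -
  have bc: "b \<in> carrier A" by (rule positive_closed[OF b])
  have pb: "self.L.pos (left_mult b)" using b bc by (simp add: positive_iff_left_mult)
  define q where "q = complex_of_real (vnorm A b) \<odot>\<^bsub>self.L\<^esub> \<one>\<^bsub>self.L\<^esub> \<ominus>\<^bsub>self.L\<^esub> left_mult b"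
  have "self.L.pos q"
    unfolding q_def using bc self.L.pos_star[OF pb] by (intro self.L.pos_norm_minus) (auto simp: vnorm_left_mult)
  then obtain k where k: "self.L.pos k" "k \<otimes>\<^bsub>self.L\<^esub> k = q" using self.L.sqrt_pos by metis
  have kc: "k \<in> carrier self.L" and ks: "star self.L k = k"
    using k(1) by (auto simp: self.L.pos_def)
  have "snd k = fst k" using ks by (simp add: adjointable_algebra_def) (metis fst_conv)
  have "fst q a = complex_of_real (vnorm A b) \<odot> a \<ominus> b \<otimes> a"
    unfolding q_def using a bc by (simp add: self.fst_L_diff)
  then have "fst k (fst k a) = complex_of_real (vnorm A b) \<odot> a \<ominus> b \<otimes> a" using k(2) a by force
  then have "star A (fst k a) \<otimes> fst k a = star A a \<otimes> (complex_of_real (vnorm A b) \<odot> a \<ominus> b \<otimes> a)"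
    using self.L_adjoint[OF kc a, of "fst k a"] a kc \<open>snd k = fst k\<close> by simp
  also have "\<dots> = complex_of_real (vnorm A b) \<odot> (star A a \<otimes> a) \<ominus> star A a \<otimes> (b \<otimes> a)"
    using a bc by (simp add: mult_diff_right mult_smult_right)
  finally show ?thesis using positive_star_mult[of "fst k a"] kc a by simp
qed

text \<open>
  For \<open>p\<close> the normalised \<open>x x*\<close> and \<open>f = 1 - e\<close>, the square of the norm of \<open>f x\<close> is
  \<open>\<parallel>x\<parallel>^2 \<parallel>f p f\<parallel>\<close>, which is small if \<open>e\<close> is an approximate unit for \<open>p\<close>.
\<close>

lemma left_approximate_unit:
  assumes x: "x \<in> carrier A" and "0 < \<epsilon>"
  obtains e where "e \<in> carrier A" "star A e = e" "vnorm A e \<le> 1" "vnorm A (x \<ominus> e \<otimes> x) < \<epsilon>"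
proof (cases "x = \<zero>")
  case True
  then show ?thesis using that[of \<zero>] \<open>0 < \<epsilon>\<close> by simp
next
  case False
  define c where "c = (vnorm A x)\<^sup>2"
  have c: "c > 0" using False x vnorm_eq_zero[OF x] by (simp add: c_def)
  define p where "p = complex_of_real (1 / c) \<odot> (x \<otimes> star A x)"
  have p: "p \<in> carrier A" using x by (simp add: p_def)
  have "positive A (x \<otimes> star A x)" using positive_star_mult[of "star A x"] x by simp
  then have pp: "self.L.pos (left_mult p)"
    using p c positive_scale[of "x \<otimes> star A x" "1 / c"] by (simp add: positive_iff_left_mult[symmetric] p_def)
  have "vnorm A p = \<bar>1 / c\<bar> * vnorm A (x \<otimes> star A x)"
    unfolding p_def using x by (simp add: vnorm_scale del: of_real_divide)
  then have pn: "vnorm A p = 1" using c vnorm_mult_star[OF x] by (simp add: c_def)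
  have n1: "vnorm self.L (left_mult p) \<le> 1" using pn p by (simp add: vnorm_left_mult)
  have eps: "0 < \<epsilon>\<^sup>2 / c" using \<open>0 < \<epsilon>\<close> c by simp
  obtain E where E: "self.L.pos E" "vnorm self.L E \<le> 1"
      "vnorm self.L (\<one>\<^bsub>self.L\<^esub> \<ominus>\<^bsub>self.L\<^esub> E) \<le> 1"
      "vnorm self.L (left_mult p \<otimes>\<^bsub>self.L\<^esub> (\<one>\<^bsub>self.L\<^esub> \<ominus>\<^bsub>self.L\<^esub> E)) < \<epsilon>\<^sup>2 / c"
      and ED: "\<And>D. closed_jordan self.L D \<Longrightarrow> left_mult p \<in> D \<Longrightarrow> E \<in> D"
    using self.L.approximate_unit[OF pp n1 eps] by blast
  obtain e where e: "e \<in> carrier A" "E = left_mult e"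
    using ED[OF closed_jordan_left_mult imageI[OF p]] by blast
  have "left_mult (star A e) = left_mult e"
    using self.L.pos_star[OF E(1)] e by (simp add: left_mult_hom)
  then have es: "star A e = e" using left_mult_inject e by blast
  define f where "f = \<one>\<^bsub>self.L\<^esub> \<ominus>\<^bsub>self.L\<^esub> E"
  have Ec: "E \<in> carrier self.L" using e by simp
  have f: "f \<in> carrier self.L" "star self.L f = f"
    using Ec self.L.pos_star[OF E(1)] by (simp_all add: f_def self.L.star_diff)
  define z where "z = f \<otimes>\<^bsub>self.L\<^esub> left_mult x"
  have zc: "z \<in> carrier self.L" using f x by (simp add: z_def)
  have "left_mult (x \<otimes> star A x) = complex_of_real c \<odot>\<^bsub>self.L\<^esub> left_mult p"
    using x c p by (simp add: left_mult_hom p_def scale_scale)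
  then have xx: "left_mult x \<otimes>\<^bsub>self.L\<^esub> left_mult (star A x) = complex_of_real c \<odot>\<^bsub>self.L\<^esub> left_mult p"
    using x by (simp add: left_mult_hom(2))
  have "z \<otimes>\<^bsub>self.L\<^esub> star self.L z
      = f \<otimes>\<^bsub>self.L\<^esub> ((left_mult x \<otimes>\<^bsub>self.L\<^esub> left_mult (star A x)) \<otimes>\<^bsub>self.L\<^esub> f)"
    using f x unfolding z_def
    by (simp add: self.L.star_mult self.L.mult_assoc left_mult_hom(4)[OF x x])
  then have "z \<otimes>\<^bsub>self.L\<^esub> star self.L z = f \<otimes>\<^bsub>self.L\<^esub> ((complex_of_real c \<odot>\<^bsub>self.L\<^esub> left_mult p) \<otimes>\<^bsub>self.L\<^esub> f)"
    unfolding xx .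
  also have "\<dots> = complex_of_real c \<odot>\<^bsub>self.L\<^esub> (f \<otimes>\<^bsub>self.L\<^esub> (left_mult p \<otimes>\<^bsub>self.L\<^esub> f))"
    using f p by (simp add: self.L.mult_smult_left self.L.mult_smult_right)
  finally have "(vnorm self.L z)\<^sup>2 = c * vnorm self.L (f \<otimes>\<^bsub>self.L\<^esub> (left_mult p \<otimes>\<^bsub>self.L\<^esub> f))"
    using self.L.vnorm_mult_star[OF zc] f p c by (simp add: self.L.vnorm_scale)
  also have "\<dots> \<le> c * (vnorm self.L f * vnorm self.L (left_mult p \<otimes>\<^bsub>self.L\<^esub> f))"
    using f p c by (intro mult_left_mono self.L.norm_mult) auto
  also have "\<dots> \<le> c * (1 * vnorm self.L (left_mult p \<otimes>\<^bsub>self.L\<^esub> f))"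
    using f p c E(3) by (intro mult_left_mono mult_right_mono self.L.vnorm_nonneg) (auto simp: f_def)
  also have "\<dots> < \<epsilon>\<^sup>2" using E(4) c by (simp add: f_def field_simps)
  finally have "vnorm self.L z < \<epsilon>" using \<open>0 < \<epsilon>\<close> by (simp add: power2_less_imp_less)
  moreover have "z = left_mult (x \<ominus> e \<otimes> x)"
    unfolding z_def f_def using x e Ec
    by (intro self.L_eqI) (auto simp: self.fst_L_diff mult_diff_left mult_assoc)
  ultimately have "vnorm A (x \<ominus> e \<otimes> x) < \<epsilon>" using x e by (simp add: vnorm_left_mult)
  moreover have "vnorm A e \<le> 1" using E(2) e by (simp add: vnorm_left_mult)
  ultimately show ?thesis using that e es by blast
qed

end

section \<open>Positive operators on a Hilbert module\<close>

text \<open>The inner squares are now required to be positive; an action of \<open>A\<close> is still not needed.\<close>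

locale hilbert_module = adjoint_space +
  assumes inn_positive: "x \<in> carrier E \<Longrightarrow> positive A (inn x x)"
begin

text \<open>
  For \<open>w\<close> and \<open>k\<close> from \<open>selfadjoint_compression\<close>, the inner product of \<open>w b\<close> and \<open>p w b\<close> is positive
  by assumption and equals minus that of \<open>k b\<close> with itself, so \<open>k\<close> vanishes.
\<close>

lemma pos_if_inn_positive:
  assumes p: "p \<in> carrier L" and pos: "\<And>b. b \<in> carrier E \<Longrightarrow> positive A (inn b (fst p b))"
  shows "L.pos p"
proof -
  have ps: "star L p = p"
  proof -
    have "star L p \<ominus>\<^bsub>L\<^esub> p = \<zero>\<^bsub>L\<^esub>"
    proof (rule L_ext_inn)
      fix b assume b: "b \<in> carrier E"
      obtain y where y: "y \<in> carrier A" "inn b (fst p b) = star A y \<otimes>\<^bsub>A\<^esub> y"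
        using pos[OF b] by (auto simp: positive_def)
      have "inn (fst p b) b = star A (inn b (fst p b))" using p b by (simp add: inn_star)
      also have "\<dots> = inn b (fst p b)" using y by (simp add: A.star_mult)
      finally have "inn b (snd p b) = inn b (fst p b)" using p b by (simp add: L_adjoint)
      then show "inn b (fst (star L p \<ominus>\<^bsub>L\<^esub> p) b) = \<zero>\<^bsub>A\<^esub>"
        using p b by (simp add: fst_L_diff inn_diff_right)
    qed (use p in simp)
    then show ?thesis using p by (simp add: L.diff_eq_zero_iff)
  qed
  obtain w k where w: "w \<in> carrier L" "star L w = w" and k: "k \<in> carrier L" "star L k = k"
    and wk: "w \<otimes>\<^bsub>L\<^esub> p \<otimes>\<^bsub>L\<^esub> w = \<ominus>\<^bsub>L\<^esub> (k \<otimes>\<^bsub>L\<^esub> k)" and imp: "k = \<zero>\<^bsub>L\<^esub> \<Longrightarrow> L.pos p"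
    using L.selfadjoint_compression[OF p ps] by metis
  have sw: "snd w = fst w" "snd k = fst k"
    using w(2) k(2) by (auto simp: adjointable_algebra_def) (metis fst_conv)+
  have "fst k b = fst \<zero>\<^bsub>L\<^esub> b" if b: "b \<in> carrier E" for b
  proof -
    have "inn (fst w b) (fst p (fst w b)) = inn b (fst (w \<otimes>\<^bsub>L\<^esub> p \<otimes>\<^bsub>L\<^esub> w) b)"
      using w(1) p b sw by (simp add: L_adjoint)
    also have "\<dots> = inn b (fst ((- 1) \<odot>\<^bsub>L\<^esub> (k \<otimes>\<^bsub>L\<^esub> k)) b)"
      unfolding wk using k by (simp add: L.minus_scale)
    also have "\<dots> = \<ominus>\<^bsub>A\<^esub> inn (fst k b) (fst k b)"
      using k(1) b sw by (simp add: L_adjoint inn_scale_right A.minus_scale)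
    finally have "positive A (\<ominus>\<^bsub>A\<^esub> inn (fst k b) (fst k b))"
      using pos[of "fst w b"] w(1) b by simp
    then have "inn (fst k b) (fst k b) = \<zero>\<^bsub>A\<^esub>"
      using A.positive_antisym[OF inn_positive[of "fst k b"]] k(1) b by simp
    then show ?thesis using inn_self_eq_zero k(1) b by simp
  qed
  then have "k = \<zero>\<^bsub>L\<^esub>" using k(1) by (intro L_eqI) auto
  then show ?thesis by (rule imp)
qed

end

section \<open>The Hilbert module of columns\<close>

text \<open>The inner product \<open>\<Sum> x_i* y_i\<close> of columns of length \<open>n\<close> over \<open>A\<close>.\<close>

definition column_inner ::
    "('v, 'm) star_algebra_scheme \<Rightarrow> nat \<Rightarrow> (nat \<Rightarrow> 'v) \<Rightarrow> (nat \<Rightarrow> 'v) \<Rightarrow> 'v" where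
  "column_inner A n x y = (\<Oplus>\<^bsub>A\<^esub>i\<in>{..<n}. star A (x i) \<otimes>\<^bsub>A\<^esub> y i)"

text \<open>
  Columns are functions on the indices below \<open>n\<close>, extensional so that equality is entrywise. Only the
  additive structure, the scalars and the norm of the record carry a meaning.
\<close>

definition column_space ::
    "('v, 'm) star_algebra_scheme \<Rightarrow> nat \<Rightarrow> (nat \<Rightarrow> 'v) normed_space" where
  "column_space A n =
     \<lparr>carrier = {..<n} \<rightarrow>\<^sub>E carrier A, mult = undefined, one = undefined,
      zero = (\<lambda>i\<in>{..<n}. \<zero>\<^bsub>A\<^esub>), add = (\<lambda>x y. \<lambda>i\<in>{..<n}. x i \<oplus>\<^bsub>A\<^esub> y i),
      smult = (\<lambda>c x. \<lambda>i\<in>{..<n}. c \<odot>\<^bsub>A\<^esub> x i),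
      vnorm = (\<lambda>x. sqrt (vnorm A (column_inner A n x x)))\<rparr>"

text \<open>Multiplication of columns by a matrix, paired with multiplication by its conjugate transpose.\<close>

definition matrix_operator ::
    "('v, 'm) star_algebra_scheme \<Rightarrow> nat \<Rightarrow> (nat \<Rightarrow> nat \<Rightarrow> 'v) \<Rightarrow>
      ((nat \<Rightarrow> 'v) \<Rightarrow> (nat \<Rightarrow> 'v)) \<times> ((nat \<Rightarrow> 'v) \<Rightarrow> (nat \<Rightarrow> 'v))" where
  "matrix_operator A n X =
     (\<lambda>x\<in>carrier (column_space A n). \<lambda>i\<in>{..<n}. \<Oplus>\<^bsub>A\<^esub>j\<in>{..<n}. X i j \<otimes>\<^bsub>A\<^esub> x j,
      \<lambda>x\<in>carrier (column_space A n). \<lambda>i\<in>{..<n}. \<Oplus>\<^bsub>A\<^esub>j\<in>{..<n}. star A (X j i) \<otimes>\<^bsub>A\<^esub> x j)"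

context cstar_algebra
begin

abbreviation "C \<equiv> column_space A"
abbreviation "ci \<equiv> column_inner A"

lemma column_mem: "x \<in> carrier (C n) \<Longrightarrow> i < n \<Longrightarrow> x i \<in> carrier A"
  by (auto simp: column_space_def)

lemma column_eqI:
  "\<lbrakk>x \<in> carrier (C n); y \<in> carrier (C n); \<And>i. i < n \<Longrightarrow> x i = y i\<rbrakk> \<Longrightarrow> x = y"
  by (auto simp: column_space_def intro: PiE_ext)

lemma columnI: "(\<And>i. i < n \<Longrightarrow> f i \<in> carrier A) \<Longrightarrow> (\<lambda>i\<in>{..<n}. f i) \<in> carrier (C n)"
  by (auto simp: column_space_def)

lemma column_ops:
  assumes "i < n"
  shows "(x \<oplus>\<^bsub>C n\<^esub> y) i = x i \<oplus> y i" "(c \<odot>\<^bsub>C n\<^esub> x) i = c \<odot> x i" "\<zero>\<^bsub>C n\<^esub> i = \<zero>"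
  using assms by (auto simp: column_space_def)

lemma column_ops_closed:
  shows "x \<in> carrier (C n) \<Longrightarrow> y \<in> carrier (C n) \<Longrightarrow> x \<oplus>\<^bsub>C n\<^esub> y \<in> carrier (C n)"
    "x \<in> carrier (C n) \<Longrightarrow> c \<odot>\<^bsub>C n\<^esub> x \<in> carrier (C n)" "\<zero>\<^bsub>C n\<^esub> \<in> carrier (C n)"
  by (auto simp: column_space_def PiE_def Pi_def)

lemma column_inner_closed [simp]:
  "x \<in> carrier (C n) \<Longrightarrow> y \<in> carrier (C n) \<Longrightarrow> ci n x y \<in> carrier A"
  unfolding column_inner_def by (auto intro!: M.finsum_closed simp: column_mem)

lemma column_inner_add_right:
  assumes "x \<in> carrier (C n)" "y \<in> carrier (C n)" "z \<in> carrier (C n)"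
  shows "ci n x (y \<oplus>\<^bsub>C n\<^esub> z) = ci n x y \<oplus> ci n x z"
proof -
  have "ci n x (y \<oplus>\<^bsub>C n\<^esub> z) = (\<Oplus>i\<in>{..<n}. star A (x i) \<otimes> y i \<oplus> star A (x i) \<otimes> z i)"
    unfolding column_inner_def using assms
    by (intro M.finsum_cong') (auto simp: column_mem column_ops mult_add_right)
  also have "\<dots> = ci n x y \<oplus> ci n x z"
    unfolding column_inner_def using assms by (intro M.finsum_addf) (auto simp: column_mem)
  finally show ?thesis .
qed

lemma column_inner_scale_right:
  assumes "x \<in> carrier (C n)" "y \<in> carrier (C n)"
  shows "ci n x (c \<odot>\<^bsub>C n\<^esub> y) = c \<odot> ci n x y"
  using assms unfolding column_inner_def
  by (subst scale_finsum)
    (auto simp: column_mem column_ops mult_smult_right intro!: M.finsum_cong')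

lemma column_inner_star:
  assumes "x \<in> carrier (C n)" "y \<in> carrier (C n)"
  shows "star A (ci n x y) = ci n y x"
  using assms unfolding column_inner_def
  by (subst star_finsum) (auto simp: column_mem star_mult intro!: M.finsum_cong')

text \<open>The right action of \<open>A\<close> on columns.\<close>

definition column_mult :: "nat \<Rightarrow> (nat \<Rightarrow> 'v) \<Rightarrow> 'v \<Rightarrow> nat \<Rightarrow> 'v" where
  "column_mult n x a = (\<lambda>i\<in>{..<n}. x i \<otimes> a)"

lemma column_mult_closed:
  "x \<in> carrier (C n) \<Longrightarrow> a \<in> carrier A \<Longrightarrow> column_mult n x a \<in> carrier (C n)"
  unfolding column_mult_def by (intro columnI) (auto simp: column_mem)

lemma column_inner_mult_right:
  assumes "x \<in> carrier (C n)" "y \<in> carrier (C n)" "a \<in> carrier A"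
  shows "ci n x (column_mult n y a) = ci n x y \<otimes> a"
  using assms unfolding column_inner_def column_mult_def
  by (subst mult_finsum_left) (auto simp: column_mem mult_assoc intro!: M.finsum_cong')

lemma column_inner_positive: "x \<in> carrier (C n) \<Longrightarrow> positive A (ci n x x)"
  unfolding column_inner_def by (intro positive_finsum) (auto simp: positive_star_mult column_mem)

lemma column_inner_add_left:
  assumes "x \<in> carrier (C n)" "y \<in> carrier (C n)" "z \<in> carrier (C n)"
  shows "ci n (x \<oplus>\<^bsub>C n\<^esub> y) z = ci n x z \<oplus> ci n y z"
  using assms column_inner_star[of z n "x \<oplus>\<^bsub>C n\<^esub> y", symmetric]
  by (simp add: column_inner_add_right star_add column_inner_star column_ops_closed)

lemma column_inner_scale_left:
  assumes "x \<in> carrier (C n)" "y \<in> carrier (C n)"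
  shows "ci n (c \<odot>\<^bsub>C n\<^esub> x) y = cnj c \<odot> ci n x y"
  using assms column_inner_star[of y n "c \<odot>\<^bsub>C n\<^esub> x", symmetric]
  by (simp add: column_inner_scale_right star_smult column_inner_star column_ops_closed)

lemma column_inner_mult_left:
  assumes "x \<in> carrier (C n)" "y \<in> carrier (C n)" "a \<in> carrier A"
  shows "ci n (column_mult n x a) y = star A a \<otimes> ci n x y"
  using assms column_inner_star[of y n "column_mult n x a", symmetric]
  by (simp add: column_inner_mult_right star_mult column_inner_star column_mult_closed)

lemma column_entry_le:
  assumes x: "x \<in> carrier (C n)" and i: "i < n"
  shows "(vnorm A (x i))\<^sup>2 \<le> vnorm A (ci n x x)"
proof -
  define r where "r = (\<Oplus>j\<in>{..<n} - {i}. star A (x j) \<otimes> x j)"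
  have r: "positive A r"
    unfolding r_def by (intro positive_finsum) (auto simp: positive_star_mult column_mem[OF x])
  have xi: "x i \<in> carrier A" using column_mem[OF x i] .
  have "{..<n} = insert i ({..<n} - {i})" using i by auto
  then have "ci n x x = (\<Oplus>j\<in>insert i ({..<n} - {i}). star A (x j) \<otimes> x j)"
    by (simp add: column_inner_def)
  also have "\<dots> = star A (x i) \<otimes> x i \<oplus> r"
    unfolding r_def using xi by (intro M.finsum_insert) (auto simp: column_mem[OF x])
  finally have "ci n x x \<ominus> star A (x i) \<otimes> x i = r"
    using xi positive_closed[OF r] by (simp add: M.minus_eq M.a_ac M.r_neg M.r_neg2 M.r_neg1)
  then have "vnorm A (star A (x i) \<otimes> x i) \<le> vnorm A (ci n x x)"
    using r xi x by (intro positive_norm_mono) (auto simp: positive_star_mult)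
  then show ?thesis using norm_star_mult[OF xi] by simp
qed

lemma column_inner_le_sum:
  assumes x: "x \<in> carrier (C n)"
  shows "vnorm A (ci n x x) \<le> (\<Sum>i<n. (vnorm A (x i))\<^sup>2)"
proof -
  have "vnorm A (ci n x x) \<le> (\<Sum>i<n. vnorm A (star A (x i) \<otimes> x i))"
    unfolding column_inner_def by (intro vnorm_finsum_le) (auto simp: column_mem[OF x])
  also have "\<dots> = (\<Sum>i<n. (vnorm A (x i))\<^sup>2)" by (intro sum.cong) (auto simp: column_mem[OF x] norm_star_mult)
  finally show ?thesis .
qed

text \<open>
  The Cauchy-Schwarz inequality in the order of \<open>A\<close>: for \<open>a = \<langle>x, y\<rangle>\<close> and \<open>r = \<parallel>\<langle>x, x\<rangle>\<parallel>\<close>, expand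
  the inner square of \<open>x a - r y\<close> and use \<open>a* \<langle>x, x\<rangle> a \<le> r a* a\<close>.
\<close>

lemma column_cauchy_schwarz:
  assumes x: "x \<in> carrier (C n)" and y: "y \<in> carrier (C n)"
  shows "positive A (complex_of_real (vnorm A (ci n x x)) \<odot> ci n y y \<ominus> star A (ci n x y) \<otimes> ci n x y)"
proof (cases "vnorm A (ci n x x) = 0")
  case True
  have "x i = \<zero>" if "i < n" for i
    using column_entry_le[OF x that] True vnorm_eq_zero[OF column_mem[OF x that]] by simp
  then have "ci n x y = (\<Oplus>i\<in>{..<n}. \<zero>)"
    unfolding column_inner_def using y by (intro M.finsum_cong') (auto simp: column_mem)
  then have "ci n x y = \<zero>" by simp
  then show ?thesis using True x y by (simp add: positive_zero)
next
  case False
  define r where "r = vnorm A (ci n x x)"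
  define a where "a = ci n x y"
  have r: "r > 0" using False vnorm_nonneg[of "ci n x x"] x by (simp add: r_def)
  have a: "a \<in> carrier A" using x y by (simp add: a_def)
  define u where "u = column_mult n x a"
  define v where "v = complex_of_real (- r) \<odot>\<^bsub>C n\<^esub> y"
  have uv: "u \<in> carrier (C n)" "v \<in> carrier (C n)"
    using x y a by (auto simp: u_def v_def column_mult_closed column_ops_closed)
  let ?s = "star A a \<otimes> a" and ?X = "star A a \<otimes> (ci n x x \<otimes> a)" and ?Y = "ci n y y"
  have c: "?s \<in> carrier A" "?X \<in> carrier A" "?Y \<in> carrier A" using x y a by auto
  have "ci n (u \<oplus>\<^bsub>C n\<^esub> v) (u \<oplus>\<^bsub>C n\<^esub> v) = (ci n u u \<oplus> ci n v u) \<oplus> (ci n u v \<oplus> ci n v v)"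
    using uv by (simp add: column_inner_add_left column_inner_add_right column_ops_closed)
  also have "ci n u u = ?X"
    using x a by (simp add: u_def column_inner_mult_left column_inner_mult_right column_mult_closed
        mult_assoc)
  also have "ci n v u = complex_of_real (- r) \<odot> ?s"
    using x y a by (simp add: u_def v_def column_inner_scale_left column_inner_mult_right
        column_mult_closed column_ops_closed a_def column_inner_star mult_smult_left)
  also have "ci n u v = complex_of_real (- r) \<odot> ?s"
    using x y a by (simp add: u_def v_def column_inner_scale_right column_inner_mult_left
        column_mult_closed column_ops_closed a_def[symmetric])
  also have "ci n v v = complex_of_real (r * r) \<odot> ?Y"
    using y by (simp add: v_def column_inner_scale_right column_inner_scale_left
        column_ops_closed scale_scale)
  finally have "positive A ((?X \<oplus> complex_of_real (- r) \<odot> ?s)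
      \<oplus> (complex_of_real (- r) \<odot> ?s \<oplus> complex_of_real (r * r) \<odot> ?Y))"
    using column_inner_positive[OF column_ops_closed(1)[OF uv]] by simp
  moreover have "positive A (complex_of_real r \<odot> ?s \<ominus> ?X)"
    unfolding r_def by (rule positive_conjugation_bound[OF column_inner_positive[OF x] a])
  ultimately have "positive A (((?X \<oplus> complex_of_real (- r) \<odot> ?s)
      \<oplus> (complex_of_real (- r) \<odot> ?s \<oplus> complex_of_real (r * r) \<odot> ?Y)) \<oplus> (complex_of_real r \<odot> ?s \<ominus> ?X))"
    by (rule positive_add)
  also have "((?X \<oplus> complex_of_real (- r) \<odot> ?s)
      \<oplus> (complex_of_real (- r) \<odot> ?s \<oplus> complex_of_real (r * r) \<odot> ?Y)) \<oplus> (complex_of_real r \<odot> ?s \<ominus> ?X)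
      = complex_of_real (r * r) \<odot> ?Y \<ominus> complex_of_real r \<odot> ?s"
    using c by (simp add: scale_minus_left M.minus_eq M.minus_add M.a_ac M.r_neg M.r_neg1 M.r_neg2)
  finally have "positive A (complex_of_real (1 / r) \<odot> (complex_of_real (r * r) \<odot> ?Y \<ominus> complex_of_real r \<odot> ?s))"
    using r by (intro positive_scale) auto
  also have "complex_of_real (1 / r) \<odot> (complex_of_real (r * r) \<odot> ?Y \<ominus> complex_of_real r \<odot> ?s)
      = complex_of_real r \<odot> ?Y \<ominus> ?s"
    using c r by (simp add: scale_diff_right scale_scale)
  finally show ?thesis by (simp add: r_def a_def)
qed

lemma column_cauchy_schwarz_norm:
  assumes x: "x \<in> carrier (C n)" and y: "y \<in> carrier (C n)"
  shows "vnorm A (ci n x y) \<le> vnorm (C n) x * vnorm (C n) y"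
proof -
  have "vnorm A (star A (ci n x y) \<otimes> ci n x y)
      \<le> vnorm A (complex_of_real (vnorm A (ci n x x)) \<odot> ci n y y)"
    using x y column_cauchy_schwarz[OF x y] by (intro positive_norm_mono) (auto simp: positive_star_mult)
  then have "(vnorm A (ci n x y))\<^sup>2 \<le> vnorm A (ci n x x) * vnorm A (ci n y y)"
    using x y by (simp add: norm_star_mult vnorm_scale vnorm_nonneg)
  then have "vnorm A (ci n x y) \<le> sqrt (vnorm A (ci n x x) * vnorm A (ci n y y))"
    by (rule real_le_rsqrt)
  then show ?thesis by (simp add: column_space_def real_sqrt_mult)
qed

lemma column_norm_square: "x \<in> carrier (C n) \<Longrightarrow> (vnorm (C n) x)\<^sup>2 = vnorm A (ci n x x)"
  using vnorm_nonneg[of "ci n x x"] column_inner_closed[of x n x] by (simp add: column_space_def)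

lemma column_norm_nonneg: "x \<in> carrier (C n) \<Longrightarrow> 0 \<le> vnorm (C n) x"
  using vnorm_nonneg[of "ci n x x"] column_inner_closed[of x n x] by (simp add: column_space_def)

lemma column_entry_norm_le:
  assumes "x \<in> carrier (C n)" "i < n" shows "vnorm A (x i) \<le> vnorm (C n) x"
  using column_entry_le[OF assms] unfolding column_norm_square[OF assms(1), symmetric]
  by (rule power2_le_imp_le) (rule column_norm_nonneg[OF assms(1)])

lemma column_norm_le_sum:
  assumes "x \<in> carrier (C n)" shows "vnorm (C n) x \<le> (\<Sum>i<n. vnorm A (x i))"
proof -
  have "vnorm (C n) x \<le> L2_set (\<lambda>i. vnorm A (x i)) {..<n}"
    using column_inner_le_sum[OF assms] by (simp add: column_space_def L2_set_def)
  also have "\<dots> \<le> (\<Sum>i<n. vnorm A (x i))"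
    using assms by (intro L2_set_le_sum) (auto simp: vnorm_nonneg column_mem)
  finally show ?thesis .
qed

lemma column_normed: "complex_normed_space (C n)"
proof -
  have ab: "abelian_group (C n)"
  proof (rule abelian_groupI)
    fix x assume x: "x \<in> carrier (C n)"
    show "\<zero>\<^bsub>C n\<^esub> \<oplus>\<^bsub>C n\<^esub> x = x"
      using x by (intro column_eqI[of _ n]) (auto simp: column_ops_closed column_ops column_mem)
    have "(- 1) \<odot>\<^bsub>C n\<^esub> x \<oplus>\<^bsub>C n\<^esub> x = \<zero>\<^bsub>C n\<^esub>"
      using x by (intro column_eqI[of _ n])
        (auto simp: column_ops_closed column_ops column_mem M.l_neg simp flip: minus_scale)
    then show "\<exists>y\<in>carrier (C n). y \<oplus>\<^bsub>C n\<^esub> x = \<zero>\<^bsub>C n\<^esub>" using x column_ops_closed(2) by blast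
    fix y assume y: "y \<in> carrier (C n)"
    show "x \<oplus>\<^bsub>C n\<^esub> y \<in> carrier (C n)" using x y by (rule column_ops_closed)
    show "x \<oplus>\<^bsub>C n\<^esub> y = y \<oplus>\<^bsub>C n\<^esub> x"
      using x y by (intro column_eqI[of _ n]) (auto simp: column_ops_closed column_ops column_mem M.a_comm)
    fix z assume z: "z \<in> carrier (C n)"
    show "x \<oplus>\<^bsub>C n\<^esub> y \<oplus>\<^bsub>C n\<^esub> z = x \<oplus>\<^bsub>C n\<^esub> (y \<oplus>\<^bsub>C n\<^esub> z)"
      using x y z by (intro column_eqI[of _ n]) (auto simp: column_ops_closed column_ops column_mem M.a_assoc)
  qed (auto simp: column_space_def)
  have md: "Module.module complex_ring (C n)"
  proof (rule Module.moduleI[OF is_cring ab])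
    fix a b x assume x: "x \<in> carrier (C n)"
    show "a \<odot>\<^bsub>C n\<^esub> x \<in> carrier (C n)" using x by (simp add: column_ops_closed)
    show "(a \<oplus>\<^bsub>complex_ring\<^esub> b) \<odot>\<^bsub>C n\<^esub> x = a \<odot>\<^bsub>C n\<^esub> x \<oplus>\<^bsub>C n\<^esub> b \<odot>\<^bsub>C n\<^esub> x"
      "(a \<otimes>\<^bsub>complex_ring\<^esub> b) \<odot>\<^bsub>C n\<^esub> x = a \<odot>\<^bsub>C n\<^esub> (b \<odot>\<^bsub>C n\<^esub> x)"
      "\<one>\<^bsub>complex_ring\<^esub> \<odot>\<^bsub>C n\<^esub> x = x"
      using x by (auto intro!: column_eqI[of _ n]
          simp: column_ops_closed column_ops column_mem complex_ring_def scale_add_left scale_scale)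
    fix y assume y: "y \<in> carrier (C n)"
    show "a \<odot>\<^bsub>C n\<^esub> (x \<oplus>\<^bsub>C n\<^esub> y) = a \<odot>\<^bsub>C n\<^esub> x \<oplus>\<^bsub>C n\<^esub> a \<odot>\<^bsub>C n\<^esub> y"
      using x y by (auto intro!: column_eqI[of _ n]
          simp: column_ops_closed column_ops column_mem scale_add_right)
  qed
  show ?thesis
  proof (intro complex_normed_space.intro complex_normed_space_axioms.intro md)
    fix x assume x: "x \<in> carrier (C n)"
    show "0 \<le> vnorm (C n) x" by (rule column_norm_nonneg[OF x])
    show "vnorm (C n) x = 0 \<longleftrightarrow> x = \<zero>\<^bsub>C n\<^esub>"
    proof
      assume "vnorm (C n) x = 0"
      then have "x i = \<zero>" if "i < n" for i
        using column_entry_norm_le[OF x that] vnorm_nonneg[OF column_mem[OF x that]]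
          vnorm_eq_zero[OF column_mem[OF x that]] by simp
      then show "x = \<zero>\<^bsub>C n\<^esub>"
        using x by (intro column_eqI[of _ n]) (auto simp: column_ops_closed column_ops)
    next
      assume x0: "x = \<zero>\<^bsub>C n\<^esub>"
      have "vnorm (C n) x \<le> (\<Sum>i<n. vnorm A (x i))" by (rule column_norm_le_sum[OF x])
      then show "vnorm (C n) x = 0" using column_norm_nonneg[OF x] by (simp add: x0 column_ops)
    qed
    show "vnorm (C n) (c \<odot>\<^bsub>C n\<^esub> x) = cmod c * vnorm (C n) x" for c
    proof -
      have "vnorm A (ci n (c \<odot>\<^bsub>C n\<^esub> x) (c \<odot>\<^bsub>C n\<^esub> x)) = (cmod c)\<^sup>2 * vnorm A (ci n x x)"
        using x by (simp add: column_inner_scale_left column_inner_scale_right column_ops_closed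
            scale_scale vnorm_scale power2_eq_square Real_Vector_Spaces.norm_mult)
      then have "sqrt (vnorm A (ci n (c \<odot>\<^bsub>C n\<^esub> x) (c \<odot>\<^bsub>C n\<^esub> x))) = cmod c * sqrt (vnorm A (ci n x x))"
        by (simp add: real_sqrt_mult)
      then show ?thesis by (simp add: column_space_def)
    qed
    fix y assume y: "y \<in> carrier (C n)"
    have "(vnorm (C n) (x \<oplus>\<^bsub>C n\<^esub> y))\<^sup>2 = vnorm A ((ci n x x \<oplus> ci n y x) \<oplus> (ci n x y \<oplus> ci n y y))"
      using x y by (simp add: column_norm_square column_ops_closed column_inner_add_left column_inner_add_right)
    also have "\<dots> \<le> (vnorm A (ci n x x) + vnorm A (ci n y x)) + (vnorm A (ci n x y) + vnorm A (ci n y y))"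
      using x y by (intro order_trans[OF vnorm_triangle] add_mono vnorm_triangle) auto
    also have "\<dots> \<le> (vnorm (C n) x + vnorm (C n) y)\<^sup>2"
      using column_cauchy_schwarz_norm[OF x y] column_cauchy_schwarz_norm[OF y x]
      by (simp add: column_norm_square[symmetric] x y power2_sum algebra_simps)
    finally show "vnorm (C n) (x \<oplus>\<^bsub>C n\<^esub> y) \<le> vnorm (C n) x + vnorm (C n) y"
      by (rule power2_le_imp_le) (simp add: column_norm_nonneg x y)
  qed
qed

lemma column_diff:
  assumes "x \<in> carrier (C n)" "y \<in> carrier (C n)" "i < n"
  shows "(x \<ominus>\<^bsub>C n\<^esub> y) i = x i \<ominus> y i"
proof -
  interpret N: complex_normed_space "C n" by (rule column_normed)
  show ?thesis using assms by (simp add: a_minus_def N.minus_scale minus_scale column_ops column_mem)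
qed

lemma column_banach: "complex_banach_space (C n)"
proof (rule complex_banach_spaceI[OF column_normed])
  fix X assume X: "norm_cauchy (C n) X"
  interpret N: complex_normed_space "C n" by (rule column_normed)
  have Xc: "X k \<in> carrier (C n)" for k using X by (auto simp: norm_cauchy_def)
  have "\<exists>l. tends_to A (\<lambda>k. X k i) l" if i: "i < n" for i
  proof (rule norm_cauchy_tends_to)
    have le: "vnorm A (X k i \<ominus> X m i) \<le> vnorm (C n) (X k \<ominus>\<^bsub>C n\<^esub> X m)" for k m
      using column_entry_norm_le[of "X k \<ominus>\<^bsub>C n\<^esub> X m" n i] Xc i by (simp add: column_diff)
    show "norm_cauchy A (\<lambda>k. X k i)"
      unfolding norm_cauchy_def
    proof (intro conjI allI impI)
      fix e :: real assume "e > 0"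
      then show "\<exists>N. \<forall>k\<ge>N. \<forall>m\<ge>N. vnorm A (X k i \<ominus> X m i) < e"
        using X le unfolding norm_cauchy_def by (meson le_less_trans)
    qed (use Xc i column_mem in auto)
  qed
  then obtain l where l: "\<And>i. i < n \<Longrightarrow> tends_to A (\<lambda>k. X k i) (l i)" by metis
  define x where "x = (\<lambda>i\<in>{..<n}. l i)"
  have x: "x \<in> carrier (C n)" unfolding x_def using l by (intro columnI) (auto simp: tends_to_def)
  have "tends_to (C n) X x"
  proof (rule N.tends_to_squeeze)
    show "(\<lambda>k. \<Sum>i<n. vnorm A (X k i \<ominus> l i)) \<longlonglongrightarrow> 0"
      using l by (intro tendsto_null_sum) (auto simp: tends_to_def)
    show "vnorm (C n) (X k \<ominus>\<^bsub>C n\<^esub> x) \<le> (\<Sum>i<n. vnorm A (X k i \<ominus> l i))" for k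
      using column_norm_le_sum[of "X k \<ominus>\<^bsub>C n\<^esub> x" n] Xc x by (simp add: column_diff) (simp add: x_def)
  qed (use Xc x in auto)
  then show "\<exists>l. tends_to (C n) X l" by blast
qed

lemma column_hilbert_module: "hilbert_module (C n) A (ci n)"
proof -
  interpret B: complex_banach_space "C n" by (rule column_banach)
  show ?thesis
    by unfold_locales
      (auto simp: column_inner_add_right column_inner_scale_right column_inner_star
        column_norm_square column_cauchy_schwarz_norm column_inner_positive)
qed

end

section \<open>Positive matrices\<close>

text \<open>The matrices of size \<open>n\<close> over \<open>A\<close>, acting on columns.\<close>

locale matrix_algebra = cstar_algebra A for A :: "('v, 'm) star_algebra_scheme" (structure) +
  fixes n :: nat
begin

sublocale H: hilbert_module "C n" A "ci n"
  by (rule column_hilbert_module)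

abbreviation "mo \<equiv> matrix_operator A n"

text \<open>Families whose entries with both indices below \<open>n\<close> lie in \<open>A\<close>; the other entries do not matter.\<close>

definition matrices :: "(nat \<Rightarrow> nat \<Rightarrow> 'v) set" where
  "matrices = {X. \<forall>i<n. \<forall>j<n. X i j \<in> carrier A}"

lemma matrices_entry: "X \<in> matrices \<Longrightarrow> i < n \<Longrightarrow> j < n \<Longrightarrow> X i j \<in> carrier A"
  by (simp add: matrices_def)

lemma fst_matrix_operator:
  "\<lbrakk>x \<in> carrier (C n); i < n\<rbrakk> \<Longrightarrow> fst (mo X) x i = (\<Oplus>j\<in>{..<n}. X i j \<otimes> x j)"
  and snd_matrix_operator:
  "\<lbrakk>x \<in> carrier (C n); i < n\<rbrakk> \<Longrightarrow> snd (mo X) x i = (\<Oplus>j\<in>{..<n}. star A (X j i) \<otimes> x j)"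
  by (simp_all add: matrix_operator_def)

lemma matrix_apply_closed:
  "\<lbrakk>X \<in> matrices; x \<in> carrier (C n)\<rbrakk> \<Longrightarrow> (\<lambda>i\<in>{..<n}. \<Oplus>j\<in>{..<n}. X i j \<otimes> x j) \<in> carrier (C n)"
  by (intro columnI M.finsum_closed) (auto simp: matrices_entry column_mem)

lemma matrix_apply_bound:
  assumes X: "X \<in> matrices" and x: "x \<in> carrier (C n)"
  shows "vnorm (C n) (\<lambda>i\<in>{..<n}. \<Oplus>j\<in>{..<n}. X i j \<otimes> x j)
    \<le> (\<Sum>i<n. \<Sum>j<n. vnorm A (X i j)) * vnorm (C n) x"
proof -
  have "vnorm (C n) (\<lambda>i\<in>{..<n}. \<Oplus>j\<in>{..<n}. X i j \<otimes> x j)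
      \<le> (\<Sum>i<n. vnorm A (\<Oplus>j\<in>{..<n}. X i j \<otimes> x j))"
    using column_norm_le_sum[OF matrix_apply_closed[OF X x]] by simp
  also have "\<dots> \<le> (\<Sum>i<n. \<Sum>j<n. vnorm A (X i j) * vnorm (C n) x)"
  proof (intro sum_mono)
    fix i assume i: "i \<in> {..<n}"
    have "vnorm A (\<Oplus>j\<in>{..<n}. X i j \<otimes> x j) \<le> (\<Sum>j<n. vnorm A (X i j \<otimes> x j))"
      using i X x by (intro vnorm_finsum_le) (auto simp: matrices_entry column_mem)
    also have "\<dots> \<le> (\<Sum>j<n. vnorm A (X i j) * vnorm (C n) x)"
    proof (intro sum_mono)
      fix j assume j: "j \<in> {..<n}"
      have "vnorm A (X i j \<otimes> x j) \<le> vnorm A (X i j) * vnorm A (x j)"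
        using i j X x by (intro norm_mult) (auto simp: matrices_entry column_mem)
      also have "\<dots> \<le> vnorm A (X i j) * vnorm (C n) x"
        using i j X x by (intro mult_left_mono column_entry_norm_le vnorm_nonneg) (auto simp: matrices_entry)
      finally show "vnorm A (X i j \<otimes> x j) \<le> vnorm A (X i j) * vnorm (C n) x" .
    qed
    finally show "vnorm A (\<Oplus>j\<in>{..<n}. X i j \<otimes> x j) \<le> (\<Sum>j<n. vnorm A (X i j) * vnorm (C n) x)" .
  qed
  finally show ?thesis by (simp add: sum_distrib_right)
qed

lemma matrix_adjoint:
  assumes X: "X \<in> matrices" and x: "x \<in> carrier (C n)" and y: "y \<in> carrier (C n)"
  shows "ci n (\<lambda>i\<in>{..<n}. \<Oplus>j\<in>{..<n}. X i j \<otimes> x j) y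
    = ci n x (\<lambda>i\<in>{..<n}. \<Oplus>j\<in>{..<n}. star A (X j i) \<otimes> y j)"
proof -
  have "ci n (\<lambda>i\<in>{..<n}. \<Oplus>j\<in>{..<n}. X i j \<otimes> x j) y
      = (\<Oplus>i\<in>{..<n}. \<Oplus>j\<in>{..<n}. star A (x j) \<otimes> (star A (X i j) \<otimes> y i))"
    unfolding column_inner_def
  proof (rule M.finsum_cong')
    fix i assume i: "i \<in> {..<n}"
    have "star A (\<Oplus>j\<in>{..<n}. X i j \<otimes> x j) \<otimes> y i = (\<Oplus>j\<in>{..<n}. star A (X i j \<otimes> x j)) \<otimes> y i"
      using i X x by (subst star_finsum) (auto simp: matrices_entry column_mem)
    also have "\<dots> = (\<Oplus>j\<in>{..<n}. star A (X i j \<otimes> x j) \<otimes> y i)"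
      using i X x y by (intro mult_finsum_left) (auto simp: matrices_entry column_mem)
    also have "\<dots> = (\<Oplus>j\<in>{..<n}. star A (x j) \<otimes> (star A (X i j) \<otimes> y i))"
      using i X x y by (intro M.finsum_cong') (auto simp: matrices_entry column_mem star_mult mult_assoc)
    finally show "star A ((\<lambda>i\<in>{..<n}. \<Oplus>j\<in>{..<n}. X i j \<otimes> x j) i) \<otimes> y i
        = (\<Oplus>j\<in>{..<n}. star A (x j) \<otimes> (star A (X i j) \<otimes> y i))" using i by simp
  qed (use X x y in \<open>auto intro!: M.finsum_closed simp: matrices_entry column_mem\<close>)
  also have "\<dots> = (\<Oplus>j\<in>{..<n}. \<Oplus>i\<in>{..<n}. star A (x j) \<otimes> (star A (X i j) \<otimes> y i))"
    using X x y by (intro M.finsum_swap) (auto simp: matrices_entry column_mem)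
  also have "\<dots> = ci n x (\<lambda>i\<in>{..<n}. \<Oplus>j\<in>{..<n}. star A (X j i) \<otimes> y j)"
    unfolding column_inner_def using X x y
    by (intro M.finsum_cong') (auto simp: matrices_entry column_mem mult_finsum_right intro!: M.finsum_closed)
  finally show ?thesis .
qed

lemma matrix_operator_closed:
  assumes X: "X \<in> matrices" shows "mo X \<in> carrier H.L"
proof -
  define Y where "Y = (\<lambda>i j. star A (X j i))"
  have Y: "Y \<in> matrices" using X by (simp add: Y_def matrices_def)
  have YX: "(\<Sum>i<n. \<Sum>j<n. vnorm A (Y i j)) = (\<Sum>i<n. \<Sum>j<n. vnorm A (X i j))"
    unfolding Y_def using X by (subst sum.swap) (simp add: matrices_entry)
  have "mo X \<in> adjointable (C n) (ci n)"
    unfolding matrix_operator_def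
    using matrix_apply_closed[OF X] matrix_apply_closed[OF Y] matrix_adjoint[OF X]
      matrix_apply_bound[OF X] matrix_apply_bound[OF Y]
    unfolding YX unfolding Y_def by (rule H.adjointableI)
  then show ?thesis by (simp add: adjointable_algebra_def)
qed

lemma matrix_operator_norm_le:
  assumes X: "X \<in> matrices" shows "vnorm H.L (mo X) \<le> (\<Sum>i<n. \<Sum>j<n. vnorm A (X i j))"
proof (rule H.L_norm_le)
  show "0 \<le> (\<Sum>i<n. \<Sum>j<n. vnorm A (X i j))"
    using X by (intro sum_nonneg) (auto simp: vnorm_nonneg matrices_entry)
  show "vnorm (C n) (fst (mo X) x) \<le> (\<Sum>i<n. \<Sum>j<n. vnorm A (X i j)) * vnorm (C n) x"
    if "x \<in> carrier (C n)" for x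
    using matrix_apply_bound[OF X that] that by (simp add: matrix_operator_def)
qed

text \<open>The column with entry \<open>a\<close> at \<open>j\<close> and zero elsewhere; these columns recover the entries of a matrix.\<close>

definition unit_column :: "nat \<Rightarrow> 'v \<Rightarrow> nat \<Rightarrow> 'v" where
  "unit_column j a = (\<lambda>i\<in>{..<n}. if i = j then a else \<zero>)"

lemma unit_column_closed: "a \<in> carrier A \<Longrightarrow> unit_column j a \<in> carrier (C n)"
  unfolding unit_column_def by (intro columnI) auto

lemma finsum_mult_unit_column:
  assumes f: "\<And>i. i < n \<Longrightarrow> f i \<in> carrier A" and a: "a \<in> carrier A" and j: "j < n"
  shows "(\<Oplus>i\<in>{..<n}. f i \<otimes> unit_column j a i) = f j \<otimes> a"
proof -
  have "(\<Oplus>i\<in>{..<n}. f i \<otimes> unit_column j a i) = (\<Oplus>i\<in>{..<n}. if j = i then f i \<otimes> a else \<zero>)"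
    using f a by (intro M.finsum_cong') (auto simp: unit_column_def)
  also have "\<dots> = f j \<otimes> a" using f a j by (intro M.finsum_singleton) auto
  finally show ?thesis .
qed

lemma fst_matrix_operator_unit:
  "\<lbrakk>X \<in> matrices; a \<in> carrier A; i < n; j < n\<rbrakk> \<Longrightarrow> fst (mo X) (unit_column j a) i = X i j \<otimes> a"
  by (simp add: fst_matrix_operator unit_column_closed finsum_mult_unit_column matrices_entry)

lemma snd_matrix_operator_unit:
  "\<lbrakk>X \<in> matrices; a \<in> carrier A; i < n; j < n\<rbrakk> \<Longrightarrow> snd (mo X) (unit_column j a) i = star A (X j i) \<otimes> a"
  by (simp add: snd_matrix_operator unit_column_closed finsum_mult_unit_column matrices_entry)

lemma unit_column_norm_le:
  assumes "a \<in> carrier A" shows "vnorm (C n) (unit_column j a) \<le> vnorm A a"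
proof -
  have "vnorm (C n) (unit_column j a) \<le> (\<Sum>i<n. vnorm A (unit_column j a i))"
    by (rule column_norm_le_sum[OF unit_column_closed[OF assms]])
  also have "\<dots> = (\<Sum>i<n. if i = j then vnorm A a else 0)"
    by (intro sum.cong) (auto simp: unit_column_def)
  also have "\<dots> \<le> vnorm A a" using assms by (simp add: vnorm_nonneg)
  finally show ?thesis .
qed

lemma entry_norm_le:
  assumes X: "X \<in> matrices" and ij: "i < n" "j < n"
  shows "vnorm A (X i j) \<le> vnorm H.L (mo X)"
proof -
  let ?a = "star A (X i j)"
  have a: "?a \<in> carrier A" using X ij by (simp add: matrices_entry)
  have c: "fst (mo X) (unit_column j ?a) \<in> carrier (C n)"
    using matrix_operator_closed[OF X] unit_column_closed[OF a] by simp
  have "vnorm A (X i j) * vnorm A (X i j) = vnorm A (fst (mo X) (unit_column j ?a) i)"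
    using X ij a vnorm_mult_star[of "X i j"]
    by (simp add: fst_matrix_operator_unit matrices_entry power2_eq_square)
  also have "\<dots> \<le> vnorm (C n) (fst (mo X) (unit_column j ?a))" by (rule column_entry_norm_le[OF c ij(1)])
  also have "\<dots> \<le> vnorm H.L (mo X) * vnorm (C n) (unit_column j ?a)"
    by (rule H.L_bound[OF matrix_operator_closed[OF X] unit_column_closed[OF a]])
  also have "\<dots> \<le> vnorm H.L (mo X) * vnorm A (X i j)"
    using unit_column_norm_le[OF a, of j] H.L_norm_nonneg[OF matrix_operator_closed[OF X]] X ij
    by (intro mult_left_mono) (auto simp: matrices_entry)
  finally show ?thesis
    using vnorm_nonneg[of "X i j"] H.L_norm_nonneg[OF matrix_operator_closed[OF X]] X ij
    by (cases "vnorm A (X i j) = 0") (auto simp: matrices_entry)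
qed

text \<open>Without a unit, take \<open>a = (u - v)*\<close>.\<close>

lemma mult_cancel_all:
  assumes "u \<in> carrier A" "v \<in> carrier A" "\<And>a. a \<in> carrier A \<Longrightarrow> u \<otimes> a = v \<otimes> a" shows "u = v"
proof -
  have "(u \<ominus> v) \<otimes> star A (u \<ominus> v) = \<zero>"
    using assms by (simp add: mult_diff_left)
  then have "vnorm A (u \<ominus> v) = 0" using vnorm_mult_star[of "u \<ominus> v"] assms by simp
  then show ?thesis using assms by (simp add: vnorm_eq_zero diff_eq_zero_iff)
qed

lemma matrix_operator_hom:
  assumes X: "X \<in> matrices" and Y: "Y \<in> matrices"
  shows "mo X \<oplus>\<^bsub>H.L\<^esub> mo Y = mo (\<lambda>i j. X i j \<oplus> Y i j)"
    "c \<odot>\<^bsub>H.L\<^esub> mo X = mo (\<lambda>i j. c \<odot> X i j)"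
    "mo X \<otimes>\<^bsub>H.L\<^esub> mo Y = mo (\<lambda>i j. \<Oplus>k\<in>{..<n}. X i k \<otimes> Y k j)"
proof -
  note cl = matrix_operator_closed[OF X] matrix_operator_closed[OF Y]
  have M1: "(\<lambda>i j. X i j \<oplus> Y i j) \<in> matrices" using X Y by (simp add: matrices_def)
  have M2: "(\<lambda>i j. c \<odot> X i j) \<in> matrices" using X by (simp add: matrices_def)
  have M3: "(\<lambda>i j. \<Oplus>k\<in>{..<n}. X i k \<otimes> Y k j) \<in> matrices"
    using X Y by (auto simp: matrices_def intro!: M.finsum_closed)
  show "mo X \<oplus>\<^bsub>H.L\<^esub> mo Y = mo (\<lambda>i j. X i j \<oplus> Y i j)"
  proof (rule H.L_eqI)
    fix x assume x: "x \<in> carrier (C n)"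
    have "fst (mo X) x i \<oplus> fst (mo Y) x i = fst (mo (\<lambda>i j. X i j \<oplus> Y i j)) x i" if i: "i < n" for i
    proof -
      have "(\<Oplus>j\<in>{..<n}. (X i j \<oplus> Y i j) \<otimes> x j) = (\<Oplus>j\<in>{..<n}. X i j \<otimes> x j \<oplus> Y i j \<otimes> x j)"
        using X Y x i by (intro M.finsum_cong') (auto simp: matrices_entry column_mem mult_add_left)
      also have "\<dots> = (\<Oplus>j\<in>{..<n}. X i j \<otimes> x j) \<oplus> (\<Oplus>j\<in>{..<n}. Y i j \<otimes> x j)"
        using X Y x i by (intro M.finsum_addf) (auto simp: matrices_entry column_mem)
      finally show ?thesis using x i by (simp add: fst_matrix_operator)
    qed
    then show "fst (mo X \<oplus>\<^bsub>H.L\<^esub> mo Y) x = fst (mo (\<lambda>i j. X i j \<oplus> Y i j)) x"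
      using x cl matrix_operator_closed[OF M1]
      by (intro column_eqI[of _ n]) (auto simp: column_ops column_ops_closed)
  qed (use cl matrix_operator_closed[OF M1] H.L_ops_closed in auto)
  show "c \<odot>\<^bsub>H.L\<^esub> mo X = mo (\<lambda>i j. c \<odot> X i j)"
  proof (rule H.L_eqI)
    fix x assume x: "x \<in> carrier (C n)"
    have "c \<odot> fst (mo X) x i = fst (mo (\<lambda>i j. c \<odot> X i j)) x i" if i: "i < n" for i
    proof -
      have "c \<odot> (\<Oplus>j\<in>{..<n}. X i j \<otimes> x j) = (\<Oplus>j\<in>{..<n}. c \<odot> (X i j \<otimes> x j))"
        using X x i by (intro scale_finsum) (auto simp: matrices_entry column_mem)
      also have "\<dots> = (\<Oplus>j\<in>{..<n}. (c \<odot> X i j) \<otimes> x j)"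
        using X x i by (intro M.finsum_cong') (auto simp: matrices_entry column_mem mult_smult_left)
      finally show ?thesis using x i by (simp add: fst_matrix_operator)
    qed
    then show "fst (c \<odot>\<^bsub>H.L\<^esub> mo X) x = fst (mo (\<lambda>i j. c \<odot> X i j)) x"
      using x cl matrix_operator_closed[OF M2]
      by (intro column_eqI[of _ n]) (auto simp: column_ops column_ops_closed)
  qed (use cl matrix_operator_closed[OF M2] H.L_ops_closed in auto)
  show "mo X \<otimes>\<^bsub>H.L\<^esub> mo Y = mo (\<lambda>i j. \<Oplus>k\<in>{..<n}. X i k \<otimes> Y k j)"
  proof (rule H.L_eqI)
    fix x assume x: "x \<in> carrier (C n)"
    have Yx: "fst (mo Y) x \<in> carrier (C n)" using x cl by simp
    have "fst (mo X) (fst (mo Y) x) i = fst (mo (\<lambda>i j. \<Oplus>k\<in>{..<n}. X i k \<otimes> Y k j)) x i"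
      if i: "i < n" for i
    proof -
      have "(\<Oplus>k\<in>{..<n}. X i k \<otimes> fst (mo Y) x k) = (\<Oplus>k\<in>{..<n}. \<Oplus>j\<in>{..<n}. X i k \<otimes> (Y k j \<otimes> x j))"
        using X Y x i by (intro M.finsum_cong')
          (auto simp: matrices_entry column_mem fst_matrix_operator mult_finsum_right intro!: M.finsum_closed)
      also have "\<dots> = (\<Oplus>j\<in>{..<n}. \<Oplus>k\<in>{..<n}. X i k \<otimes> (Y k j \<otimes> x j))"
        using X Y x i by (intro M.finsum_swap) (auto simp: matrices_entry column_mem)
      also have "\<dots> = (\<Oplus>j\<in>{..<n}. (\<Oplus>k\<in>{..<n}. X i k \<otimes> Y k j) \<otimes> x j)"
        using X Y x i by (intro M.finsum_cong')
          (auto simp: matrices_entry column_mem mult_finsum_left mult_assoc intro!: M.finsum_closed M.finsum_cong')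
      finally show ?thesis using x i Yx by (simp add: fst_matrix_operator)
    qed
    then show "fst (mo X \<otimes>\<^bsub>H.L\<^esub> mo Y) x = fst (mo (\<lambda>i j. \<Oplus>k\<in>{..<n}. X i k \<otimes> Y k j)) x"
      using x cl matrix_operator_closed[OF M3]
      by (intro column_eqI[of _ n]) auto
  qed (use cl matrix_operator_closed[OF M3] H.L_ops_closed in auto)
qed

lemma matrix_operator_diff:
  assumes X: "X \<in> matrices" and Y: "Y \<in> matrices"
  shows "mo X \<ominus>\<^bsub>H.L\<^esub> mo Y = mo (\<lambda>i j. X i j \<oplus> (- 1) \<odot> Y i j)"
proof -
  have "(\<lambda>i j. (- 1) \<odot> Y i j) \<in> matrices" using Y by (simp add: matrices_def)
  then show ?thesis
    using matrix_operator_hom[OF X] matrix_operator_hom(2)[OF Y Y] matrix_operator_closed[OF Y]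
    by (simp add: a_minus_def H.L.minus_scale)
qed

text \<open>
  The entries of a matrix are bounded by its operator norm, and conversely, so the matrices form a closed
  set of operators. Hence the square root of a positive matrix is again a matrix.
\<close>

lemma closed_jordan_matrices: "closed_jordan H.L (mo ` matrices)"
  unfolding closed_jordan_def
proof (intro conjI allI ballI impI)
  fix P p assume P: "range P \<subseteq> mo ` matrices" and p: "tends_to H.L P p"
  have "\<exists>X. X \<in> matrices \<and> P m = mo X" for m using P by auto
  then obtain X where X: "\<And>m. X m \<in> matrices" "\<And>m. P m = mo (X m)" by metis
  have le: "vnorm A (X k i j \<ominus> X m i j) \<le> vnorm H.L (P k \<ominus>\<^bsub>H.L\<^esub> P m)" if ij: "i < n" "j < n" for k m i j
  proof -
    have "(\<lambda>i j. X k i j \<oplus> (- 1) \<odot> X m i j) \<in> matrices"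
      using X(1)[of k] X(1)[of m] by (simp add: matrices_def)
    moreover have "X k i j \<ominus> X m i j = X k i j \<oplus> (- 1) \<odot> X m i j"
      using X(1)[of m] ij by (simp add: M.minus_eq minus_scale matrices_entry)
    ultimately show ?thesis
      using entry_norm_le[of "\<lambda>i j. X k i j \<oplus> (- 1) \<odot> X m i j" i j] ij X(1)[of k] X(1)[of m]
      by (simp add: X(2) matrix_operator_diff)
  qed
  have "\<exists>l. tends_to A (\<lambda>m. X m i j) l" if ij: "i < n" "j < n" for i j
  proof (rule norm_cauchy_tends_to)
    show "norm_cauchy A (\<lambda>m. X m i j)"
      unfolding norm_cauchy_def
    proof (intro conjI allI impI)
      fix e :: real assume "e > 0"
      then show "\<exists>N. \<forall>k\<ge>N. \<forall>m\<ge>N. vnorm A (X k i j \<ominus> X m i j) < e"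
        using H.L.tends_to_cauchy[OF p] le[OF ij] unfolding norm_cauchy_def by (meson le_less_trans)
    qed (use X ij matrices_entry in auto)
  qed
  then obtain W where W: "\<And>i j. i < n \<Longrightarrow> j < n \<Longrightarrow> tends_to A (\<lambda>m. X m i j) (W i j)" by metis
  have Wm: "W \<in> matrices" using W by (auto simp: matrices_def tends_to_def)
  have "tends_to H.L P (mo W)"
  proof (rule H.L.tends_to_squeeze)
    show "(\<lambda>m. \<Sum>i<n. \<Sum>j<n. vnorm A (X m i j \<ominus> W i j)) \<longlonglongrightarrow> 0"
      using W by (intro tendsto_null_sum) (auto simp: tends_to_def)
    fix m
    have "(\<lambda>i j. X m i j \<oplus> (- 1) \<odot> W i j) \<in> matrices"
      using X(1)[of m] Wm by (simp add: matrices_def)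
    then have "vnorm H.L (P m \<ominus>\<^bsub>H.L\<^esub> mo W) \<le> (\<Sum>i<n. \<Sum>j<n. vnorm A (X m i j \<oplus> (- 1) \<odot> W i j))"
      using matrix_operator_norm_le X(1)[of m] Wm by (simp add: X(2) matrix_operator_diff)
    also have "\<dots> = (\<Sum>i<n. \<Sum>j<n. vnorm A (X m i j \<ominus> W i j))"
      using Wm by (intro sum.cong) (auto simp: a_minus_def minus_scale matrices_entry)
    finally show "vnorm H.L (P m \<ominus>\<^bsub>H.L\<^esub> mo W) \<le> \<dots>" .
  qed (use X Wm matrix_operator_closed in auto)
  then have "p = mo W" using H.L.tends_to_unique[OF p] by blast
  then show "p \<in> mo ` matrices" using Wm by blast
next
  show "mo ` matrices \<subseteq> carrier H.L" using matrix_operator_closed by auto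
next
  fix p q assume "p \<in> mo ` matrices" "q \<in> mo ` matrices"
  then obtain X Y where XY: "X \<in> matrices" "p = mo X" "Y \<in> matrices" "q = mo Y" by blast
  then have "(\<lambda>i j. X i j \<oplus> Y i j) \<in> matrices" by (simp add: matrices_def)
  then show "p \<oplus>\<^bsub>H.L\<^esub> q \<in> mo ` matrices" using XY matrix_operator_hom(1) by simp
next
  fix r p assume "p \<in> mo ` matrices"
  then obtain X where X: "X \<in> matrices" "p = mo X" by blast
  then have "(\<lambda>i j. complex_of_real r \<odot> X i j) \<in> matrices" by (simp add: matrices_def)
  then show "complex_of_real r \<odot>\<^bsub>H.L\<^esub> p \<in> mo ` matrices" using X matrix_operator_hom(2)[OF X(1) X(1)] by simp
next
  fix p assume "p \<in> mo ` matrices"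
  then obtain X where X: "X \<in> matrices" "p = mo X" by blast
  then have "(\<lambda>i j. \<Oplus>k\<in>{..<n}. X i k \<otimes> X k j) \<in> matrices"
    by (auto simp: matrices_def intro!: M.finsum_closed)
  then show "p \<otimes>\<^bsub>H.L\<^esub> p \<in> mo ` matrices" using X matrix_operator_hom(3)[OF X(1) X(1)] by simp
qed

lemma matrix_positive_if_inner_positive:
  assumes X: "X \<in> matrices"
    and pos: "\<And>b. b \<in> carrier (C n) \<Longrightarrow>
      positive A (\<Oplus>i\<in>{..<n}. \<Oplus>j\<in>{..<n}. star A (b i) \<otimes> X i j \<otimes> b j)"
  shows "matrix_positive A n X"
proof -
  have "H.L.pos (mo X)"
  proof (rule H.pos_if_inn_positive[OF matrix_operator_closed[OF X]])
    fix b assume b: "b \<in> carrier (C n)"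
    have "ci n b (fst (mo X) b) = (\<Oplus>i\<in>{..<n}. \<Oplus>j\<in>{..<n}. star A (b i) \<otimes> X i j \<otimes> b j)"
      unfolding column_inner_def using X b
      by (intro M.finsum_cong') (auto simp: fst_matrix_operator matrices_entry column_mem
          mult_finsum_right mult_assoc intro!: M.finsum_closed M.finsum_cong')
    then show "positive A (ci n b (fst (mo X) b))" using pos[OF b] by simp
  qed
  then obtain K where K: "H.L.pos K" "K \<otimes>\<^bsub>H.L\<^esub> K = mo X"
    and KD: "\<And>D. closed_jordan H.L D \<Longrightarrow> mo X \<in> D \<Longrightarrow> K \<in> D"
    using H.L.sqrt_pos by blast
  obtain Z where Z: "Z \<in> matrices" "K = mo Z"
    using KD[OF closed_jordan_matrices imageI[OF X]] by blast
  have Zs: "Z i j = star A (Z j i)" if ij: "i < n" "j < n" for i j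
  proof (rule mult_cancel_all)
    fix a assume a: "a \<in> carrier A"
    have "star H.L K = K" using K(1) by (rule H.L.pos_star)
    then have "snd (mo Z) (unit_column j a) = fst (mo Z) (unit_column j a)"
      using H.fst_L(6)[OF unit_column_closed[OF a], of K j] Z by simp
    then show "Z i j \<otimes> a = star A (Z j i) \<otimes> a"
      using fst_matrix_operator_unit[OF Z(1) a ij] snd_matrix_operator_unit[OF Z(1) a ij] by simp
  qed (use Z ij matrices_entry in auto)
  define ZZ where "ZZ = (\<lambda>i j. \<Oplus>k\<in>{..<n}. Z i k \<otimes> Z k j)"
  have ZZ: "ZZ \<in> matrices" using Z(1) by (auto simp: matrices_def ZZ_def intro!: M.finsum_closed)
  have eq: "mo X = mo ZZ" using K(2) Z matrix_operator_hom(3)[OF Z(1) Z(1)] by (simp add: ZZ_def)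
  have "X i j = (\<Oplus>k\<in>{..<n}. star A (Z k i) \<otimes> Z k j)" if ij: "i < n" "j < n" for i j
  proof -
    have "X i j = ZZ i j"
    proof (rule mult_cancel_all)
      fix a assume a: "a \<in> carrier A"
      show "X i j \<otimes> a = ZZ i j \<otimes> a"
        using fst_matrix_operator_unit[OF X a ij] fst_matrix_operator_unit[OF ZZ a ij] eq by simp
    qed (use X ZZ ij matrices_entry in auto)
    also have "\<dots> = (\<Oplus>k\<in>{..<n}. star A (Z k i) \<otimes> Z k j)"
      unfolding ZZ_def using Z(1) ij Zs[OF ij(1)]
      by (intro M.finsum_cong') (auto simp: matrices_entry)
    finally show ?thesis .
  qed
  then show ?thesis unfolding matrix_positive_def using Z(1) by (auto simp: matrices_def)
qed

end

section \<open>Complete positivity and the Kadison-Schwarz inequality\<close>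

text \<open>The positive definiteness of a bundle map in the case that all group elements are the unit; \<open>T\<close> is then
  the unit component.\<close>

definition positive_definite_map :: "('v, 'm) star_algebra_scheme \<Rightarrow> ('v \<Rightarrow> 'v) \<Rightarrow> bool" where
  "positive_definite_map A T \<longleftrightarrow> (\<forall>(n::nat) a b. (\<forall>i<n. a i \<in> carrier A \<and> b i \<in> carrier A) \<longrightarrow>
     positive A (\<Oplus>\<^bsub>A\<^esub>i\<in>{..<n}. \<Oplus>\<^bsub>A\<^esub>j\<in>{..<n}.
       b i \<otimes>\<^bsub>A\<^esub> T (star A (a i) \<otimes>\<^bsub>A\<^esub> a j) \<otimes>\<^bsub>A\<^esub> star A (b j)))"

context cstar_algebra
begin

lemma linear_mapD:
  assumes "linear_map A T"
  shows "x \<in> carrier A \<Longrightarrow> T x \<in> carrier A"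
    "x \<in> carrier A \<Longrightarrow> y \<in> carrier A \<Longrightarrow> T (x \<oplus> y) = T x \<oplus> T y"
    "x \<in> carrier A \<Longrightarrow> T (c \<odot> x) = c \<odot> T x"
  using assms by (auto simp: linear_map_def)

lemma linear_map_finsum:
  assumes T: "linear_map A T" and "finite S" "f \<in> S \<rightarrow> carrier A"
  shows "T (\<Oplus>i\<in>S. f i) = (\<Oplus>i\<in>S. T (f i))"
  using assms(2,3)
proof (induction S rule: finite_induct)
  case empty
  have "T \<zero> = T (0 \<odot> \<zero>)" by simp
  also have "\<dots> = 0 \<odot> T \<zero>" by (rule linear_mapD(3)[OF T M.zero_closed])
  also have "\<dots> = \<zero>" using linear_mapD(1)[OF T] by simp
  finally show ?case by simp
next
  case (insert x S)
  have fS: "(\<Oplus>i\<in>S. f i) \<in> carrier A" "f x \<in> carrier A"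
    using insert.prems by (auto intro!: M.finsum_closed)
  have "(\<lambda>i. T (f i)) \<in> S \<rightarrow> carrier A" "T (f x) \<in> carrier A"
    using insert.prems linear_mapD(1)[OF T] by auto
  then show ?case using insert linear_mapD(2)[OF T fS(2,1)] by (simp add: Pi_def)
qed

lemma positive_definite_mapD:
  fixes n :: nat
  assumes T: "linear_map A T" and pd: "positive_definite_map A T"
    and a: "\<And>i. i < n \<Longrightarrow> a i \<in> carrier A" and b: "\<And>i. i < n \<Longrightarrow> b i \<in> carrier A"
  shows "positive A (\<Oplus>i\<in>{..<n}. \<Oplus>j\<in>{..<n}. star A (b i) \<otimes> T (star A (a i) \<otimes> a j) \<otimes> b j)"
proof -
  have "(\<Oplus>i\<in>{..<n}. \<Oplus>j\<in>{..<n}. star A (b i) \<otimes> T (star A (a i) \<otimes> a j) \<otimes> star A (star A (b j)))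
      = (\<Oplus>i\<in>{..<n}. \<Oplus>j\<in>{..<n}. star A (b i) \<otimes> T (star A (a i) \<otimes> a j) \<otimes> b j)"
    using a b linear_mapD(1)[OF T] by (intro M.finsum_cong' refl) (auto intro!: M.finsum_closed)
  then show ?thesis
    using pd[unfolded positive_definite_map_def, rule_format, of n a "\<lambda>i. star A (b i)"] a b by simp
qed

lemma completely_positive_if_positive_definite:
  assumes T: "linear_map A T" and pd: "positive_definite_map A T"
  shows "completely_positive A T"
  unfolding completely_positive_def
proof (intro conjI allI impI T)
  fix n X assume "matrix_positive A n X"
  then obtain Y where Y: "\<And>i j. i < n \<Longrightarrow> j < n \<Longrightarrow> Y i j \<in> carrier A"
    and X: "\<And>i j. i < n \<Longrightarrow> j < n \<Longrightarrow> X i j = (\<Oplus>k\<in>{..<n}. star A (Y k i) \<otimes> Y k j)"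
    unfolding matrix_positive_def by blast
  interpret mat: matrix_algebra A n by unfold_locales
  note Tc = linear_mapD(1)[OF T]
  have TX: "T (X i j) = (\<Oplus>k\<in>{..<n}. T (star A (Y k i) \<otimes> Y k j))" if "i < n" "j < n" for i j
    using X[OF that] Y that by (simp add: linear_map_finsum[OF T] Pi_def)
  show "matrix_positive A n (\<lambda>i j. T (X i j))"
  proof (rule mat.matrix_positive_if_inner_positive)
    show "(\<lambda>i j. T (X i j)) \<in> mat.matrices"
      unfolding mat.matrices_def using X Y Tc by (auto intro!: M.finsum_closed)
    fix b assume b: "b \<in> carrier (C n)"
    have bc: "\<And>i. i < n \<Longrightarrow> b i \<in> carrier A" using column_mem[OF b] .
    let ?f = "\<lambda>k i j. star A (b i) \<otimes> T (star A (Y k i) \<otimes> Y k j) \<otimes> b j"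
    have f: "?f k i j \<in> carrier A" if "k < n" "i < n" "j < n" for k i j
      using that Y bc Tc by simp
    have "(\<Oplus>i\<in>{..<n}. \<Oplus>j\<in>{..<n}. star A (b i) \<otimes> T (X i j) \<otimes> b j)
        = (\<Oplus>i\<in>{..<n}. \<Oplus>j\<in>{..<n}. \<Oplus>k\<in>{..<n}. ?f k i j)"
    proof (intro M.finsum_cong' refl)
      fix i j assume ij: "i \<in> {..<n}" "j \<in> {..<n}"
      have "star A (b i) \<otimes> T (X i j) = (\<Oplus>k\<in>{..<n}. star A (b i) \<otimes> T (star A (Y k i) \<otimes> Y k j))"
        using ij Y bc Tc by (simp add: TX mult_finsum_right Pi_def)
      then show "star A (b i) \<otimes> T (X i j) \<otimes> b j = (\<Oplus>k\<in>{..<n}. ?f k i j)"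
        using ij Y bc Tc by (simp add: mult_finsum_left Pi_def)
    qed (use f in \<open>auto intro!: M.finsum_closed\<close>)
    also have "\<dots> = (\<Oplus>i\<in>{..<n}. \<Oplus>k\<in>{..<n}. \<Oplus>j\<in>{..<n}. ?f k i j)"
      using f by (intro M.finsum_cong' M.finsum_swap refl) (auto intro!: M.finsum_closed)
    also have "\<dots> = (\<Oplus>k\<in>{..<n}. \<Oplus>i\<in>{..<n}. \<Oplus>j\<in>{..<n}. ?f k i j)"
      using f by (intro M.finsum_swap) (auto intro!: M.finsum_closed)
    finally have eq: "(\<Oplus>i\<in>{..<n}. \<Oplus>j\<in>{..<n}. star A (b i) \<otimes> T (X i j) \<otimes> b j)
        = (\<Oplus>k\<in>{..<n}. \<Oplus>i\<in>{..<n}. \<Oplus>j\<in>{..<n}. ?f k i j)" .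
    show "positive A (\<Oplus>i\<in>{..<n}. \<Oplus>j\<in>{..<n}. star A (b i) \<otimes> T (X i j) \<otimes> b j)"
      unfolding eq
    proof (rule positive_finsum)
      fix k assume "k \<in> {..<n}"
      then show "positive A (\<Oplus>i\<in>{..<n}. \<Oplus>j\<in>{..<n}. ?f k i j)"
        using Y bc by (intro positive_definite_mapD[OF T pd]) auto
    qed simp
  qed
qed

text \<open>
  Since the matrix with entries \<open>T(c_i* c_j)\<close>, for \<open>c = (a, e)\<close>, has the form \<open>Z*Z\<close>, its entries are the
  inner products of the columns of \<open>Z\<close>, to which the Cauchy-Schwarz inequality applies.
\<close>

lemma kadison_schwarz_compressed:
  assumes T: "linear_map A T" and pd: "positive_definite_map A T" and ct: "contractive A T"
    and a: "a \<in> carrier A" and e: "e \<in> carrier A" "vnorm A e \<le> 1"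
  shows "positive A (T (star A a \<otimes> a) \<ominus> star A (T (star A e \<otimes> a)) \<otimes> T (star A e \<otimes> a))"
proof -
  interpret mat: matrix_algebra A 2 by unfold_locales
  note Tc = linear_mapD(1)[OF T]
  define c where "c = (\<lambda>i::nat. if i = 0 then a else e)"
  have cc: "c i \<in> carrier A" for i using a e by (simp add: c_def)
  have "matrix_positive A 2 (\<lambda>i j. T (star A (c i) \<otimes> c j))"
  proof (rule mat.matrix_positive_if_inner_positive)
    show "(\<lambda>i j. T (star A (c i) \<otimes> c j)) \<in> mat.matrices"
      unfolding mat.matrices_def using cc Tc by auto
    show "positive A (\<Oplus>i\<in>{..<2}. \<Oplus>j\<in>{..<2}. star A (b i) \<otimes> T (star A (c i) \<otimes> c j) \<otimes> b j)"
      if b: "b \<in> carrier (C 2)" for b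
      using positive_definite_mapD[OF T pd, of 2 c b] cc column_mem[OF b] by simp
  qed
  then obtain Z where Z: "\<And>i j :: nat. i < 2 \<Longrightarrow> j < 2 \<Longrightarrow> Z i j \<in> carrier A"
    and TZ: "\<And>i j :: nat. i < 2 \<Longrightarrow> j < 2 \<Longrightarrow> T (star A (c i) \<otimes> c j) = (\<Oplus>k\<in>{..<2::nat}. star A (Z k i) \<otimes> Z k j)"
    unfolding matrix_positive_def by blast
  define z where "z = (\<lambda>i. \<lambda>k\<in>{..<2::nat}. Z k i)"
  have z: "z i \<in> carrier (C 2)" if "i < 2" for i :: nat
    unfolding z_def using Z that by (intro columnI) auto
  have ciz: "ci 2 (z i) (z j) = T (star A (c i) \<otimes> c j)" if "i < 2" "j < 2" for i j :: nat
    unfolding TZ[OF that] column_inner_def using Z that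
    by (intro M.finsum_cong') (auto simp: z_def)
  let ?p = "T (star A a \<otimes> a)" and ?t = "T (star A e \<otimes> a)" and ?m = "vnorm A (T (star A e \<otimes> e))"
  have cs: "positive A (complex_of_real ?m \<odot> ?p \<ominus> star A ?t \<otimes> ?t)"
    using column_cauchy_schwarz[OF z[of 1] z[of 0]] ciz[of 1 1] ciz[of 0 0] ciz[of 1 0]
    by (simp add: c_def)
  have "?m \<le> vnorm A (star A e \<otimes> e)" using ct e by (simp add: contractive_def)
  also have "\<dots> \<le> 1" using e vnorm_nonneg[OF e(1)] by (simp add: norm_star_mult power_le_one)
  finally have m: "?m \<le> 1" .
  have "positive A ?p" using column_inner_positive[OF z[of 0]] ciz[of 0 0] by (simp add: c_def)
  then have "positive A (complex_of_real (1 - ?m) \<odot> ?p)" using m by (intro positive_scale) auto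
  then have "positive A ((complex_of_real (1 - ?m) \<odot> ?p) \<oplus> (complex_of_real ?m \<odot> ?p \<ominus> star A ?t \<otimes> ?t))"
    using cs by (rule positive_add)
  also have "(complex_of_real (1 - ?m) \<odot> ?p) \<oplus> (complex_of_real ?m \<odot> ?p \<ominus> star A ?t \<otimes> ?t)
      = (complex_of_real (1 - ?m) \<odot> ?p \<oplus> complex_of_real ?m \<odot> ?p) \<ominus> star A ?t \<otimes> ?t"
    using Tc a e by (simp add: M.minus_eq M.a_assoc)
  also have "complex_of_real (1 - ?m) \<odot> ?p \<oplus> complex_of_real ?m \<odot> ?p = ?p"
    using Tc a by (subst scale_add_left[symmetric]) auto
  finally show ?thesis .
qed

lemma stateD:
  assumes "state A \<phi>"
  shows "x \<in> carrier A \<Longrightarrow> y \<in> carrier A \<Longrightarrow> \<phi> (x \<oplus> y) = \<phi> x + \<phi> y"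
    "x \<in> carrier A \<Longrightarrow> \<phi> (c \<odot> x) = c * \<phi> x"
    "positive A x \<Longrightarrow> 0 \<le> \<phi> x"
  using assms by (auto simp: state_def)

lemma state_diff:
  assumes "state A \<phi>" "x \<in> carrier A" "y \<in> carrier A" shows "\<phi> (x \<ominus> y) = \<phi> x - \<phi> y"
  using stateD(1)[OF assms(1), of x "(- 1) \<odot> y"] stateD(2)[OF assms(1), of y "-1"] assms(2,3)
  by (simp add: M.minus_eq minus_scale)

lemma state_bound:
  assumes \<phi>: "state A \<phi>" and x: "x \<in> carrier A" shows "cmod (\<phi> x) \<le> vnorm A x"
proof (cases "x = \<zero>")
  case True
  have "\<phi> (0 \<odot> \<zero>) = 0 * \<phi> \<zero>" by (rule stateD(2)[OF \<phi>]) simp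
  then show ?thesis using True by simp
next
  case False
  define r where "r = vnorm A x"
  have r: "r > 0" using False x vnorm_nonneg[OF x] vnorm_eq_zero[OF x] by (simp add: r_def)
  define u where "u = complex_of_real (1 / r) \<odot> x"
  have u: "u \<in> unit_ball A"
    using x r by (simp add: u_def vnorm_scale del: of_real_divide) (simp add: r_def)
  have "cmod (\<phi> u) \<le> (SUP x\<in>unit_ball A. cmod (\<phi> x))"
    using \<phi> by (intro cSUP_upper[OF u]) (auto simp: state_def)
  then have "cmod (\<phi> u) \<le> 1" using \<phi> by (simp add: state_def)
  moreover have "cmod (\<phi> u) = (1 / r) * cmod (\<phi> x)"
    using stateD(2)[OF \<phi> x] r by (simp add: u_def Real_Vector_Spaces.norm_mult del: of_real_divide)
  ultimately show ?thesis using r by (simp add: field_simps r_def)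
qed

lemma tends_to_state:
  assumes \<phi>: "state A \<phi>" and X: "tends_to A X x" shows "(\<lambda>n. \<phi> (X n)) \<longlonglongrightarrow> \<phi> x"
proof (rule LIM_zero_cancel, rule Lim_null_comparison)
  have c: "X n \<in> carrier A" "x \<in> carrier A" for n using X by (auto simp: tends_to_def)
  show "\<forall>\<^sub>F n in sequentially. norm (\<phi> (X n) - \<phi> x) \<le> vnorm A (X n \<ominus> x)"
    using state_bound[OF \<phi>, of "X _ \<ominus> x"] c by (simp add: state_diff[OF \<phi>])
  show "(\<lambda>n. vnorm A (X n \<ominus> x)) \<longlonglongrightarrow> 0" using X by (simp add: tends_to_def)
qed

lemma state_seminorm_contraction:
  assumes \<phi>: "state A \<phi>" and T: "linear_map A T" and pd: "positive_definite_map A T"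
    and ct: "contractive A T" and sub: "subinvariant A \<phi> T" and a: "a \<in> carrier A"
  shows "seminorm (gns_form A \<phi>) (T a) \<le> seminorm (gns_form A \<phi>) a"
proof -
  note Tc = linear_mapD(1)[OF T]
  have "\<exists>e. e \<in> carrier A \<and> star A e = e \<and> vnorm A e \<le> 1 \<and> vnorm A (a \<ominus> e \<otimes> a) < 1 / real (Suc n)" for n
    using left_approximate_unit[OF a, of "1 / real (Suc n)"] by (metis of_nat_0_less_iff zero_less_Suc zero_less_divide_1_iff)
  then obtain e where e: "\<And>n. e n \<in> carrier A" "\<And>n. star A (e n) = e n" "\<And>n. vnorm A (e n) \<le> 1"
      "\<And>n. vnorm A (a \<ominus> e n \<otimes> a) < 1 / real (Suc n)" by metis
  have "tends_to A (\<lambda>n. T (e n \<otimes> a)) (T a)"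
  proof (rule tends_to_squeeze)
    show "range (\<lambda>n. T (e n \<otimes> a)) \<subseteq> carrier A" "T a \<in> carrier A" using e a Tc by auto
    show "(\<lambda>n. 1 / real (Suc n)) \<longlonglongrightarrow> 0" using LIMSEQ_inverse_real_of_nat by (simp add: inverse_eq_divide)
    fix n
    have "T (e n \<otimes> a) \<ominus> T a = T (e n \<otimes> a \<oplus> (- 1) \<odot> a)"
      using linear_mapD[OF T] e a by (simp add: M.minus_eq minus_scale)
    also have "e n \<otimes> a \<oplus> (- 1) \<odot> a = e n \<otimes> a \<ominus> a" using e a by (simp add: M.minus_eq minus_scale)
    finally have "vnorm A (T (e n \<otimes> a) \<ominus> T a) \<le> vnorm A (e n \<otimes> a \<ominus> a)"
      using ct e a by (simp add: contractive_def)
    also have "\<dots> \<le> 1 / real (Suc n)"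
      using less_imp_le[OF e(4)[of n]] vnorm_minus_commute[of "e n \<otimes> a" a] e a by simp
    finally show "vnorm A (T (e n \<otimes> a) \<ominus> T a) \<le> 1 / real (Suc n)" .
  qed
  then have "(\<lambda>n. \<phi> (star A (T (e n \<otimes> a)) \<otimes> T (e n \<otimes> a))) \<longlonglongrightarrow> \<phi> (star A (T a) \<otimes> T a)"
    by (intro tends_to_state[OF \<phi>] tends_to_mult tends_to_star)
  then have lim: "(\<lambda>n. Re (\<phi> (star A (T (e n \<otimes> a)) \<otimes> T (e n \<otimes> a)))) \<longlonglongrightarrow> Re (\<phi> (star A (T a) \<otimes> T a))"
    by (rule tendsto_Re)
  have "Re (\<phi> (star A (T (e n \<otimes> a)) \<otimes> T (e n \<otimes> a))) \<le> Re (\<phi> (T (star A a \<otimes> a)))" for n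
  proof -
    have "0 \<le> \<phi> (T (star A a \<otimes> a) \<ominus> star A (T (e n \<otimes> a)) \<otimes> T (e n \<otimes> a))"
      using stateD(3)[OF \<phi> kadison_schwarz_compressed[OF T pd ct a e(1,3)]] by (simp add: e(2))
    then show ?thesis using e a Tc by (simp add: state_diff[OF \<phi>] less_eq_complex_def)
  qed
  then have "Re (\<phi> (star A (T a) \<otimes> T a)) \<le> Re (\<phi> (T (star A a \<otimes> a)))"
    using LIMSEQ_le_const2[OF lim] by blast
  also have "\<dots> \<le> Re (\<phi> (star A a \<otimes> a))"
    using sub positive_star_mult[OF a] by (auto simp: subinvariant_def less_eq_complex_def)
  finally show ?thesis by (simp add: seminorm_def gns_form_def)
qed

end

section \<open>The completion of a semi-inner product\<close>

text \<open>
  The norm of \<open>V\<close> plays no role here; only the seminorm \<open>p\<close> of the form \<open>s\<close> is completed.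
\<close>

locale semi_inner_product = complex_normed_space V
  for V :: "('v, 'm) normed_space_scheme" (structure) +
  fixes s :: "'v \<Rightarrow> 'v \<Rightarrow> complex"
  assumes form_add: "\<lbrakk>x \<in> carrier V; y \<in> carrier V; z \<in> carrier V\<rbrakk> \<Longrightarrow> s x (y \<oplus> z) = s x y + s x z"
    and form_scale: "\<lbrakk>x \<in> carrier V; y \<in> carrier V\<rbrakk> \<Longrightarrow> s x (c \<odot> y) = c * s x y"
    and form_cnj: "\<lbrakk>x \<in> carrier V; y \<in> carrier V\<rbrakk> \<Longrightarrow> s y x = cnj (s x y)"
    and form_nonneg: "x \<in> carrier V \<Longrightarrow> 0 \<le> Re (s x x)"
begin

abbreviation "p \<equiv> seminorm s"
abbreviation "H \<equiv> hilbert_completion V s"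

lemma form_add_left:
  "\<lbrakk>x \<in> carrier V; y \<in> carrier V; z \<in> carrier V\<rbrakk> \<Longrightarrow> s (x \<oplus> y) z = s x z + s y z"
  using form_cnj[of z "x \<oplus> y"] form_cnj[of z x] form_cnj[of z y] by (simp add: form_add)

lemma form_scale_left:
  "\<lbrakk>x \<in> carrier V; y \<in> carrier V\<rbrakk> \<Longrightarrow> s (c \<odot> x) y = cnj c * s x y"
  using form_cnj[of y "c \<odot> x"] form_cnj[of y x] by (simp add: form_scale)

lemma form_self_real: "x \<in> carrier V \<Longrightarrow> Im (s x x) = 0"
  using form_cnj[of x x] by (simp add: complex_eq_iff)

lemma p_nonneg: "x \<in> carrier V \<Longrightarrow> 0 \<le> p x"
  by (simp add: seminorm_def form_nonneg)

lemma p_square: "x \<in> carrier V \<Longrightarrow> (p x)\<^sup>2 = Re (s x x)"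
  by (simp add: seminorm_def form_nonneg)

lemma form_self: "x \<in> carrier V \<Longrightarrow> s x x = complex_of_real ((p x)\<^sup>2)"
  by (simp add: p_square form_self_real complex_eq_iff)

text \<open>The form is nonnegative at \<open>x - t cnj(s x y) y\<close> for every real \<open>t\<close>.\<close>

lemma form_cauchy_schwarz:
  assumes x: "x \<in> carrier V" and y: "y \<in> carrier V" shows "cmod (s x y) \<le> p x * p y"
proof -
  define a where "a = s x y"
  have q: "0 \<le> (p x)\<^sup>2 - 2 * t * (cmod a)\<^sup>2 + t\<^sup>2 * (cmod a)\<^sup>2 * (p y)\<^sup>2" for t :: real
  proof -
    define c where "c = - complex_of_real t * cnj a"
    have "s (x \<oplus> c \<odot> y) (x \<oplus> c \<odot> y) = s x x + c * a + cnj c * cnj a + cnj c * c * s y y"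
      using x y form_cnj[OF x y] by (simp add: form_add form_add_left form_scale form_scale_left a_def algebra_simps)
    also have "\<dots> = complex_of_real ((p x)\<^sup>2 - 2 * t * (cmod a)\<^sup>2 + t\<^sup>2 * (cmod a)\<^sup>2 * (p y)\<^sup>2)"
    proof -
      have "c * a = - complex_of_real t * (complex_of_real (cmod a))\<^sup>2"
        "cnj c * cnj a = - complex_of_real t * (complex_of_real (cmod a))\<^sup>2"
        "cnj c * c = (complex_of_real t)\<^sup>2 * (complex_of_real (cmod a))\<^sup>2"
        using complex_norm_square[of a] by (simp_all add: c_def power2_eq_square algebra_simps)
      then show ?thesis unfolding form_self[OF x] form_self[OF y] by simp
    qed
    finally show ?thesis
      using form_nonneg[of "x \<oplus> c \<odot> y"] x y by simp
  qed
  show ?thesis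
  proof (cases "p y = 0")
    case True
    have "cmod a = 0"
    proof (rule ccontr)
      assume "cmod a \<noteq> 0"
      then have a: "(cmod a)\<^sup>2 > 0" by simp
      have "2 * (((p x)\<^sup>2 + 1) / (cmod a)\<^sup>2) * (cmod a)\<^sup>2 = 2 * ((p x)\<^sup>2 + 1)" using a by simp
      then show False using q[of "((p x)\<^sup>2 + 1) / (cmod a)\<^sup>2"] True zero_le_power2[of "p x"]
        by (simp del: zero_le_power2)
    qed
    then show ?thesis using p_nonneg[OF x] p_nonneg[OF y] by (simp add: a_def)
  next
    case False
    then have py: "(p y)\<^sup>2 > 0" by simp
    have "0 \<le> (p x)\<^sup>2 - (cmod a)\<^sup>2 / (p y)\<^sup>2"
    proof -
      define P where "P = (p y)\<^sup>2"
      have P: "P > 0" using py by (simp add: P_def)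
      have "(1 / P)\<^sup>2 * (cmod a)\<^sup>2 * P = (cmod a)\<^sup>2 / P"
        using P by (simp add: power2_eq_square)
      then show ?thesis using q[of "1 / P"] by (simp flip: P_def)
    qed
    then have "(cmod a)\<^sup>2 \<le> (p x * p y)\<^sup>2" using py by (simp add: field_simps power_mult_distrib)
    then show ?thesis
      unfolding a_def by (rule power2_le_imp_le) (simp add: p_nonneg x y)
  qed
qed

lemma p_triangle:
  assumes x: "x \<in> carrier V" and y: "y \<in> carrier V" shows "p (x \<oplus> y) \<le> p x + p y"
proof (rule power2_le_imp_le)
  have "(p (x \<oplus> y))\<^sup>2 = Re (s x x) + Re (s y y) + 2 * Re (s x y)"
    using x y form_cnj[OF x y] by (simp add: p_square form_add form_add_left)
  also have "\<dots> \<le> (p x)\<^sup>2 + (p y)\<^sup>2 + 2 * (p x * p y)"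
    using form_cauchy_schwarz[OF x y] complex_Re_le_cmod[of "s x y"] x y by (simp add: p_square)
  finally show "(p (x \<oplus> y))\<^sup>2 \<le> (p x + p y)\<^sup>2" by (simp add: power2_sum)
qed (simp add: p_nonneg x y)

lemma p_scale: "x \<in> carrier V \<Longrightarrow> p (c \<odot> x) = cmod c * p x"
proof -
  assume x: "x \<in> carrier V"
  have "s (c \<odot> x) (c \<odot> x) = complex_of_real ((cmod c)\<^sup>2) * s x x"
    using x by (simp add: form_scale form_scale_left complex_norm_square[of c] del: of_real_power)
  then have "Re (s (c \<odot> x) (c \<odot> x)) = (cmod c)\<^sup>2 * Re (s x x)" by simp
  then show ?thesis by (simp add: seminorm_def real_sqrt_mult)
qed

lemma p_zero [simp]: "p \<zero> = 0"
  using p_scale[of \<zero> 0] by simp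

lemma p_minus_commute: "x \<in> carrier V \<Longrightarrow> y \<in> carrier V \<Longrightarrow> p (x \<ominus> y) = p (y \<ominus> x)"
  using p_scale[of "y \<ominus> x" "-1"] by (simp add: minus_diff flip: minus_scale)

lemma p_diff_triangle:
  "\<lbrakk>x \<in> carrier V; y \<in> carrier V; z \<in> carrier V\<rbrakk> \<Longrightarrow> p (x \<ominus> z) \<le> p (x \<ominus> y) + p (y \<ominus> z)"
  using p_triangle[of "x \<ominus> y" "y \<ominus> z"] by (simp add: diff_trans)

lemma p_le_diff: "x \<in> carrier V \<Longrightarrow> y \<in> carrier V \<Longrightarrow> \<bar>p x - p y\<bar> \<le> p (x \<ominus> y)"
  using p_triangle[of "x \<ominus> y" y] p_triangle[of "y \<ominus> x" x] p_minus_commute[of x y]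
  by (simp add: diff_add_cancel)

abbreviation "CS \<equiv> cauchy_seqs V s"

lemma CS_mem: "X \<in> CS \<Longrightarrow> X n \<in> carrier V"
  by (auto simp: cauchy_seqs_def)

lemma CS_I:
  assumes "\<And>n. X n \<in> carrier V" "\<And>e. 0 < e \<Longrightarrow> \<exists>N. \<forall>m\<ge>N. \<forall>n\<ge>N. p (X m \<ominus> X n) < e"
  shows "X \<in> CS"
  using assms by (auto simp: cauchy_seqs_def)

lemma CS_D: "X \<in> CS \<Longrightarrow> 0 < e \<Longrightarrow> \<exists>N. \<forall>m\<ge>N. \<forall>n\<ge>N. p (X m \<ominus> X n) < e"
  by (auto simp: cauchy_seqs_def)

lemma CS_const: "x \<in> carrier V \<Longrightarrow> (\<lambda>_. x) \<in> CS"
  by (rule CS_I) auto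

text \<open>The set \<open>CS\<close> of Cauchy sequences for \<open>p\<close> is closed under Lipschitz images.\<close>

lemma CS_contraction:
  assumes X: "X \<in> CS" and Y: "\<And>n. Y n \<in> carrier V"
    and le: "\<And>m n. p (Y m \<ominus> Y n) \<le> K * p (X m \<ominus> X n)"
  shows "Y \<in> CS"
proof (rule CS_I[OF Y])
  fix e :: real assume e: "0 < e"
  have K: "\<bar>K\<bar> + 1 > 0" by simp
  obtain N where N: "\<And>m n. m \<ge> N \<Longrightarrow> n \<ge> N \<Longrightarrow> p (X m \<ominus> X n) < e / (\<bar>K\<bar> + 1)"
    using CS_D[OF X divide_pos_pos[OF e K]] by blast
  have "p (Y m \<ominus> Y n) < e" if "m \<ge> N" "n \<ge> N" for m n
  proof -
    have "p (Y m \<ominus> Y n) \<le> (\<bar>K\<bar> + 1) * p (X m \<ominus> X n)"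
    proof -
      have "K \<le> \<bar>K\<bar> + 1" by linarith
      then have "K * p (X m \<ominus> X n) \<le> (\<bar>K\<bar> + 1) * p (X m \<ominus> X n)"
        using CS_mem[OF X] by (intro mult_right_mono p_nonneg) auto
      then show ?thesis using le[of m n] by simp
    qed
    also have "\<dots> < e" using N[OF that] K by (simp add: field_simps)
    finally show ?thesis .
  qed
  then show "\<exists>N. \<forall>m\<ge>N. \<forall>n\<ge>N. p (Y m \<ominus> Y n) < e" by blast
qed

lemma CS_scale: "X \<in> CS \<Longrightarrow> (\<lambda>n. c \<odot> X n) \<in> CS"
  by (rule CS_contraction[of X _ "cmod c"]) (auto simp: CS_mem p_scale simp flip: scale_diff_right)

lemma CS_add:
  assumes X: "X \<in> CS" and Y: "Y \<in> CS" shows "(\<lambda>n. X n \<oplus> Y n) \<in> CS"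
proof (rule CS_I)
  fix e :: real assume "0 < e"
  then have e2: "0 < e / 2" by simp
  obtain N where N: "\<And>m n. m \<ge> N \<Longrightarrow> n \<ge> N \<Longrightarrow> p (X m \<ominus> X n) < e / 2"
    using CS_D[OF X e2] by blast
  obtain M where M: "\<And>m n. m \<ge> M \<Longrightarrow> n \<ge> M \<Longrightarrow> p (Y m \<ominus> Y n) < e / 2"
    using CS_D[OF Y e2] by blast
  have "p (X m \<oplus> Y m \<ominus> (X n \<oplus> Y n)) < e" if "m \<ge> max N M" "n \<ge> max N M" for m n
    using N[of m n] M[of m n] that CS_mem[OF X] CS_mem[OF Y]
      p_triangle[of "X m \<ominus> X n" "Y m \<ominus> Y n"] by (simp add: add_diff_add)
  then show "\<exists>N. \<forall>m\<ge>N. \<forall>n\<ge>N. p (X m \<oplus> Y m \<ominus> (X n \<oplus> Y n)) < e" by blast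
qed (use CS_mem[OF X] CS_mem[OF Y] in simp)

lemma p_convergent: "X \<in> CS \<Longrightarrow> convergent (\<lambda>n. p (X n))"
proof -
  assume X: "X \<in> CS"
  have "Cauchy (\<lambda>n. p (X n))"
  proof (rule CauchyI)
    fix e :: real assume "0 < e"
    then obtain N where "\<And>m n. m \<ge> N \<Longrightarrow> n \<ge> N \<Longrightarrow> p (X m \<ominus> X n) < e"
      using CS_D[OF X] by blast
    then show "\<exists>M. \<forall>m\<ge>M. \<forall>n\<ge>M. norm (p (X m) - p (X n)) < e"
      using p_le_diff CS_mem[OF X] unfolding real_norm_def by (meson le_less_trans)
  qed
  then show ?thesis by (rule Cauchy_convergent)
qed

lemma null_rel_iff:
  "(X, Y) \<in> null_rel V s \<longleftrightarrow> X \<in> CS \<and> Y \<in> CS \<and> (\<lambda>n. p (X n \<ominus> Y n)) \<longlonglongrightarrow> 0"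
  by (simp add: null_rel_def)

lemma null_rel_squeeze:
  assumes "X \<in> CS" "Y \<in> CS" "\<And>n. p (X n \<ominus> Y n) \<le> f n" "f \<longlonglongrightarrow> 0"
  shows "(X, Y) \<in> null_rel V s"
proof -
  have "(\<lambda>n. p (X n \<ominus> Y n)) \<longlonglongrightarrow> 0"
    by (rule Lim_null_comparison[OF _ assms(4)]) (use assms(1-3) in \<open>simp add: p_nonneg CS_mem\<close>)
  then show ?thesis using assms by (simp add: null_rel_iff)
qed

lemma null_rel_sym: "(X, Y) \<in> null_rel V s \<Longrightarrow> (Y, X) \<in> null_rel V s"
  using p_minus_commute by (auto simp: null_rel_iff CS_mem)

lemma null_rel_trans:
  assumes "(X, Y) \<in> null_rel V s" "(Y, Z) \<in> null_rel V s" shows "(X, Z) \<in> null_rel V s"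
proof (rule null_rel_squeeze)
  show "(\<lambda>n. p (X n \<ominus> Y n) + p (Y n \<ominus> Z n)) \<longlonglongrightarrow> 0"
    using assms by (intro tendsto_eq_intros) (auto simp: null_rel_iff)
qed (use assms in \<open>auto simp: null_rel_iff CS_mem intro!: p_diff_triangle\<close>)

lemma null_rel_refl: "X \<in> CS \<Longrightarrow> (X, X) \<in> null_rel V s"
  by (simp add: null_rel_iff CS_mem)

lemma null_rel_equiv: "equiv CS (null_rel V s)"
proof (rule equivI)
  show "refl_on CS (null_rel V s)" using null_rel_refl by (auto simp: refl_on_def null_rel_iff)
  show "sym (null_rel V s)" by (rule symI) (rule null_rel_sym)
  show "trans (null_rel V s)" by (rule transI) (rule null_rel_trans)
qed (auto simp: null_rel_iff)

lemma seq_class_eq_iff: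
  "X \<in> CS \<Longrightarrow> Y \<in> CS \<Longrightarrow> seq_class V s X = seq_class V s Y \<longleftrightarrow> (X, Y) \<in> null_rel V s"
  unfolding seq_class_def using eq_equiv_class_iff[OF null_rel_equiv] by blast

lemma H_carrier: "carrier H = seq_class V s ` CS"
  by (auto simp: hilbert_completion_def quotient_def seq_class_def)

lemma seq_class_closed [simp]: "X \<in> CS \<Longrightarrow> seq_class V s X \<in> carrier H"
  by (simp add: H_carrier)

lemma class_rep_related:
  assumes "X \<in> CS" shows "(class_rep (seq_class V s X), X) \<in> null_rel V s"
proof -
  have "X \<in> seq_class V s X" using null_rel_refl[OF assms] by (simp add: seq_class_def)
  then have "class_rep (seq_class V s X) \<in> seq_class V s X" 
    by (rule someI[of "\<lambda>Y. Y \<in> seq_class V s X"])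
  then show ?thesis using null_rel_sym by (simp add: seq_class_def)
qed

lemma H_add:
  assumes X: "X \<in> CS" and Y: "Y \<in> CS"
  shows "seq_class V s X \<oplus>\<^bsub>H\<^esub> seq_class V s Y = seq_class V s (\<lambda>n. X n \<oplus> Y n)"
proof -
  let ?X = "class_rep (seq_class V s X)" and ?Y = "class_rep (seq_class V s Y)"
  have r: "(?X, X) \<in> null_rel V s" "(?Y, Y) \<in> null_rel V s"
    by (rule class_rep_related[OF X]) (rule class_rep_related[OF Y])
  then have c: "?X \<in> CS" "?Y \<in> CS" by (auto simp: null_rel_iff)
  have "((\<lambda>n. ?X n \<oplus> ?Y n), (\<lambda>n. X n \<oplus> Y n)) \<in> null_rel V s"
  proof (rule null_rel_squeeze)
    show "(\<lambda>n. p (?X n \<ominus> X n) + p (?Y n \<ominus> Y n)) \<longlonglongrightarrow> 0"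
      using r by (intro tendsto_eq_intros) (auto simp: null_rel_iff)
    show "p (?X n \<oplus> ?Y n \<ominus> (X n \<oplus> Y n)) \<le> p (?X n \<ominus> X n) + p (?Y n \<ominus> Y n)" for n
      using CS_mem[OF X] CS_mem[OF Y] CS_mem[OF c(1)] CS_mem[OF c(2)]
      by (simp add: add_diff_add p_triangle)
  qed (use CS_add X Y c in auto)
  then have "seq_class V s (\<lambda>n. ?X n \<oplus> ?Y n) = seq_class V s (\<lambda>n. X n \<oplus> Y n)"
    using seq_class_eq_iff[OF CS_add[OF c] CS_add[OF X Y]] by simp
  then show ?thesis by (simp add: hilbert_completion_def)
qed

lemma H_scale:
  assumes X: "X \<in> CS" shows "c \<odot>\<^bsub>H\<^esub> seq_class V s X = seq_class V s (\<lambda>n. c \<odot> X n)"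
proof -
  let ?X = "class_rep (seq_class V s X)"
  have r: "(?X, X) \<in> null_rel V s" by (rule class_rep_related[OF X])
  then have cX: "?X \<in> CS" by (auto simp: null_rel_iff)
  have "((\<lambda>n. c \<odot> ?X n), (\<lambda>n. c \<odot> X n)) \<in> null_rel V s"
  proof (rule null_rel_squeeze)
    show "(\<lambda>n. cmod c * p (?X n \<ominus> X n)) \<longlonglongrightarrow> 0"
      using r by (intro tendsto_mult_right_zero) (auto simp: null_rel_iff)
    show "p (c \<odot> ?X n \<ominus> c \<odot> X n) \<le> cmod c * p (?X n \<ominus> X n)" for n
      using CS_mem[OF X] CS_mem[OF cX] by (simp add: p_scale flip: scale_diff_right)
  qed (use CS_scale X cX in auto)
  then have "seq_class V s (\<lambda>n. c \<odot> ?X n) = seq_class V s (\<lambda>n. c \<odot> X n)"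
    using seq_class_eq_iff[OF CS_scale[OF cX] CS_scale[OF X]] by simp
  then show ?thesis by (simp add: hilbert_completion_def)
qed

lemma H_zero: "\<zero>\<^bsub>H\<^esub> = seq_class V s (\<lambda>_. \<zero>)"
  by (simp add: hilbert_completion_def)

lemma H_norm:
  assumes X: "X \<in> CS" shows "(\<lambda>n. p (X n)) \<longlonglongrightarrow> vnorm H (seq_class V s X)"
proof -
  let ?X = "class_rep (seq_class V s X)"
  have r: "(?X, X) \<in> null_rel V s" by (rule class_rep_related[OF X])
  then have c: "?X \<in> CS" by (auto simp: null_rel_iff)
  obtain L where L: "(\<lambda>n. p (X n)) \<longlonglongrightarrow> L" using p_convergent[OF X] by (auto simp: convergent_def)
  have L0: "0 \<le> L" using L CS_mem[OF X] p_nonneg by (intro LIMSEQ_le_const[OF L]) auto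
  have "(\<lambda>n. p (?X n) - p (X n)) \<longlonglongrightarrow> 0"
  proof (rule Lim_null_comparison)
    show "(\<lambda>n. p (?X n \<ominus> X n)) \<longlonglongrightarrow> 0" using r by (simp add: null_rel_iff)
    show "\<forall>\<^sub>F n in sequentially. norm (p (?X n) - p (X n)) \<le> p (?X n \<ominus> X n)"
      using p_le_diff CS_mem[OF X] CS_mem[OF c] by simp
  qed
  from tendsto_add[OF this L] have "(\<lambda>n. p (?X n)) \<longlonglongrightarrow> L" by simp
  then have "(\<lambda>n. complex_of_real ((p (?X n))\<^sup>2)) \<longlonglongrightarrow> complex_of_real (L\<^sup>2)"
    by (intro tendsto_of_real tendsto_power)
  then have "(\<lambda>n. s (?X n) (?X n)) \<longlonglongrightarrow> complex_of_real (L\<^sup>2)"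
    using form_self CS_mem[OF c] by simp
  then have "completion_inner s (seq_class V s X) (seq_class V s X) = complex_of_real (L\<^sup>2)"
    unfolding completion_inner_def by (rule limI)
  then have "vnorm H (seq_class V s X) = L" using L0 by (simp add: hilbert_completion_def)
  then show ?thesis using L by simp
qed

lemma H_normed: "complex_normed_space H"
proof -
  have zc: "(\<lambda>_. \<zero>) \<in> CS" by (rule CS_const) simp
  have ab: "abelian_group H"
  proof (rule abelian_groupI)
    fix \<xi> assume "\<xi> \<in> carrier H"
    then obtain X where X: "X \<in> CS" "\<xi> = seq_class V s X" by (auto simp: H_carrier)
    show "\<zero>\<^bsub>H\<^esub> \<oplus>\<^bsub>H\<^esub> \<xi> = \<xi>" using X zc by (simp add: H_zero H_add CS_mem)
    have "(\<lambda>n. (- 1) \<odot> X n) \<in> CS" by (rule CS_scale[OF X(1)])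
    moreover from this have "seq_class V s (\<lambda>n. (- 1) \<odot> X n) \<oplus>\<^bsub>H\<^esub> \<xi> = \<zero>\<^bsub>H\<^esub>"
      using X by (simp add: H_zero H_add CS_mem M.l_neg flip: minus_scale)
    ultimately show "\<exists>\<eta>\<in>carrier H. \<eta> \<oplus>\<^bsub>H\<^esub> \<xi> = \<zero>\<^bsub>H\<^esub>" using seq_class_closed by blast
    fix \<eta> assume "\<eta> \<in> carrier H"
    then obtain Y where Y: "Y \<in> CS" "\<eta> = seq_class V s Y" by (auto simp: H_carrier)
    show "\<xi> \<oplus>\<^bsub>H\<^esub> \<eta> \<in> carrier H" using X Y by (simp add: H_add CS_add)
    show "\<xi> \<oplus>\<^bsub>H\<^esub> \<eta> = \<eta> \<oplus>\<^bsub>H\<^esub> \<xi>" using X Y by (simp add: H_add CS_mem M.a_comm)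
    fix \<zeta> assume "\<zeta> \<in> carrier H"
    then obtain Z where Z: "Z \<in> CS" "\<zeta> = seq_class V s Z" by (auto simp: H_carrier)
    show "\<xi> \<oplus>\<^bsub>H\<^esub> \<eta> \<oplus>\<^bsub>H\<^esub> \<zeta> = \<xi> \<oplus>\<^bsub>H\<^esub> (\<eta> \<oplus>\<^bsub>H\<^esub> \<zeta>)"
      using X Y Z by (simp add: H_add CS_add CS_mem M.a_assoc)
  qed (use zc in \<open>simp add: H_zero\<close>)
  have md: "Module.module complex_ring H"
  proof (rule Module.moduleI[OF is_cring ab])
    fix a b \<xi> assume "\<xi> \<in> carrier H"
    then obtain X where X: "X \<in> CS" "\<xi> = seq_class V s X" by (auto simp: H_carrier)
    show "a \<odot>\<^bsub>H\<^esub> \<xi> \<in> carrier H" using X by (simp add: H_scale CS_scale)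
    show "(a \<oplus>\<^bsub>complex_ring\<^esub> b) \<odot>\<^bsub>H\<^esub> \<xi> = a \<odot>\<^bsub>H\<^esub> \<xi> \<oplus>\<^bsub>H\<^esub> b \<odot>\<^bsub>H\<^esub> \<xi>"
      "(a \<otimes>\<^bsub>complex_ring\<^esub> b) \<odot>\<^bsub>H\<^esub> \<xi> = a \<odot>\<^bsub>H\<^esub> (b \<odot>\<^bsub>H\<^esub> \<xi>)"
      "\<one>\<^bsub>complex_ring\<^esub> \<odot>\<^bsub>H\<^esub> \<xi> = \<xi>"
      using X by (simp_all add: H_scale H_add CS_scale CS_mem complex_ring_def scale_add_left scale_scale)
    fix \<eta> assume "\<eta> \<in> carrier H"
    then obtain Y where Y: "Y \<in> CS" "\<eta> = seq_class V s Y" by (auto simp: H_carrier)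
    show "a \<odot>\<^bsub>H\<^esub> (\<xi> \<oplus>\<^bsub>H\<^esub> \<eta>) = a \<odot>\<^bsub>H\<^esub> \<xi> \<oplus>\<^bsub>H\<^esub> a \<odot>\<^bsub>H\<^esub> \<eta>"
      using X Y by (simp add: H_scale H_add CS_scale CS_add CS_mem scale_add_right)
  qed
  show ?thesis
  proof (intro complex_normed_space.intro complex_normed_space_axioms.intro md)
    fix \<xi> assume "\<xi> \<in> carrier H"
    then obtain X where X: "X \<in> CS" "\<xi> = seq_class V s X" by (auto simp: H_carrier)
    note NX = H_norm[OF X(1), folded X(2)]
    show "0 \<le> vnorm H \<xi>" by (rule LIMSEQ_le_const[OF NX]) (use CS_mem[OF X(1)] p_nonneg in auto)
    show "vnorm H \<xi> = 0 \<longleftrightarrow> \<xi> = \<zero>\<^bsub>H\<^esub>"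
    proof
      assume "vnorm H \<xi> = 0"
      then have "(X, \<lambda>_. \<zero>) \<in> null_rel V s"
        using NX X zc CS_mem[OF X(1)] by (simp add: null_rel_iff M.minus_eq minus_scale)
      then show "\<xi> = \<zero>\<^bsub>H\<^esub>" using X zc seq_class_eq_iff by (simp add: H_zero)
    next
      assume "\<xi> = \<zero>\<^bsub>H\<^esub>"
      then show "vnorm H \<xi> = 0" using LIMSEQ_unique[OF H_norm[OF zc]] by (simp add: H_zero)
    qed
    have "(\<lambda>n. p (c \<odot> X n)) \<longlonglongrightarrow> cmod c * vnorm H \<xi>" for c
      using tendsto_mult_left[OF NX, of "cmod c"] CS_mem[OF X(1)] by (simp add: p_scale)
    then show "vnorm H (c \<odot>\<^bsub>H\<^esub> \<xi>) = cmod c * vnorm H \<xi>" for c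
      using LIMSEQ_unique[OF H_norm[OF CS_scale[OF X(1)]]] X by (simp add: H_scale)
    fix \<eta> assume "\<eta> \<in> carrier H"
    then obtain Y where Y: "Y \<in> CS" "\<eta> = seq_class V s Y" by (auto simp: H_carrier)
    have "(\<lambda>n. p (X n \<oplus> Y n)) \<longlonglongrightarrow> vnorm H (\<xi> \<oplus>\<^bsub>H\<^esub> \<eta>)"
      using H_norm[OF CS_add[OF X(1) Y(1)]] X Y by (simp add: H_add)
    moreover have "(\<lambda>n. p (X n) + p (Y n)) \<longlonglongrightarrow> vnorm H \<xi> + vnorm H \<eta>"
      using tendsto_add[OF H_norm[OF X(1)] H_norm[OF Y(1)]] X Y by simp
    ultimately show "vnorm H (\<xi> \<oplus>\<^bsub>H\<^esub> \<eta>) \<le> vnorm H \<xi> + vnorm H \<eta>"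
      by (rule LIMSEQ_le) (use CS_mem[OF X(1)] CS_mem[OF Y(1)] p_triangle in auto)
  qed
qed

sublocale H: complex_normed_space H
  by (rule H_normed)

lemma embed_closed [simp]: "x \<in> carrier V \<Longrightarrow> embed V s x \<in> carrier H"
  by (simp add: embed_def CS_const)

lemma H_diff:
  assumes X: "X \<in> CS" and Y: "Y \<in> CS"
  shows "seq_class V s X \<ominus>\<^bsub>H\<^esub> seq_class V s Y = seq_class V s (\<lambda>n. X n \<ominus> Y n)"
proof -
  have "seq_class V s X \<oplus>\<^bsub>H\<^esub> (- 1) \<odot>\<^bsub>H\<^esub> seq_class V s Y = seq_class V s (\<lambda>n. X n \<oplus> (- 1) \<odot> Y n)"
    using X Y by (simp add: H_scale H_add CS_scale)
  then show ?thesis using X Y by (simp add: a_minus_def H.minus_scale minus_scale CS_mem)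
qed

lemma CS_diff: "X \<in> CS \<Longrightarrow> Y \<in> CS \<Longrightarrow> (\<lambda>n. X n \<ominus> Y n) \<in> CS"
  using CS_add[OF _ CS_scale[of Y "-1"], of X] by (simp add: M.minus_eq minus_scale CS_mem)

lemma embed_norm: "x \<in> carrier V \<Longrightarrow> vnorm H (embed V s x) = p x"
  using LIMSEQ_unique[OF H_norm[OF CS_const[of x]] tendsto_const] by (simp add: embed_def)

lemma embed_diff:
  "x \<in> carrier V \<Longrightarrow> y \<in> carrier V \<Longrightarrow> embed V s x \<ominus>\<^bsub>H\<^esub> embed V s y = embed V s (x \<ominus> y)"
  by (simp add: embed_def H_diff CS_const)

lemma embed_dense:
  assumes "\<xi> \<in> carrier H" "0 < e"
  obtains x where "x \<in> carrier V" "vnorm H (\<xi> \<ominus>\<^bsub>H\<^esub> embed V s x) < e"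
proof -
  obtain X where X: "X \<in> CS" "\<xi> = seq_class V s X" using assms by (auto simp: H_carrier)
  have "0 < e / 2" using assms by simp
  then obtain N where N: "\<And>m n. m \<ge> N \<Longrightarrow> n \<ge> N \<Longrightarrow> p (X m \<ominus> X n) < e / 2"
    using CS_D[OF X(1)] by blast
  have XN: "X N \<in> carrier V" by (rule CS_mem[OF X(1)])
  have "(\<lambda>n. p (X n \<ominus> X N)) \<longlonglongrightarrow> vnorm H (\<xi> \<ominus>\<^bsub>H\<^esub> embed V s (X N))"
    using H_norm[OF CS_diff[OF X(1) CS_const[OF XN]]] X XN by (simp add: embed_def H_diff CS_const)
  then have "vnorm H (\<xi> \<ominus>\<^bsub>H\<^esub> embed V s (X N)) \<le> e / 2"
    by (rule LIMSEQ_le_const2) (use N in \<open>auto intro!: exI[of _ N] less_imp_le\<close>)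
  then show ?thesis using that[OF XN] assms(2) by simp
qed

end

section \<open>Operators on the completion\<close>

text \<open>A linear map that contracts the seminorm of the form.\<close>

locale seminorm_contraction = semi_inner_product +
  fixes T :: "'a \<Rightarrow> 'a"
  assumes lin: "linear_map V T" and contr: "x \<in> carrier V \<Longrightarrow> p (T x) \<le> p x"
begin

lemma T_closed [simp]: "x \<in> carrier V \<Longrightarrow> T x \<in> carrier V"
  and T_add: "x \<in> carrier V \<Longrightarrow> y \<in> carrier V \<Longrightarrow> T (x \<oplus> y) = T x \<oplus> T y"
  and T_scale: "x \<in> carrier V \<Longrightarrow> T (c \<odot> x) = c \<odot> T x"
  using lin by (auto simp: linear_map_def)

lemma T_diff: "x \<in> carrier V \<Longrightarrow> y \<in> carrier V \<Longrightarrow> T (x \<ominus> y) = T x \<ominus> T y"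
  by (simp add: M.minus_eq minus_scale T_add T_scale)

lemma T_CS: "X \<in> CS \<Longrightarrow> (\<lambda>n. T (X n)) \<in> CS"
  by (rule CS_contraction[of X _ 1]) (auto simp: CS_mem contr simp flip: T_diff)

text \<open>The continuous extension to the completion, applied termwise to a representing sequence.\<close>

definition extension :: "(nat \<Rightarrow> 'a) set \<Rightarrow> (nat \<Rightarrow> 'a) set" where
  "extension = (\<lambda>\<xi>\<in>carrier H. seq_class V s (\<lambda>n. T (class_rep \<xi> n)))"

lemma extension_seq_class:
  assumes X: "X \<in> CS" shows "extension (seq_class V s X) = seq_class V s (\<lambda>n. T (X n))"
proof -
  let ?X = "class_rep (seq_class V s X)"
  have r: "(?X, X) \<in> null_rel V s" by (rule class_rep_related[OF X])
  then have c: "?X \<in> CS" by (auto simp: null_rel_iff)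
  have "((\<lambda>n. T (?X n)), (\<lambda>n. T (X n))) \<in> null_rel V s"
  proof (rule null_rel_squeeze)
    show "(\<lambda>n. p (?X n \<ominus> X n)) \<longlonglongrightarrow> 0" using r by (auto simp: null_rel_iff)
    show "p (T (?X n) \<ominus> T (X n)) \<le> p (?X n \<ominus> X n)" for n
      using CS_mem[OF X] CS_mem[OF c] by (simp add: contr flip: T_diff)
  qed (use T_CS X c in auto)
  then show ?thesis
    using seq_class_eq_iff[OF T_CS[OF c] T_CS[OF X]] X by (simp add: extension_def)
qed

lemma extension_linear: "linear_map H extension"
  unfolding linear_map_def
proof (intro conjI ballI allI funcsetI)
  fix \<xi> c assume "\<xi> \<in> carrier H"
  then obtain X where X: "X \<in> CS" "\<xi> = seq_class V s X" by (auto simp: H_carrier)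
  show "extension \<xi> \<in> carrier H" using X T_CS by (simp add: extension_seq_class)
  show "extension (c \<odot>\<^bsub>H\<^esub> \<xi>) = c \<odot>\<^bsub>H\<^esub> extension \<xi>"
    using X T_CS CS_mem[OF X(1)] by (simp add: H_scale CS_scale extension_seq_class T_scale)
  fix \<eta> assume "\<eta> \<in> carrier H"
  then obtain Y where Y: "Y \<in> CS" "\<eta> = seq_class V s Y" by (auto simp: H_carrier)
  show "extension (\<xi> \<oplus>\<^bsub>H\<^esub> \<eta>) = extension \<xi> \<oplus>\<^bsub>H\<^esub> extension \<eta>"
    using X Y T_CS CS_mem[OF X(1)] CS_mem[OF Y(1)] by (simp add: H_add CS_add extension_seq_class T_add)
qed

lemma extension_contraction:
  assumes "\<xi> \<in> carrier H" shows "vnorm H (extension \<xi>) \<le> vnorm H \<xi>"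
proof -
  obtain X where X: "X \<in> CS" "\<xi> = seq_class V s X" using assms by (auto simp: H_carrier)
  have "vnorm H (extension \<xi>) \<le> vnorm H (seq_class V s X)"
    unfolding X(2) extension_seq_class[OF X(1)]
    by (rule LIMSEQ_le[OF H_norm[OF T_CS[OF X(1)]] H_norm[OF X(1)]]) (use CS_mem[OF X(1)] contr in auto)
  then show ?thesis by (simp add: X(2))
qed

lemma extension_embed: "x \<in> carrier V \<Longrightarrow> extension (embed V s x) = embed V s (T x)"
  by (simp add: embed_def extension_seq_class CS_const)

lemma bounded_linear_agree:
  assumes S: "bounded_linear_map H S" and R: "bounded_linear_map H R"
    and eq: "\<And>x. x \<in> carrier V \<Longrightarrow> S (embed V s x) = R (embed V s x)" and \<xi>: "\<xi> \<in> carrier H"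
  shows "S \<xi> = R \<xi>"
proof -
  have diff: "U (\<xi> \<ominus>\<^bsub>H\<^esub> \<eta>) = U \<xi> \<ominus>\<^bsub>H\<^esub> U \<eta>" if "linear_map H U" "\<xi> \<in> carrier H" "\<eta> \<in> carrier H" for U \<xi> \<eta>
  proof -
    have "U (\<xi> \<oplus>\<^bsub>H\<^esub> (- 1) \<odot>\<^bsub>H\<^esub> \<eta>) = U \<xi> \<oplus>\<^bsub>H\<^esub> (- 1) \<odot>\<^bsub>H\<^esub> U \<eta>"
      using that by (simp add: linear_map_def)
    then show ?thesis using that by (simp add: linear_map_def Pi_def a_minus_def H.minus_scale)
  qed
  obtain K where K: "\<And>\<eta>. \<eta> \<in> carrier H \<Longrightarrow> vnorm H (S \<eta>) \<le> K * vnorm H \<eta>"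
    using S by (auto simp: bounded_linear_map_def)
  obtain M where M: "\<And>\<eta>. \<eta> \<in> carrier H \<Longrightarrow> vnorm H (R \<eta>) \<le> M * vnorm H \<eta>"
    using R by (auto simp: bounded_linear_map_def)
  have lS: "linear_map H S" and lR: "linear_map H R" using S R by (auto simp: bounded_linear_map_def)
  have cl: "S \<eta> \<in> carrier H" "R \<eta> \<in> carrier H" if "\<eta> \<in> carrier H" for \<eta>
    using lS lR that by (auto simp: linear_map_def)
  have "vnorm H (S \<xi> \<ominus>\<^bsub>H\<^esub> R \<xi>) \<le> e" if e: "0 < e" for e
  proof -
    define d where "d = e / (\<bar>K\<bar> + \<bar>M\<bar> + 1)"
    have KM: "\<bar>K\<bar> + \<bar>M\<bar> + 1 > 0" by linarith
    have d: "0 < d" using e KM by (simp add: d_def)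
    obtain x where x: "x \<in> carrier V" "vnorm H (\<xi> \<ominus>\<^bsub>H\<^esub> embed V s x) < d"
      using embed_dense[OF \<xi> d] .
    let ?x = "embed V s x"
    have xc: "?x \<in> carrier H" "\<xi> \<ominus>\<^bsub>H\<^esub> ?x \<in> carrier H" using x \<xi> by auto
    have "S \<xi> \<ominus>\<^bsub>H\<^esub> R \<xi> = (S \<xi> \<ominus>\<^bsub>H\<^esub> S ?x) \<oplus>\<^bsub>H\<^esub> (R ?x \<ominus>\<^bsub>H\<^esub> R \<xi>)"
      using cl xc \<xi> eq[OF x(1)] H.diff_trans[of "S \<xi>" "R ?x" "R \<xi>"] by simp
    then have "vnorm H (S \<xi> \<ominus>\<^bsub>H\<^esub> R \<xi>) \<le> vnorm H (S \<xi> \<ominus>\<^bsub>H\<^esub> S ?x) + vnorm H (R ?x \<ominus>\<^bsub>H\<^esub> R \<xi>)"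
      using cl xc \<xi> by (simp add: H.vnorm_triangle)
    also have "\<dots> = vnorm H (S (\<xi> \<ominus>\<^bsub>H\<^esub> ?x)) + vnorm H (R (\<xi> \<ominus>\<^bsub>H\<^esub> ?x))"
      using diff[OF lS \<xi> xc(1)] diff[OF lR \<xi> xc(1)] H.vnorm_minus_commute[of "R ?x" "R \<xi>"] cl xc \<xi> by simp
    also have "\<dots> \<le> \<bar>K\<bar> * vnorm H (\<xi> \<ominus>\<^bsub>H\<^esub> ?x) + \<bar>M\<bar> * vnorm H (\<xi> \<ominus>\<^bsub>H\<^esub> ?x)"
      using K[OF xc(2)] M[OF xc(2)] H.vnorm_nonneg[OF xc(2)]
        mult_right_mono[of K "\<bar>K\<bar>" "vnorm H (\<xi> \<ominus>\<^bsub>H\<^esub> ?x)"] mult_right_mono[of M "\<bar>M\<bar>" "vnorm H (\<xi> \<ominus>\<^bsub>H\<^esub> ?x)"]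
      by linarith
    also have "\<dots> \<le> (\<bar>K\<bar> + \<bar>M\<bar> + 1) * vnorm H (\<xi> \<ominus>\<^bsub>H\<^esub> ?x)"
      using H.vnorm_nonneg[OF xc(2)] by (simp add: distrib_right)
    also have "\<dots> \<le> (\<bar>K\<bar> + \<bar>M\<bar> + 1) * d" using x(2) KM by (intro mult_left_mono) auto
    also have "\<dots> = e" using KM by (simp add: d_def)
    finally show ?thesis .
  qed
  then have "vnorm H (S \<xi> \<ominus>\<^bsub>H\<^esub> R \<xi>) \<le> 0" by (rule field_le_epsilon[of _ 0, simplified])
  then have "vnorm H (S \<xi> \<ominus>\<^bsub>H\<^esub> R \<xi>) = 0" using H.vnorm_nonneg[of "S \<xi> \<ominus>\<^bsub>H\<^esub> R \<xi>"] cl \<xi> by simp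
  then show ?thesis using cl \<xi> by (simp add: H.vnorm_eq_zero H.diff_eq_zero_iff)
qed

lemma induced_operator_eq: "induced_operator V s T = extension"
  unfolding induced_operator_def
proof (rule the_equality)
  have bl: "bounded_linear_map H extension"
    unfolding bounded_linear_map_def using extension_linear extension_contraction
    by (auto intro!: exI[of _ 1])
  have ex: "extension \<in> extensional (carrier H)" by (simp add: extension_def)
  show "extension \<in> extensional (carrier H) \<and> bounded_linear_map H extension \<and>
      (\<forall>x\<in>carrier V. extension (embed V s x) = embed V s (T x))"
    using bl ex extension_embed by blast
  fix S assume S: "S \<in> extensional (carrier H) \<and> bounded_linear_map H S \<and>
      (\<forall>x\<in>carrier V. S (embed V s x) = embed V s (T x))"
  have "S \<xi> = extension \<xi>" if "\<xi> \<in> carrier H" for \<xi>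
  proof (rule bounded_linear_agree[OF _ bl _ that])
    show "bounded_linear_map H S" using S by blast
    show "S (embed V s x) = extension (embed V s x)" if "x \<in> carrier V" for x
      using S that extension_embed by force
  qed
  then show "S = extension" using extensionalityI[OF conjunct1[OF S] ex] by blast
qed

end

lemma (in semi_inner_product) strong_convergence:
  fixes T :: "'i \<Rightarrow> 'v \<Rightarrow> 'v"
  assumes T: "\<forall>\<^sub>F i in F. seminorm_contraction V s (T i)"
    and lim: "\<And>x. x \<in> carrier V \<Longrightarrow> ((\<lambda>i. p (T i x \<ominus> x)) \<longlongrightarrow> 0) F"
    and \<xi>: "\<xi> \<in> carrier H"
  shows "((\<lambda>i. vnorm H (induced_operator V s (T i) \<xi> \<ominus>\<^bsub>H\<^esub> \<xi>)) \<longlongrightarrow> 0) F"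
proof (rule tendstoI)
  fix e :: real assume e: "0 < e"
  then have e3: "0 < e / 3" by simp
  obtain x where x: "x \<in> carrier V" "vnorm H (\<xi> \<ominus>\<^bsub>H\<^esub> embed V s x) < e / 3"
    using embed_dense[OF \<xi> e3] .
  have "\<forall>\<^sub>F i in F. p (T i x \<ominus> x) < e / 3"
    using order_tendstoD(2)[OF lim[OF x(1)] e3] .
  with T show "\<forall>\<^sub>F i in F. dist (vnorm H (induced_operator V s (T i) \<xi> \<ominus>\<^bsub>H\<^esub> \<xi>)) 0 < e"
  proof eventually_elim
    case (elim i)
    interpret S: seminorm_contraction V s "T i" by (rule elim(1))
    let ?x = "embed V s x" and ?S = "S.extension"
    have Sc: "?S \<eta> \<in> carrier H" if "\<eta> \<in> carrier H" for \<eta>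
      using S.extension_linear that by (auto simp: linear_map_def)
    have xc: "?x \<in> carrier H" using x by simp
    have "?S (\<xi> \<oplus>\<^bsub>H\<^esub> (- 1) \<odot>\<^bsub>H\<^esub> ?x) = ?S \<xi> \<oplus>\<^bsub>H\<^esub> (- 1) \<odot>\<^bsub>H\<^esub> ?S ?x"
      using S.extension_linear \<xi> xc by (simp add: linear_map_def)
    then have "?S \<xi> \<ominus>\<^bsub>H\<^esub> ?S ?x = ?S (\<xi> \<ominus>\<^bsub>H\<^esub> ?x)"
      using \<xi> xc Sc by (simp add: a_minus_def H.minus_scale)
    then have 1: "vnorm H (?S \<xi> \<ominus>\<^bsub>H\<^esub> ?S ?x) < e / 3"
      using S.extension_contraction[of "\<xi> \<ominus>\<^bsub>H\<^esub> ?x"] x \<xi> xc by simp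
    have 2: "vnorm H (?S ?x \<ominus>\<^bsub>H\<^esub> ?x) < e / 3"
      using elim(2) x(1) by (simp add: S.extension_embed embed_diff embed_norm)
    have 3: "vnorm H (?x \<ominus>\<^bsub>H\<^esub> \<xi>) < e / 3"
      using x(2) H.vnorm_minus_commute[OF \<xi> xc] by simp
    have "vnorm H (?S \<xi> \<ominus>\<^bsub>H\<^esub> \<xi>) < e"
      using H.vnorm_diff_triangle[of "?S \<xi>" "?S ?x" \<xi>] H.vnorm_diff_triangle[of "?S ?x" ?x \<xi>]
        1 2 3 Sc \<xi> xc by simp
    then show ?case
      using H.vnorm_nonneg[of "?S \<xi> \<ominus>\<^bsub>H\<^esub> \<xi>"] Sc \<xi> by (simp add: S.induced_operator_eq)
  qed
qed

section \<open>The unit fibre of a Fell bundle\<close>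

text \<open>A positive form is hermitian, because \<open>c s x y + cnj c s y x\<close> is real for \<open>c = 1\<close> and \<open>c = i\<close>.\<close>

lemma (in cstar_algebra) gns_form_semi_inner_product:
  assumes \<phi>: "state A \<phi>" shows "semi_inner_product A (gns_form A \<phi>)"
proof
  fix x y assume x: "x \<in> carrier A" and y: "y \<in> carrier A"
  have nn: "0 \<le> gns_form A \<phi> u u" if "u \<in> carrier A" for u
    using stateD(3)[OF \<phi> positive_star_mult[OF that]] by (simp add: gns_form_def)
  show "0 \<le> Re (gns_form A \<phi> x x)" using nn[OF x] by (simp add: less_eq_complex_def)
  show "gns_form A \<phi> x (c \<odot> y) = c * gns_form A \<phi> x y" for c
    using x y by (simp add: gns_form_def mult_smult_right stateD(2)[OF \<phi>])
  show "gns_form A \<phi> x (y \<oplus> z) = gns_form A \<phi> x y + gns_form A \<phi> x z" if "z \<in> carrier A" for z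
    using x y that by (simp add: gns_form_def mult_add_right stateD(1)[OF \<phi>])
  have Im: "Im (gns_form A \<phi> u u) = 0" if "u \<in> carrier A" for u
    using nn[OF that] by (simp add: less_eq_complex_def)
  have "gns_form A \<phi> (x \<oplus> c \<odot> y) (x \<oplus> c \<odot> y) = gns_form A \<phi> x x + c * gns_form A \<phi> x y
      + cnj c * gns_form A \<phi> y x + cnj c * c * gns_form A \<phi> y y" for c
    using x y by (simp add: gns_form_def star_add star_smult mult_add_left mult_add_right
        mult_smult_left mult_smult_right stateD(1,2)[OF \<phi>] algebra_simps)
  then have "Im (c * gns_form A \<phi> x y + cnj c * gns_form A \<phi> y x) = 0" for c
    using Im[of "x \<oplus> c \<odot> y"] Im[OF x] Im[OF y] x y
    by simp
  from this[of 1] this[of \<i>] show "gns_form A \<phi> y x = cnj (gns_form A \<phi> x y)"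
    by (simp add: complex_eq_iff)
qed

lemma eventually_net_filter: "directed_set I below \<Longrightarrow> \<forall>\<^sub>F i in net_filter I below. i \<in> I"
proof -
  assume "directed_set I below"
  then obtain i where i: "i \<in> I" by (auto simp: directed_set_def)
  have "net_filter I below \<le> principal {j \<in> I. below i j}"
    unfolding net_filter_def by (rule INF_lower[OF i])
  then show ?thesis by (simp add: le_principal eventually_mono)
qed

context fell_bundle
begin

abbreviation "A \<equiv> unit_fibre G B"
abbreviation "E \<equiv> fibre B \<one>\<^bsub>G\<^esub>"

lemma unit_fibre_simps [simp]:
  "carrier A = carrier E" "add A = add E" "zero A = zero E" "smult A = smult E" "vnorm A = vnorm E"
  "mult A = bmult B" "star A = bstar B"
  by (simp_all add: unit_fibre_def Let_def)

text \<open>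
  The unit fibre as a Banach space and as a $C^*$-algebra are different records with the same linear
  structure and norm, hence with the same completions and induced operators.
\<close>

lemma unit_fibre_minus: "a_minus A = a_minus E"
  by (intro ext) (simp add: a_minus_def a_inv_def m_inv_def)

lemma cauchy_seqs_unit_fibre: "cauchy_seqs A s = cauchy_seqs E s"
  unfolding cauchy_seqs_def unit_fibre_minus by simp

lemma seq_class_unit_fibre: "seq_class A s = seq_class E s"
  by (intro ext) (simp add: seq_class_def null_rel_def unit_fibre_minus cauchy_seqs_unit_fibre)

lemma hilbert_completion_unit_fibre: "hilbert_completion A s = hilbert_completion E s"
  by (simp add: hilbert_completion_def seq_class_unit_fibre cauchy_seqs_unit_fibre null_rel_def
      unit_fibre_minus)

lemma induced_operator_unit_fibre: "induced_operator A s T = induced_operator E s T"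
  by (simp add: induced_operator_def hilbert_completion_unit_fibre embed_def seq_class_unit_fibre)

lemma gns_form_unit_fibre: "gns_form A \<psi> = fibre_form B \<psi>"
  by (intro ext) (simp add: gns_form_def fibre_form_def)

lemma linear_map_unit_fibre: "linear_map A T = linear_map E T"
  by (simp add: linear_map_def)

lemma positive_definite_unit:
  assumes "positive_definite G B T" shows "positive_definite_map A (T \<one>\<^bsub>G\<^esub>)"
  unfolding positive_definite_map_def
proof (intro allI impI)
  fix n :: nat and a b assume ab: "\<forall>i<n. a i \<in> carrier A \<and> b i \<in> carrier A"
  show "positive A (\<Oplus>\<^bsub>A\<^esub>i\<in>{..<n}. \<Oplus>\<^bsub>A\<^esub>j\<in>{..<n}.
      b i \<otimes>\<^bsub>A\<^esub> T \<one>\<^bsub>G\<^esub> (star A (a i) \<otimes>\<^bsub>A\<^esub> a j) \<otimes>\<^bsub>A\<^esub> star A (b j))"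
    using assms[unfolded positive_definite_def, rule_format, of n "\<lambda>_. \<one>\<^bsub>G\<^esub>" a b] ab by simp
qed

end

theorem proposition4p7:
  fixes G :: "('g, 'm) monoid_scheme"
    and B :: "('g, 'v, 'b) fell_data_scheme"
    and \<psi> :: "'v \<Rightarrow> complex"
  assumes "fell_bundle G B"
    and "state (unit_fibre G B) \<psi>"
    and "haagerup_bundle TYPE('i) G B \<psi>"
  shows "haagerup_cstar TYPE('i) (unit_fibre G B) \<psi>"
proof -
  interpret fell_bundle G B by fact
  let ?A = "unit_fibre G B" and ?s = "fibre_form B \<psi>"
  interpret A: cstar_algebra ?A by (rule cstar_algebra_unit_fibre)
  interpret form: semi_inner_product ?A "gns_form ?A \<psi>"
    by (rule A.gns_form_semi_inner_product) fact
  obtain I :: "'i set" and below T where I: "directed_set I below"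
    and T: "\<And>i. i \<in> I \<Longrightarrow> bundle_map G B (T i) \<and> positive_definite G B (T i)"
    and contr: "\<And>i. i \<in> I \<Longrightarrow> contractive (fibre B \<one>\<^bsub>G\<^esub>) (T i \<one>\<^bsub>G\<^esub>) \<and> subinvariant ?A \<psi> (T i \<one>\<^bsub>G\<^esub>)"
    and comp: "\<And>i g. i \<in> I \<Longrightarrow> g \<in> carrier G \<Longrightarrow>
      compact_map (fibre_space B \<psi> g) (fibre_operator B \<psi> (T i) g)"
    and lim: "\<And>g b. g \<in> carrier G \<Longrightarrow> b \<in> elems B g \<Longrightarrow>
      ((\<lambda>i. seminorm ?s (T i g b \<ominus>\<^bsub>fibre B g\<^esub> b)) \<longlongrightarrow> 0) (net_filter I below)"
    using assms(3) unfolding haagerup_bundle_def by blast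
  define \<Phi> where "\<Phi> i = T i \<one>\<^bsub>G\<^esub>" for i
  have lin: "linear_map ?A (\<Phi> i)" if "i \<in> I" for i
    using T[OF that] by (auto simp: bundle_map_def bounded_linear_map_def linear_map_unit_fibre \<Phi>_def)
  have pd: "positive_definite_map ?A (\<Phi> i)" if "i \<in> I" for i
    unfolding \<Phi>_def using T[OF that] by (intro positive_definite_unit) blast
  have ct: "contractive ?A (\<Phi> i)" and sub: "subinvariant ?A \<psi> (\<Phi> i)" if "i \<in> I" for i
    using contr[OF that] by (auto simp: contractive_def \<Phi>_def)
  \<comment> \<open>so the operators on the GNS space exist and are contractions\<close>
  have "seminorm_contraction ?A (gns_form ?A \<psi>) (\<Phi> i)" if "i \<in> I" for i
    by unfold_locales
      (use lin[OF that] A.state_seminorm_contraction[OF assms(2) lin pd ct sub] that in auto)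
  then have ev: "\<forall>\<^sub>F i in net_filter I below. seminorm_contraction ?A (gns_form ?A \<psi>) (\<Phi> i)"
    using eventually_net_filter[OF I] by (rule eventually_mono[rotated])
  have strong: "((\<lambda>i. vnorm (gns_space ?A \<psi>)
      (gns_operator ?A \<psi> (\<Phi> i) \<xi> \<ominus>\<^bsub>gns_space ?A \<psi>\<^esub> \<xi>)) \<longlongrightarrow> 0) (net_filter I below)"
    if "\<xi> \<in> carrier (gns_space ?A \<psi>)" for \<xi>
  proof (rule form.strong_convergence[OF ev _ that])
    fix x assume "x \<in> carrier ?A"
    then show "((\<lambda>i. seminorm (gns_form ?A \<psi>) (\<Phi> i x \<ominus>\<^bsub>?A\<^esub> x)) \<longlongrightarrow> 0) (net_filter I below)"
      using lim[of "\<one>\<^bsub>G\<^esub>" x] by (simp add: \<Phi>_def gns_form_unit_fibre unit_fibre_minus)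
  qed
  have compact: "compact_map (gns_space ?A \<psi>) (gns_operator ?A \<psi> (\<Phi> i))" if "i \<in> I" for i
    using comp[OF that one_closed]
    by (simp add: \<Phi>_def gns_form_unit_fibre hilbert_completion_unit_fibre induced_operator_unit_fibre)
  show ?thesis
    unfolding haagerup_cstar_def
    by (intro exI[of _ I] exI[of _ below] exI[of _ \<Phi>] conjI ballI I strong compact sub ct
        A.completely_positive_if_positive_definite lin pd)
qed

end
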